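(* Let $\mathfrak S$ be a (cofinite) arithmetic and centered $G$-semimatroid such that for all $a\in E_{\mathfrak S}$ the group $\Gamma(a)$ is cyclic. For $A\subseteq E_{\mathfrak S}$ write $A^c:=E_{\mathfrak S}\setminus A$ and $M_{\mathfrak S}(A):=\Gamma^{A^c}/h'_{A^c}(G)$. Then: (1) The abelian groups $M_{\mathfrak S}(A)$, $A\subseteq E_{\mathfrak S}$, define a realizable matroid over $\mathbb Z$. (2) If all the groups $\Gamma(a)$, $a\in E_{\mathfrak S}$, are infinite cyclic, then the underlying matroid of $M_{\mathfrak S}$ is the dual of $(E_{\mathfrak S},\underline{\mathrm{rk}})$. (3) If all the groups $\Gamma(a)$ are infinite cyclic and, additionally, $W(A)$ is a pure subgroup of $\Gamma^A$ for every $A\subseteq E_{\mathfrak S}$, then for every $A\subseteq E_{\mathfrak S}$ there is an isomorphism $$M_{\mathfrak S}(A)\simeq \mathbb Z^{|A^c|-\underline{\mathrm{rk}}(A^c)}\oplus W(A^c)/h_{A^c}(G),$$ and the underlying arithmetic matroid of $M_{\mathfrak S}$ is dual to $(E_{\mathfrak S},\underline{\mathrm{rk}},m_{\mathfrak S})$.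
   Context: A finitary semimatroid is a triple $\mathcal S=(S,\mathcal C,\mathrm{rk})$ where $S$ is a (possibly infinite) set, $\mathcal C$ is a non-empty finite-dimensional simplicial complex on $S$ (a family of finite subsets of bounded cardinality, closed under taking subsets) with $\{x\}\in\mathcal C$ for all $x\in S$, and $\mathrm{rk}:\mathcal C\to\mathbb N$ is a bounded function such that: (R1) $0\le \mathrm{rk}(X)\le |X|$; (R2) $X\subseteq Y$ in $\mathcal C$ implies $\mathrm{rk}(X)\le\mathrm{rk}(Y)$; (R3) if $X,Y,X\cup Y\in\mathcal C$ then $\mathrm{rk}(X)+\mathrm{rk}(Y)\ge \mathrm{rk}(X\cup Y)+\mathrm{rk}(X\cap Y)$; (CR1) if $X,Y\in\mathcal C$ and $\mathrm{rk}(X)=\mathrm{rk}(X\cap Y)$ then $X\cup Y\in\mathcal C$; (CR2) if $X,Y\in\mathcal C$ and $\mathrm{rk}(X)<\mathrm{rk}(Y)$ then $X\cup\{y\}\in\mathcal C$ for some $y\in Y\setminus X$. A $G$-semimatroid $\mathfrak S$ is a finitary semimatroid $\mathcal S=(S,\mathcal C,\mathrm{rk})$ with an action of a group $G$ on $S$ whose induced action on $2^S$ preserves centrality (membership in $\mathcal C$) and rank. For $X\subseteq S$ let $\underline X:=\{Gx: x\in X\}$. Put $E_{\mathfrak S}:=S/G$, $\mathcal C_{\mathfrak S}:=\mathcal C/G$, and for $A\subseteq E_{\mathfrak S}$: $\underline{\mathrm{rk}}(A):=\max\{\mathrm{rk}(X): X\in\mathcal C,\ \underline X\subseteq A\}$,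 $\lceil A\rceil^{\mathcal C}:=\{X\in\mathcal C:\underline X=A\}$, $m_{\mathfrak S}(A):=|\lceil A\rceil^{\mathcal C}/G|$. The action is cofinite if $\mathcal C_{\mathfrak S}$ is finite; centered if $\underline X=E_{\mathfrak S}$ for some $X\in\mathcal C$ (then $\lceil A\rceil^{\mathcal C}\neq\emptyset$ for all $A\subseteq E_{\mathfrak S}$); translative if $\{x,g(x)\}\in\mathcal C$ implies $g(x)=x$; normal if $\mathrm{stab}(x)$ is normal in $G$ for all $x\in S$; almost arithmetic if translative and normal. For an almost arithmetic action let $\Gamma(x):=G/\mathrm{stab}(x)$ ($x\in S$) and, for $X\in\mathcal C$, $\Gamma^X:=\prod_{x\in X}\Gamma(x)$, $h'_X:G\to\Gamma^X$, $g\mapsto(g\,\mathrm{stab}(x))_{x\in X}$. For $\gamma\in\Gamma^X$ let $\gamma.X:=\{\gamma_x(x):x\in X\}$ and $W(X):=\{\gamma\in\Gamma^X:\gamma.X\in\mathcal C\}$; the image of $h'_X$ lies in $W(X)$ and $h_X:G\to W(X)$ denotes $h'_X$ with restricted codomain. The action is arithmetic if it is almost arithmetic and $W(X)$ is a subgroup of $\Gamma^X$ for all $X\in\mathcal C$. For arithmetic actions with all groups $\Gamma(x)$ cyclic, $\Gamma^X$, $W(X)$, $h'_X$, $h_X$ do not depend on the choice of $X\in\lceil A\rceil^{\mathcal C}$ (using that $\mathrm{stab}(x)$ depends only on $Gx$), and are denoted $\Gamma^A,W(A),h'_A,h_A$; in particular $\Gamma(a):=\Gamma(x)$ for $x\in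 a\in E_{\mathfrak S}$. A matroid over a commutative ring $Q$ on a finite set $E$ is a function $M:2^E\to Q$-modules such that for any $A\subset E$ and $e_1,e_2\in E$ there is a pushout square with corners $M(A)$, $M(A\cup\{e_1\})$, $M(A\cup\{e_2\})$, $M(A\cup\{e_1,e_2\})$ (maps $M(A)\to M(A\cup\{e_i\})\to M(A\cup\{e_1,e_2\})$) in which all morphisms are surjections with cyclic kernel. It is realizable if there are a finitely generated $Q$-module $N$ and elements $(x_e)_{e\in E}$ of $N$ with $M(A)\cong N/\sum_{e\in A}Qx_e$ for all $A\subseteq E$. A matroid over $\mathbb Z$ induces an arithmetic matroid on $E$ with rank function $r$ given by $r(E)-r(A)=\mathrm{rank}_{\mathbb Z}M(A)$ and multiplicity $m(A)=$ cardinality of the torsion subgroup of $M(A)$; $(E,r)$ is the underlying matroid, $(E,r,m)$ the underlying arithmetic matroid. The dual of a matroid $(E,r)$ has rank function $r^*(A)=r(E\setminus A)+|A|-r(E)$; the dual of an arithmetic matroid $(E,r,m)$ is $(E,r^*,m^* )$ with $m^*(A)=m(E\setminus A)$. A subgroup $W$ of an abelian group $\Gamma$ is pure if $nW=W\cap n\Gamma$ for all integers $n$. *)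

theory Defs
  imports "HOL-Algebra.FiniteProduct" "HOL-Algebra.Group_Action" "HOL-Algebra.Product_Groups"
begin

section \<open>Finitary semimatroids\<close>

locale finitary_semimatroid =
  fixes S :: "'x set" and C :: "'x set set" and rk :: "'x set \<Rightarrow> nat"
  assumes central_nonempty: "C \<noteq> {}"
    and central_finite: "X \<in> C \<Longrightarrow> finite X"
    and central_subset: "X \<in> C \<Longrightarrow> X \<subseteq> S"
    and central_bounded: "\<exists>n. \<forall>X\<in>C. card X \<le> n"
    and central_down_closed: "X \<in> C \<Longrightarrow> Y \<subseteq> X \<Longrightarrow> Y \<in> C"
    and central_singleton: "x \<in> S \<Longrightarrow> {x} \<in> C"
    and rk_bounded: "\<exists>n. \<forall>X\<in>C. rk X \<le> n"
    and R1: "X \<in> C \<Longrightarrow> rk X \<le> card X"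
    and R2: "X \<in> C \<Longrightarrow> Y \<in> C \<Longrightarrow> X \<subseteq> Y \<Longrightarrow> rk X \<le> rk Y"
    and R3: "X \<in> C \<Longrightarrow> Y \<in> C \<Longrightarrow> X \<union> Y \<in> C \<Longrightarrow> rk (X \<union> Y) + rk (X \<inter> Y) \<le> rk X + rk Y"
    and CR1: "X \<in> C \<Longrightarrow> Y \<in> C \<Longrightarrow> rk X = rk (X \<inter> Y) \<Longrightarrow> X \<union> Y \<in> C"
    and CR2: "X \<in> C \<Longrightarrow> Y \<in> C \<Longrightarrow> rk X < rk Y \<Longrightarrow> \<exists>y\<in>Y - X. X \<union> {y} \<in> C"

section \<open>Group actions on semimatroids\<close>

locale G_semimatroid = finitary_semimatroid S C rk + group_action G S \<phi>
  for S :: "'x set" and C :: "'x set set" and rk :: "'x set \<Rightarrow> nat"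
    and G :: "('g, 'm) monoid_scheme" (structure) and \<phi> :: "'g \<Rightarrow> 'x \<Rightarrow> 'x" +
  assumes central_invariant: "g \<in> carrier G \<Longrightarrow> X \<in> C \<Longrightarrow> \<phi> g ` X \<in> C"
    and rk_invariant: "g \<in> carrier G \<Longrightarrow> X \<in> C \<Longrightarrow> rk (\<phi> g ` X) = rk X"

text \<open>The set \<open>E = S/G\<close> is \<^term>\<open>orbits G S \<phi>\<close>; \<open>orbit_set G \<phi> X\<close> is the underlined \<open>X\<close>.\<close>

definition orbit_set :: "('g, 'm) monoid_scheme \<Rightarrow> ('g \<Rightarrow> 'x \<Rightarrow> 'x) \<Rightarrow> 'x set \<Rightarrow> 'x set set"
  where "orbit_set G \<phi> X = orbit G \<phi> ` X"

definition set_action :: "('g \<Rightarrow> 'x \<Rightarrow> 'x) \<Rightarrow> 'g \<Rightarrow> 'x set \<Rightarrow> 'x set"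
  where "set_action \<phi> g X = \<phi> g ` X"

definition orbit_rank ::
    "'x set set \<Rightarrow> ('x set \<Rightarrow> nat) \<Rightarrow> ('g, 'm) monoid_scheme \<Rightarrow> ('g \<Rightarrow> 'x \<Rightarrow> 'x) \<Rightarrow> 'x set set \<Rightarrow> nat"
  where "orbit_rank C rk G \<phi> A = Max {rk X | X. X \<in> C \<and> orbit_set G \<phi> X \<subseteq> A}"

definition central_lifts ::
    "'x set set \<Rightarrow> ('g, 'm) monoid_scheme \<Rightarrow> ('g \<Rightarrow> 'x \<Rightarrow> 'x) \<Rightarrow> 'x set set \<Rightarrow> 'x set set"
  where "central_lifts C G \<phi> A = {X \<in> C. orbit_set G \<phi> X = A}"

definition orbit_mult ::
    "'x set set \<Rightarrow> ('g, 'm) monoid_scheme \<Rightarrow> ('g \<Rightarrow> 'x \<Rightarrow> 'x) \<Rightarrow> 'x set set \<Rightarrow> nat"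
  where "orbit_mult C G \<phi> A = card (orbits G (central_lifts C G \<phi> A) (set_action \<phi>))"

definition cofinite_action ::
    "'x set set \<Rightarrow> ('g, 'm) monoid_scheme \<Rightarrow> ('g \<Rightarrow> 'x \<Rightarrow> 'x) \<Rightarrow> bool"
  where "cofinite_action C G \<phi> \<longleftrightarrow> finite (orbits G C (set_action \<phi>))"

definition centered_action ::
    "'x set \<Rightarrow> 'x set set \<Rightarrow> ('g, 'm) monoid_scheme \<Rightarrow> ('g \<Rightarrow> 'x \<Rightarrow> 'x) \<Rightarrow> bool"
  where "centered_action S C G \<phi> \<longleftrightarrow> (\<exists>X\<in>C. orbit_set G \<phi> X = orbits G S \<phi>)"

definition translative_action ::
    "'x set \<Rightarrow> 'x set set \<Rightarrow> ('g, 'm) monoid_scheme \<Rightarrow> ('g \<Rightarrow> 'x \<Rightarrow> 'x) \<Rightarrow> bool"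
  where "translative_action S C G \<phi> \<longleftrightarrow>
    (\<forall>x\<in>S. \<forall>g\<in>carrier G. {x, \<phi> g x} \<in> C \<longrightarrow> \<phi> g x = x)"

definition normal_action ::
    "'x set \<Rightarrow> ('g, 'm) monoid_scheme \<Rightarrow> ('g \<Rightarrow> 'x \<Rightarrow> 'x) \<Rightarrow> bool"
  where "normal_action S G \<phi> \<longleftrightarrow> (\<forall>x\<in>S. stabilizer G \<phi> x \<lhd> G)"

definition Gam :: "('g, 'm) monoid_scheme \<Rightarrow> ('g \<Rightarrow> 'x \<Rightarrow> 'x) \<Rightarrow> 'x \<Rightarrow> 'g set monoid"
  where "Gam G \<phi> x = G Mod stabilizer G \<phi> x"

definition Gam_set ::
    "('g, 'm) monoid_scheme \<Rightarrow> ('g \<Rightarrow> 'x \<Rightarrow> 'x) \<Rightarrow> 'x set \<Rightarrow> ('x \<Rightarrow> 'g set) monoid"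
  where "Gam_set G \<phi> X = product_group X (Gam G \<phi>)"

text \<open>The common image of \<open>x\<close> under all elements of a coset \<open>c\<close> of its (normal) stabilizer.\<close>

definition coset_action :: "('g \<Rightarrow> 'x \<Rightarrow> 'x) \<Rightarrow> 'g set \<Rightarrow> 'x \<Rightarrow> 'x"
  where "coset_action \<phi> c x = (THE y. \<exists>g\<in>c. y = \<phi> g x)"

definition translate :: "('g \<Rightarrow> 'x \<Rightarrow> 'x) \<Rightarrow> ('x \<Rightarrow> 'g set) \<Rightarrow> 'x set \<Rightarrow> 'x set"
  where "translate \<phi> \<gamma> X = (\<lambda>x. coset_action \<phi> (\<gamma> x) x) ` X"

definition W_set ::
    "'x set set \<Rightarrow> ('g, 'm) monoid_scheme \<Rightarrow> ('g \<Rightarrow> 'x \<Rightarrow> 'x) \<Rightarrow> 'x set \<Rightarrow> ('x \<Rightarrow> 'g set) set"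
  where "W_set C G \<phi> X = {\<gamma> \<in> carrier (Gam_set G \<phi> X). translate \<phi> \<gamma> X \<in> C}"

locale almost_arithmetic_semimatroid = G_semimatroid +
  assumes translative: "translative_action S C G \<phi>"
    and normal: "normal_action S G \<phi>"

locale arithmetic_semimatroid = almost_arithmetic_semimatroid +
  assumes W_subgroup: "X \<in> C \<Longrightarrow> subgroup (W_set C G \<phi> X) (Gam_set G \<phi> X)"

text \<open>
  The same objects indexed by orbits. They are read off from representatives: stabilizers are
  normal, hence constant on orbits, and for abelian \<open>\<Gamma>(x)\<close> the subgroup \<open>W(X)\<close> depends only on the
  set of orbits met by \<open>X\<close>. A translative action makes \<open>X \<rightarrow> A\<close>, \<open>x \<mapsto> Gx\<close> a bijection for every
  \<open>X\<close> in \<open>central_lifts C G \<phi> A\<close>, which identifies the index sets \<open>X\<close> and \<open>A\<close>.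
\<close>

definition orbit_stab :: "('g, 'm) monoid_scheme \<Rightarrow> ('g \<Rightarrow> 'x \<Rightarrow> 'x) \<Rightarrow> 'x set \<Rightarrow> 'g set"
  where "orbit_stab G \<phi> a = stabilizer G \<phi> (SOME x. x \<in> a)"

definition orbit_Gam :: "('g, 'm) monoid_scheme \<Rightarrow> ('g \<Rightarrow> 'x \<Rightarrow> 'x) \<Rightarrow> 'x set \<Rightarrow> 'g set monoid"
  where "orbit_Gam G \<phi> a = G Mod orbit_stab G \<phi> a"

definition orbit_Gam_set ::
    "('g, 'm) monoid_scheme \<Rightarrow> ('g \<Rightarrow> 'x \<Rightarrow> 'x) \<Rightarrow> 'x set set \<Rightarrow> ('x set \<Rightarrow> 'g set) monoid"
  where "orbit_Gam_set G \<phi> A = product_group A (orbit_Gam G \<phi>)"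

definition orbit_h ::
    "('g, 'm) monoid_scheme \<Rightarrow> ('g \<Rightarrow> 'x \<Rightarrow> 'x) \<Rightarrow> 'x set set \<Rightarrow> 'g \<Rightarrow> 'x set \<Rightarrow> 'g set"
  where "orbit_h G \<phi> A g = (\<lambda>a\<in>A. orbit_stab G \<phi> a #>\<^bsub>G\<^esub> g)"

definition orbit_W ::
    "'x set set \<Rightarrow> ('g, 'm) monoid_scheme \<Rightarrow> ('g \<Rightarrow> 'x \<Rightarrow> 'x) \<Rightarrow> 'x set set \<Rightarrow> ('x set \<Rightarrow> 'g set) set"
  where "orbit_W C G \<phi> A =
    (let X = (SOME X. X \<in> central_lifts C G \<phi> A)
     in {\<gamma> \<in> carrier (orbit_Gam_set G \<phi> A). (\<lambda>x\<in>X. \<gamma> (orbit G \<phi> x)) \<in> W_set C G \<phi> X})"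

definition semimatroid_module ::
    "'x set \<Rightarrow> ('g, 'm) monoid_scheme \<Rightarrow> ('g \<Rightarrow> 'x \<Rightarrow> 'x) \<Rightarrow> 'x set set \<Rightarrow> ('x set \<Rightarrow> 'g set) set monoid"
  where "semimatroid_module S G \<phi> A =
    (let B = orbits G S \<phi> - A in orbit_Gam_set G \<phi> B Mod orbit_h G \<phi> B ` carrier G)"

section \<open>Abelian groups\<close>

definition pure_subgroup :: "'a set \<Rightarrow> ('a, 'm) monoid_scheme \<Rightarrow> bool"
  where "pure_subgroup W \<Gamma> \<longleftrightarrow> subgroup W \<Gamma> \<and>
    (\<forall>n::int. (\<lambda>w. w [^]\<^bsub>\<Gamma>\<^esub> n) ` W = W \<inter> (\<lambda>x. x [^]\<^bsub>\<Gamma>\<^esub> n) ` carrier \<Gamma>)"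

definition torsion :: "('a, 'm) monoid_scheme \<Rightarrow> 'a set"
  where "torsion N = {x \<in> carrier N. \<exists>n::nat. n > 0 \<and> x [^]\<^bsub>N\<^esub> n = \<one>\<^bsub>N\<^esub>}"

definition Z_independent :: "('a, 'm) monoid_scheme \<Rightarrow> 'a set \<Rightarrow> bool"
  where "Z_independent N B \<longleftrightarrow> finite B \<and> B \<subseteq> carrier N \<and>
    (\<forall>c :: 'a \<Rightarrow> int. (\<Otimes>\<^bsub>N\<^esub>b\<in>B. b [^]\<^bsub>N\<^esub> c b) = \<one>\<^bsub>N\<^esub> \<longrightarrow> (\<forall>b\<in>B. c b = 0))"

text \<open>Only meaningful when the sizes of independent sets are bounded, e.g. for finitely generated
  abelian groups.\<close>

definition Z_rank :: "('a, 'm) monoid_scheme \<Rightarrow> nat"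
  where "Z_rank N = Max {card B | B. Z_independent N B}"

definition fin_gen :: "('a, 'm) monoid_scheme \<Rightarrow> bool"
  where "fin_gen N \<longleftrightarrow> (\<exists>F. finite F \<and> F \<subseteq> carrier N \<and> generate N F = carrier N)"

definition free_Z :: "nat \<Rightarrow> (nat \<Rightarrow> int) monoid"
  where "free_Z n = product_group {..<n} (\<lambda>_. integer_group)"

definition infinite_cyclic :: "('a, 'm) monoid_scheme \<Rightarrow> bool"
  where "infinite_cyclic N \<longleftrightarrow> cyclic_group N \<and> infinite (carrier N)"

text \<open>
  Pushouts of abelian groups. HOL cannot quantify over the type of the test group \<open>T\<close>; the type
  \<open>('a \<times> 'a) set\<close> is large enough for the universal property to hold for test groups of every
  type, see \<open>is_pushout_universal\<close> below.
\<close>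

definition is_pushout ::
    "'a monoid \<Rightarrow> 'a monoid \<Rightarrow> 'a monoid \<Rightarrow> 'a monoid \<Rightarrow>
     ('a \<Rightarrow> 'a) \<Rightarrow> ('a \<Rightarrow> 'a) \<Rightarrow> ('a \<Rightarrow> 'a) \<Rightarrow> ('a \<Rightarrow> 'a) \<Rightarrow> bool"
  where "is_pushout A B1 B2 P f1 f2 i1 i2 \<longleftrightarrow>
    f1 \<in> hom A B1 \<and> f2 \<in> hom A B2 \<and> i1 \<in> hom B1 P \<and> i2 \<in> hom B2 P \<and>
    (\<forall>a\<in>carrier A. i1 (f1 a) = i2 (f2 a)) \<and>
    (\<forall>(T :: ('a \<times> 'a) set monoid) u1 u2.
       comm_group T \<and> u1 \<in> hom B1 T \<and> u2 \<in> hom B2 T \<and> (\<forall>a\<in>carrier A. u1 (f1 a) = u2 (f2 a)) \<longrightarrow>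
       (\<exists>!w. w \<in> hom P T \<and> w \<in> extensional (carrier P) \<and>
          (\<forall>b\<in>carrier B1. w (i1 b) = u1 b) \<and> (\<forall>b\<in>carrier B2. w (i2 b) = u2 b)))"

lemma comm_group_transport:
  fixes Q :: "('b, 'm) monoid_scheme" and r :: "'b \<Rightarrow> 'c"
  assumes Q: "comm_group Q" and r: "inj_on r (carrier Q)"
  obtains T :: "'c monoid" where "comm_group T" "r \<in> iso Q T"
proof -
  interpret Q: comm_group Q by (rule Q)
  define q where "q = the_inv_into (carrier Q) r"
  define T where "T = \<lparr>carrier = r ` carrier Q,
    monoid.mult = (\<lambda>x y. r (q x \<otimes>\<^bsub>Q\<^esub> q y)), one = r \<one>\<^bsub>Q\<^esub>\<rparr>"
  have q [simp]: "q (r x) = x" if "x \<in> carrier Q" for x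
    using that r by (simp add: q_def the_inv_into_f_f)
  have iso: "r \<in> iso Q T"
    using r by (auto simp: iso_def hom_def T_def bij_betw_def)
  have "comm_group (T\<lparr>one := r \<one>\<^bsub>Q\<^esub>\<rparr>)"
    using Q.iso_imp_img_comm_group[OF iso] .
  then show thesis using that iso by (simp add: T_def)
qed

lemma mult_image_subgroup:
  assumes "comm_group B1" "comm_group B2" "comm_group T" "u1 \<in> hom B1 T" "u2 \<in> hom B2 T"
  shows "subgroup ((\<lambda>(b, c). u1 b \<otimes>\<^bsub>T\<^esub> u2 c) ` (carrier B1 \<times> carrier B2)) T"
proof -
  interpret B1: comm_group B1 by fact
  interpret B2: comm_group B2 by fact
  interpret T: comm_group T by fact
  interpret B: group "B1 \<times>\<times> B2"
    by (simp add: DirProd_group B1.group_axioms B2.group_axioms)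
  have "(\<lambda>(b, c). u1 b \<otimes>\<^bsub>T\<^esub> u2 c) \<in> hom (B1 \<times>\<times> B2) T"
    using assms(4,5) by (auto simp: hom_def Pi_iff T.m_ac)
  then interpret group_hom "B1 \<times>\<times> B2" T "\<lambda>(b, c). u1 b \<otimes>\<^bsub>T\<^esub> u2 c"
    by (simp add: group_hom_def group_hom_axioms_def B.group_axioms T.group_axioms)
  show ?thesis using img_is_subgroup by simp
qed

lemma is_pushout_universal:
  fixes A B1 B2 P :: "'a monoid" and T :: "('t, 'm) monoid_scheme"
  assumes grp: "comm_group A" "comm_group B1" "comm_group B2" "comm_group P" "comm_group T"
    and po: "is_pushout A B1 B2 P f1 f2 i1 i2"
    and u: "u1 \<in> hom B1 T" "u2 \<in> hom B2 T" "\<And>a. a \<in> carrier A \<Longrightarrow> u1 (f1 a) = u2 (f2 a)"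
  shows "\<exists>!w. w \<in> hom P T \<and> w \<in> extensional (carrier P) \<and>
    (\<forall>b\<in>carrier B1. w (i1 b) = u1 b) \<and> (\<forall>b\<in>carrier B2. w (i2 b) = u2 b)"
proof -
  interpret A: comm_group A by fact
  interpret B1: comm_group B1 by fact
  interpret B2: comm_group B2 by fact
  interpret P: comm_group P by fact
  interpret T: comm_group T by fact
  from po have f: "f1 \<in> hom A B1" "f2 \<in> hom A B2" and i: "i1 \<in> hom B1 P" "i2 \<in> hom B2 P"
    and comm: "\<And>a. a \<in> carrier A \<Longrightarrow> i1 (f1 a) = i2 (f2 a)"
    by (auto simp: is_pushout_def)
  have univ: "\<exists>!w. w \<in> hom P T' \<and> w \<in> extensional (carrier P) \<and>
      (\<forall>b\<in>carrier B1. w (i1 b) = v1 b) \<and> (\<forall>b\<in>carrier B2. w (i2 b) = v2 b)"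
    if "comm_group T'" "v1 \<in> hom B1 T'" "v2 \<in> hom B2 T'"
      "\<And>a. a \<in> carrier A \<Longrightarrow> v1 (f1 a) = v2 (f2 a)" for T' :: "('a \<times> 'a) set monoid" and v1 v2
    using po that unfolding is_pushout_def by blast
  define I where "I = (\<lambda>(b, c). i1 b \<otimes>\<^bsub>P\<^esub> i2 c) ` (carrier B1 \<times> carrier B2)"
  have subI: "subgroup I P"
    unfolding I_def by (intro mult_image_subgroup grp i)
  have normI: "I \<lhd> P" by (rule P.subgroup_imp_normal[OF subI])
  interpret I: normal I P by (rule normI)
  have i1I: "i1 b \<in> I" if "b \<in> carrier B1" for b
  proof -
    have "i1 b \<otimes>\<^bsub>P\<^esub> i2 \<one>\<^bsub>B2\<^esub> \<in> I" unfolding I_def using that by force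
    then show ?thesis
      using i that by (simp add: hom_one[OF i(2) B2.group_axioms P.group_axioms] hom_in_carrier)
  qed
  have i2I: "i2 c \<in> I" if "c \<in> carrier B2" for c
  proof -
    have "i1 \<one>\<^bsub>B1\<^esub> \<otimes>\<^bsub>P\<^esub> i2 c \<in> I" unfolding I_def using that by force
    then show ?thesis
      using i that by (simp add: hom_one[OF i(1) B1.group_axioms P.group_axioms] hom_in_carrier)
  qed
  have generates: "carrier P \<subseteq> I"
  proof
    fix p assume p: "p \<in> carrier P"
    have cQ: "comm_group (P Mod I)" by (rule P.abelian_FactGroup[OF subI])
    have "inj_on (\<lambda>X. (\<lambda>x. (x, x)) ` X) (carrier (P Mod I))"
      by (rule inj_onI) (force simp: set_eq_iff)
    then obtain T' :: "('a \<times> 'a) set monoid"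
      where T': "comm_group T'" and r: "(\<lambda>X. (\<lambda>x. (x, x)) ` X) \<in> iso (P Mod I) T'" (is "?r \<in> _")
      by (rule comm_group_transport[OF cQ])
    interpret T': comm_group T' by (rule T')
    interpret Q: comm_group "P Mod I" by (rule cQ)
    have rhom: "?r \<in> hom (P Mod I) T'" and rinj: "inj_on ?r (carrier (P Mod I))"
      using r by (auto simp: iso_def bij_betw_def)
    have r1: "?r I = \<one>\<^bsub>T'\<^esub>"
      using hom_one[OF rhom Q.group_axioms T'.group_axioms] by simp
    define w1 where "w1 = restrict (\<lambda>p. ?r (I #>\<^bsub>P\<^esub> p)) (carrier P)"
    define w0 where "w0 = restrict (\<lambda>p. \<one>\<^bsub>T'\<^esub>) (carrier P)"
    have w1: "w1 \<in> hom P T'"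
      using hom_compose[OF I.r_coset_hom_Mod rhom] by (auto simp: hom_def Pi_iff w1_def)
    have w0: "w0 \<in> hom P T'" by (auto simp: hom_def w0_def)
    have triv: "(\<lambda>_. \<one>\<^bsub>T'\<^esub>) \<in> hom B1 T'" "(\<lambda>_. \<one>\<^bsub>T'\<^esub>) \<in> hom B2 T'" by (auto simp: hom_def)
    have coset: "I #>\<^bsub>P\<^esub> x = I" if "x \<in> I" for x
      using that subI by (meson P.coset_join2 I.mem_carrier)
    define R where "R w \<longleftrightarrow> w \<in> hom P T' \<and> w \<in> extensional (carrier P) \<and>
        (\<forall>b\<in>carrier B1. w (i1 b) = \<one>\<^bsub>T'\<^esub>) \<and> (\<forall>b\<in>carrier B2. w (i2 b) = \<one>\<^bsub>T'\<^esub>)" for w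
    have "R w1"
      unfolding R_def using w1 i by (simp add: w1_def hom_in_carrier coset i1I i2I r1)
    moreover have "R w0"
      unfolding R_def using w0 i by (simp add: w0_def hom_in_carrier)
    moreover have "\<exists>!w. R w"
      unfolding R_def by (rule univ[OF T' triv refl])
    ultimately have "w1 = w0" by blast
    have "?r (I #>\<^bsub>P\<^esub> p) = w1 p" using p by (simp only: w1_def restrict_apply')
    also have "\<dots> = w0 p" by (simp only: \<open>w1 = w0\<close>)
    also have "\<dots> = ?r I" using p by (simp only: w0_def restrict_apply' r1)
    finally have "?r (I #>\<^bsub>P\<^esub> p) = ?r I" .
    moreover have "I #>\<^bsub>P\<^esub> p \<in> carrier (P Mod I)" "I \<in> carrier (P Mod I)"
      using p Q.one_closed by (auto simp: FactGroup_def RCOSETS_def)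
    ultimately have "I #>\<^bsub>P\<^esub> p = I" using rinj by (blast dest: inj_onD)
    then show "p \<in> I" using P.coset_join1[OF _ p subI] by blast
  qed
  define q where "q t = {(b, c). b \<in> carrier B1 \<and> c \<in> carrier B2 \<and> u1 b \<otimes>\<^bsub>T\<^esub> u2 c = t}" for t
  define H where "H = (\<lambda>(b, c). u1 b \<otimes>\<^bsub>T\<^esub> u2 c) ` (carrier B1 \<times> carrier B2)"
  have subH: "subgroup H T"
    unfolding H_def by (intro mult_image_subgroup grp u)
  have u1H: "u1 b \<in> H" if "b \<in> carrier B1" for b
  proof -
    have "u1 b \<otimes>\<^bsub>T\<^esub> u2 \<one>\<^bsub>B2\<^esub> \<in> H" unfolding H_def using that by force
    then show ?thesis
      using u that by (simp add: hom_one[OF u(2) B2.group_axioms T.group_axioms] hom_in_carrier)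
  qed
  have u2H: "u2 c \<in> H" if "c \<in> carrier B2" for c
  proof -
    have "u1 \<one>\<^bsub>B1\<^esub> \<otimes>\<^bsub>T\<^esub> u2 c \<in> H" unfolding H_def using that by force
    then show ?thesis
      using u that by (simp add: hom_one[OF u(1) B1.group_axioms T.group_axioms] hom_in_carrier)
  qed
  have cTH: "comm_group (T\<lparr>carrier := H\<rparr>)"
    by (rule group.group_comm_groupI[OF subgroup.subgroup_is_group[OF subH T.group_axioms]])
      (simp add: T.m_comm subgroup.mem_carrier[OF subH])
  have "inj_on q (carrier (T\<lparr>carrier := H\<rparr>))"
    by (rule inj_onI) (fastforce simp: q_def H_def)
  then obtain T' :: "('a \<times> 'a) set monoid"
    where T': "comm_group T'" and q: "q \<in> iso (T\<lparr>carrier := H\<rparr>) T'"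
    by (rule comm_group_transport[OF cTH])
  have qhom: "q \<in> hom (T\<lparr>carrier := H\<rparr>) T'" and qinj: "inj_on q H"
    using q by (auto simp: iso_def bij_betw_def)
  have s: "inv_into H q \<in> hom T' (T\<lparr>carrier := H\<rparr>)"
    using group.iso_set_sym[OF comm_group.axioms(2)[OF cTH] q] by (simp add: iso_def)
  have "q \<circ> u1 \<in> hom B1 T'" "q \<circ> u2 \<in> hom B2 T'"
    using u u1H u2H qhom by (auto simp: hom_def Pi_iff)
  from univ[OF T' this] obtain w where w: "w \<in> hom P T'"
      "\<And>b. b \<in> carrier B1 \<Longrightarrow> w (i1 b) = q (u1 b)" "\<And>b. b \<in> carrier B2 \<Longrightarrow> w (i2 b) = q (u2 b)"
    using u(3) by auto
  have ex: "restrict (inv_into H q \<circ> w) (carrier P) \<in> hom P T"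
    using w(1) s subgroup.subset[OF subH] by (auto simp: hom_def Pi_iff)
  show ?thesis
  proof (rule ex1I[of _ "restrict (inv_into H q \<circ> w) (carrier P)"])
    show "restrict (inv_into H q \<circ> w) (carrier P) \<in> hom P T \<and>
        restrict (inv_into H q \<circ> w) (carrier P) \<in> extensional (carrier P) \<and>
        (\<forall>b\<in>carrier B1. restrict (inv_into H q \<circ> w) (carrier P) (i1 b) = u1 b) \<and>
        (\<forall>b\<in>carrier B2. restrict (inv_into H q \<circ> w) (carrier P) (i2 b) = u2 b)"
      using ex i w u1H u2H qinj by (auto simp: hom_in_carrier)
    fix w' assume w': "w' \<in> hom P T \<and> w' \<in> extensional (carrier P) \<and>
      (\<forall>b\<in>carrier B1. w' (i1 b) = u1 b) \<and> (\<forall>b\<in>carrier B2. w' (i2 b) = u2 b)"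
    show "w' = restrict (inv_into H q \<circ> w) (carrier P)"
    proof (rule extensionalityI[of _ "carrier P"])
      fix p assume "p \<in> carrier P"
      then obtain b c where p: "b \<in> carrier B1" "c \<in> carrier B2" "p = i1 b \<otimes>\<^bsub>P\<^esub> i2 c"
        using generates by (auto simp: I_def)
      have bc: "i1 b \<in> carrier P" "i2 c \<in> carrier P" using p i by (auto simp: hom_in_carrier)
      have "w' p = u1 b \<otimes>\<^bsub>T\<^esub> u2 c" using w' bc p hom_mult[of w' P T] by simp
      moreover have "restrict (inv_into H q \<circ> w) (carrier P) p = u1 b \<otimes>\<^bsub>T\<^esub> u2 c"
        unfolding p(3) hom_mult[OF ex bc] using bc p w u1H u2H qinj by simp
      ultimately show "w' p = restrict (inv_into H q \<circ> w) (carrier P) p" by simp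
    qed (use w' in auto)
  qed
qed

section \<open>Matroids and matroids over the integers\<close>

definition matroid :: "'e set \<Rightarrow> ('e set \<Rightarrow> nat) \<Rightarrow> bool"
  where "matroid E r \<longleftrightarrow> finite E \<and>
    (\<forall>A\<subseteq>E. r A \<le> card A) \<and>
    (\<forall>A B. A \<subseteq> B \<and> B \<subseteq> E \<longrightarrow> r A \<le> r B) \<and>
    (\<forall>A\<subseteq>E. \<forall>B\<subseteq>E. r (A \<union> B) + r (A \<inter> B) \<le> r A + r B)"

text \<open>The subtraction does not truncate when \<open>(E, r)\<close> is a matroid.\<close>

definition dual_rank :: "'e set \<Rightarrow> ('e set \<Rightarrow> nat) \<Rightarrow> 'e set \<Rightarrow> nat"
  where "dual_rank E r A = r (E - A) + card A - r E"

definition dual_mult :: "'e set \<Rightarrow> ('e set \<Rightarrow> nat) \<Rightarrow> 'e set \<Rightarrow> nat"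
  where "dual_mult E m A = m (E - A)"

definition epi_cyclic_kernel :: "'a monoid \<Rightarrow> 'a monoid \<Rightarrow> ('a \<Rightarrow> 'a) \<Rightarrow> bool"
  where "epi_cyclic_kernel M N f \<longleftrightarrow>
    f \<in> epi M N \<and> cyclic_group (M\<lparr>carrier := kernel M N f\<rparr>)"

text \<open>Modules over the integers are abelian groups, written multiplicatively as in the library.\<close>

definition matroid_over_Z :: "'e set \<Rightarrow> ('e set \<Rightarrow> 'a monoid) \<Rightarrow> bool"
  where "matroid_over_Z E M \<longleftrightarrow> finite E \<and> (\<forall>A\<subseteq>E. comm_group (M A)) \<and>
    (\<forall>A\<subseteq>E. \<forall>e1\<in>E. \<forall>e2\<in>E. \<exists>f1 f2 i1 i2.
       is_pushout (M A) (M (A \<union> {e1})) (M (A \<union> {e2})) (M (A \<union> {e1, e2})) f1 f2 i1 i2 \<and>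
       epi_cyclic_kernel (M A) (M (A \<union> {e1})) f1 \<and>
       epi_cyclic_kernel (M A) (M (A \<union> {e2})) f2 \<and>
       epi_cyclic_kernel (M (A \<union> {e1})) (M (A \<union> {e1, e2})) i1 \<and>
       epi_cyclic_kernel (M (A \<union> {e2})) (M (A \<union> {e1, e2})) i2)"

text \<open>Taking \<open>N\<close> over the same type as \<open>M\<close> is no restriction, since \<open>N\<close> is isomorphic to
  \<open>M {}\<close>.\<close>

definition realizable_over_Z :: "'e set \<Rightarrow> ('e set \<Rightarrow> 'a monoid) \<Rightarrow> bool"
  where "realizable_over_Z E M \<longleftrightarrow>
    (\<exists>(N :: 'a monoid) x. comm_group N \<and> fin_gen N \<and> x \<in> E \<rightarrow> carrier N \<and>
       (\<forall>A\<subseteq>E. M A \<cong> N Mod generate N (x ` A)))"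

text \<open>\<open>underlying_matroid E M r\<close>: the rank function of the underlying matroid of \<open>M\<close> is \<open>r\<close>
  (being a rank function, \<open>r {} = 0\<close>, so \<open>r\<close> is determined on subsets of \<open>E\<close>).\<close>

definition underlying_matroid :: "'e set \<Rightarrow> ('e set \<Rightarrow> 'a monoid) \<Rightarrow> ('e set \<Rightarrow> nat) \<Rightarrow> bool"
  where "underlying_matroid E M r \<longleftrightarrow> matroid E r \<and>
    (\<forall>A\<subseteq>E. int (r E) - int (r A) = int (Z_rank (M A)))"

definition underlying_arithmetic_matroid ::
    "'e set \<Rightarrow> ('e set \<Rightarrow> 'a monoid) \<Rightarrow> ('e set \<Rightarrow> nat) \<Rightarrow> ('e set \<Rightarrow> nat) \<Rightarrow> bool"
  where "underlying_arithmetic_matroid E M r m \<longleftrightarrow> underlying_matroid E M r \<and>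
    (\<forall>A\<subseteq>E. m A = card (torsion (M A)))"

end

theory Submission
  imports Defs "HOL-Algebra.Multiplicative_Group"
begin

text \<open>
  Why the theorem holds. For a set \<open>B\<close> of orbits let \<open>\<Gamma>\<^sup>B\<close> be the product of the groups \<open>\<Gamma>(a)\<close>,
  \<open>a \<in> B\<close>, and let \<open>L\<^sub>B\<close> be the image of \<open>G\<close> in it, so that \<open>M(A) = \<Gamma>\<^sup>B / L\<^sub>B\<close> for the
  complement \<open>B\<close> of \<open>A\<close>.

  Part (1) is independent of the semimatroid. Deleting the coordinates in \<open>A\<close> is an epimorphism
  \<open>\<Gamma>\<^sup>E \<rightarrow> M(A)\<close>, and putting one further element \<open>e\<close> into \<open>A\<close> enlarges its kernel by exactly the
  cyclic subgroup generated by a generator of the factor \<open>\<Gamma>(e)\<close> (\<open>kernel_quot_map_insert\<close>). A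
  family of quotients of one abelian group with this property is a matroid over the integers,
  realized by the images of these generators in \<open>M({})\<close> (locale \<open>elementwise_quotients\<close>); as
  \<open>M(E)\<close> is trivial, these images generate \<open>M({})\<close>.

  Part (2). All central sets meeting the same set \<open>B\<close> of orbits have the same rank, since CR2 would
  otherwise put two points of one orbit into a central set, which translativity forbids. So the
  rank of \<open>B\<close> can be read off inside one fixed central set that meets every orbit once, and
  matroid axioms are inherited from there. It remains to see that \<open>L\<^sub>B\<close> has rank \<open>r(B)\<close>. Let
  \<open>I \<subseteq> B\<close> be a basis. By CR1, a translation of a central lift \<open>X\<close> of \<open>B\<close> which keeps \<open>X\<close> central
  and fixes the points over \<open>I\<close> is trivial (\<open>translate_eq_of_fixes_basis\<close>); so \<open>L\<^sub>B\<close> injects into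
  \<open>\<Gamma>\<^sup>I\<close>. By CR2, every translate of a lift of \<open>I\<close> is central
  (\<open>independent_translate_central\<close>); the cosets of \<open>L\<^sub>I\<close> in \<open>\<Gamma>\<^sup>I\<close> are therefore the orbits of
  central lifts of \<open>I\<close>, of which there are finitely many by cofiniteness. So \<open>L\<^sub>I\<close> has finite index
  in \<open>\<Gamma>\<^sup>I\<close>. The two facts together say that the generators of the factors \<open>\<Gamma>(a)\<close>, \<open>a \<in> B - I\<close>, are
  independent in \<open>\<Gamma>\<^sup>B / L\<^sub>B\<close> and span it up to torsion (\<open>Z_rank_quot\<close>).

  Part (3). The orbits of central lifts of \<open>B\<close> correspond to the elements of \<open>W(B) / L\<^sub>B\<close>
  (\<open>translation_cosets_biject_lift_orbits\<close>), so this group is finite of order \<open>m(B)\<close>. Purity of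
  \<open>W(B)\<close> says that nothing else in \<open>\<Gamma>\<^sup>B / L\<^sub>B\<close> is torsion (\<open>torsion_quot\<close>). The claimed
  isomorphism is then the splitting of a finitely generated abelian group into a free part and its
  torsion subgroup (\<open>fin_gen_iso_free_times_torsion\<close>).
\<close>

section \<open>Integer combinations in abelian groups\<close>

text \<open>
  Independence and spanning are formulated for indexed families. Families may repeat an element, so
  they can be mapped along homomorphisms and changed one entry at a time without any
  injectivity condition; independent families turn out to be injective anyway.
\<close>

definition int_comb :: "('a, 'm) monoid_scheme \<Rightarrow> 'i set \<Rightarrow> ('i \<Rightarrow> 'a) \<Rightarrow> ('i \<Rightarrow> int) \<Rightarrow> 'a"
  where "int_comb N I y c = (\<Otimes>\<^bsub>N\<^esub>i\<in>I. y i [^]\<^bsub>N\<^esub> c i)"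

definition spanning_family :: "('a, 'm) monoid_scheme \<Rightarrow> 'i set \<Rightarrow> ('i \<Rightarrow> 'a) \<Rightarrow> bool"
  where "spanning_family N I y \<longleftrightarrow> finite I \<and> y \<in> I \<rightarrow> carrier N \<and>
    (\<forall>x\<in>carrier N. \<exists>c. x = int_comb N I y c)"

definition independent_family :: "('a, 'm) monoid_scheme \<Rightarrow> 'i set \<Rightarrow> ('i \<Rightarrow> 'a) \<Rightarrow> bool"
  where "independent_family N I y \<longleftrightarrow> finite I \<and> y \<in> I \<rightarrow> carrier N \<and>
    (\<forall>c. int_comb N I y c = \<one>\<^bsub>N\<^esub> \<longrightarrow> (\<forall>i\<in>I. c i = 0))"

text \<open>
  Elimination over the integers: if the column \<open>j\<close> has a nonzero entry in row \<open>p\<close>, cross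
  multiplication clears the column in all other rows, and a dependency of these extends to \<open>p\<close>.
\<close>

lemma int_dependency:
  fixes a :: "'i \<Rightarrow> 'j \<Rightarrow> int"
  assumes "finite J" "finite I" "card J < card I"
  shows "\<exists>c :: 'i \<Rightarrow> int. (\<exists>i\<in>I. c i \<noteq> 0) \<and> (\<forall>j\<in>J. (\<Sum>i\<in>I. c i * a i j) = 0)"
  using assms
proof (induction J arbitrary: I a rule: finite_induct)
  case empty
  then have "I \<noteq> {}" by auto
  then show ?case by (intro exI[of _ "\<lambda>_. 1"]) auto
next
  case (insert j J)
  show ?case
  proof (cases "\<forall>i\<in>I. a i j = 0")
    case True
    from insert.IH[of I a] insert.prems insert.hyps
    obtain c where "\<exists>i\<in>I. c i \<noteq> 0" "\<forall>j\<in>J. (\<Sum>i\<in>I. c i * a i j) = 0" by auto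
    with True show ?thesis by (intro exI[of _ c]) auto
  next
    case False
    then obtain p where p: "p \<in> I" "a p j \<noteq> 0" by blast
    define I' where "I' = I - {p}"
    have I': "I = insert p I'" "p \<notin> I'" "finite I'" "card J < card I'"
      using p insert.prems insert.hyps by (auto simp: I'_def)
    from insert.IH[of I' "\<lambda>i k. a p j * a i k - a i j * a p k"] I'(3,4)
    obtain c where c: "\<exists>i\<in>I'. c i \<noteq> 0"
      "\<And>k. k \<in> J \<Longrightarrow> (\<Sum>i\<in>I'. c i * (a p j * a i k - a i j * a p k)) = 0" by blast
    (* The coefficient at p is chosen to kill column j; the factor a p j avoids a division by it. *)
    define d where "d = (\<lambda>i. if i = p then - (\<Sum>i\<in>I'. c i * a i j) else a p j * c i)"
    have sum_d: "(\<Sum>i\<in>I. d i * a i k) =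
        - (\<Sum>i\<in>I'. c i * a i j) * a p k + (\<Sum>i\<in>I'. a p j * c i * a i k)" for k
    proof -
      have "(\<Sum>i\<in>I'. d i * a i k) = (\<Sum>i\<in>I'. a p j * c i * a i k)"
        by (rule sum.cong) (use I'(2) in \<open>auto simp: d_def\<close>)
      then show ?thesis unfolding I'(1) using I' by (simp add: d_def)
    qed
    have "(\<Sum>i\<in>I. d i * a i k) = 0" if "k \<in> insert j J" for k
    proof (cases "k = j")
      case True
      then show ?thesis unfolding sum_d
        by (simp add: sum_distrib_left sum_distrib_right flip: sum_negf) (simp add: mult_ac sum_negf)
    next
      case False
      with that c(2)[of k] have "(\<Sum>i\<in>I'. c i * (a p j * a i k - a i j * a p k)) = 0" by auto
      then show ?thesis unfolding sum_d
        by (simp add: sum_distrib_left sum_distrib_right sum_subtractf algebra_simps)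
    qed
    moreover have "\<exists>i\<in>I. d i \<noteq> 0"
      using c(1) I'(1,2) p(2) by (auto simp: d_def)
    ultimately show ?thesis by blast
  qed
qed

context comm_group
begin

lemma int_comb_closed [simp]: "y \<in> I \<rightarrow> carrier G \<Longrightarrow> int_comb G I y c \<in> carrier G"
  unfolding int_comb_def by (intro finprod_closed) auto

lemma int_comb_insert:
  "finite I \<Longrightarrow> i \<notin> I \<Longrightarrow> y \<in> insert i I \<rightarrow> carrier G \<Longrightarrow>
    int_comb G (insert i I) y c = y i [^] c i \<otimes> int_comb G I y c"
  unfolding int_comb_def by (subst finprod_insert) auto

lemma int_comb_cong:
  assumes "y \<in> I \<rightarrow> carrier G" "\<And>i. i \<in> I \<Longrightarrow> z i = y i" "\<And>i. i \<in> I \<Longrightarrow> d i = c i"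
  shows "int_comb G I z d = int_comb G I y c"
  unfolding int_comb_def by (rule finprod_cong') (use assms in auto)

lemma int_comb_zero: "(\<And>i. i \<in> I \<Longrightarrow> c i = 0) \<Longrightarrow> int_comb G I y c = \<one>"
  unfolding int_comb_def by (rule finprod_one_eqI) simp

lemma int_comb_add:
  "y \<in> I \<rightarrow> carrier G \<Longrightarrow>
    int_comb G I y (\<lambda>i. c i + d i) = int_comb G I y c \<otimes> int_comb G I y d"
  unfolding int_comb_def
  by (subst finprod_multf[symmetric]) (auto intro!: finprod_cong' int_pow_mult dest: Pi_mem)

lemma int_comb_pow:
  fixes n :: int
  assumes "finite I" "y \<in> I \<rightarrow> carrier G"
  shows "int_comb G I y c [^] n = int_comb G I y (\<lambda>i. n * c i)"
  using assms
proof (induction I rule: finite_induct)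
  case empty
  then show ?case by (simp add: int_comb_def)
next
  case (insert i I)
  then have "y \<in> I \<rightarrow> carrier G" "y i \<in> carrier G" by auto
  with insert show ?case
    by (simp add: int_comb_insert int_pow_distrib int_pow_pow mult.commute)
qed

lemma int_comb_remove:
  "finite I \<Longrightarrow> i \<in> I \<Longrightarrow> y \<in> I \<rightarrow> carrier G \<Longrightarrow>
    int_comb G I y c = y i [^] c i \<otimes> int_comb G (I - {i}) y c"
  using int_comb_insert[of "I - {i}" i y c] by (simp add: insert_absorb)

lemma int_comb_swap:
  fixes a :: "'i \<Rightarrow> 'j \<Rightarrow> int"
  assumes "finite I" "finite J" "y \<in> J \<rightarrow> carrier G"
  shows "int_comb G I (\<lambda>i. int_comb G J y (a i)) c = int_comb G J y (\<lambda>j. \<Sum>i\<in>I. c i * a i j)"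
  using assms(1)
proof (induction I rule: finite_induct)
  case empty
  then show ?case by (simp add: int_comb_zero) (simp add: int_comb_def)
next
  case (insert i I)
  then show ?case
    using assms(2,3)
    by (subst int_comb_insert) (auto simp: int_comb_pow int_comb_add)
qed

lemma int_comb_reindex:
  "inj_on f I \<Longrightarrow> y \<in> f ` I \<rightarrow> carrier G \<Longrightarrow>
    int_comb G (f ` I) y c = int_comb G I (y \<circ> f) (c \<circ> f)"
  unfolding int_comb_def by (subst finprod_reindex) auto

lemma int_comb_mem_generate:
  assumes "finite I" "y \<in> I \<rightarrow> carrier G" shows "int_comb G I y c \<in> generate G (y ` I)"
proof -
  have "subgroup (generate G (y ` I)) G"
    using assms by (intro generate_is_subgroup) auto
  then interpret H: subgroup "generate G (y ` I)" G .
  have "int_comb G K y c \<in> generate G (y ` I)" if "finite K" "K \<subseteq> I" for K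
    using that
  proof (induction K rule: finite_induct)
    case empty
    then show ?case using H.one_closed by (simp add: int_comb_def)
  next
    case (insert i K)
    then have "y \<in> insert i K \<rightarrow> carrier G" using assms by auto
    moreover have "y i [^] c i \<in> generate G (y ` I)"
      using insert by (intro subgroup_int_pow_closed H.subgroup_axioms generate.incl) auto
    ultimately show ?case using insert by (simp add: int_comb_insert)
  qed
  then show ?thesis using assms by blast
qed

lemma generate_eq_int_comb:
  assumes "finite I" "y \<in> I \<rightarrow> carrier G"
  shows "generate G (y ` I) = range (int_comb G I y)"
proof
  show "range (int_comb G I y) \<subseteq> generate G (y ` I)"
    using int_comb_mem_generate[OF assms] by blast
  show "generate G (y ` I) \<subseteq> range (int_comb G I y)"
  proof (rule generate_subgroup_incl)
    show "y ` I \<subseteq> range (int_comb G I y)"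
    proof
      fix x assume "x \<in> y ` I"
      then obtain i where i: "i \<in> I" "x = y i" by blast
      moreover have "int_comb G (I - {i}) y (\<lambda>k. if k = i then 1 else 0) = \<one>"
        by (rule int_comb_zero) auto
      ultimately have "int_comb G I y (\<lambda>k. if k = i then 1 else 0) = y i"
        using assms by (subst int_comb_remove[of I i]) (auto simp: Pi_iff)
      then show "x \<in> range (int_comb G I y)" using i(2) by (metis rangeI)
    qed
    show "subgroup (range (int_comb G I y)) G"
    proof (rule subgroupI)
      fix u v assume "u \<in> range (int_comb G I y)" "v \<in> range (int_comb G I y)"
      then obtain c d where uv: "u = int_comb G I y c" "v = int_comb G I y d" by auto
      show "u \<otimes> v \<in> range (int_comb G I y)"
        unfolding uv int_comb_add[OF assms(2), symmetric] by blast
      have "inv u = u [^] (-1::int)" using assms uv by (simp add: int_pow_neg)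
      also have "\<dots> \<in> range (int_comb G I y)"
        unfolding uv int_comb_pow[OF assms] by blast
      finally show "inv u \<in> range (int_comb G I y)" .
    qed (use assms in auto)
  qed
qed

lemma Z_independent_iff_family: "Z_independent G B \<longleftrightarrow> independent_family G B (\<lambda>b. b)"
  by (auto simp: Z_independent_def independent_family_def int_comb_def)

lemma independent_family_inj:
  assumes "independent_family G I y" shows "inj_on y I"
proof (rule inj_onI, rule ccontr)
  fix i j assume ij: "i \<in> I" "j \<in> I" "y i = y j" "i \<noteq> j"
  have I: "finite I" "y \<in> I \<rightarrow> carrier G" using assms by (auto simp: independent_family_def)
  let ?c = "\<lambda>k. if k = i then 1 else if k = j then -1 else (0::int)"
  have "int_comb G I y ?c = y i [^] ?c i \<otimes> (y j [^] ?c j \<otimes> int_comb G (I - {i} - {j}) y ?c)"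
    using ij I by (subst int_comb_remove[of I i], simp_all, subst int_comb_remove[of "I - {i}" j]) auto
  also have "int_comb G (I - {i} - {j}) y ?c = \<one>" by (rule int_comb_zero) auto
  also have "y i [^] ?c i \<otimes> (y j [^] ?c j \<otimes> \<one>) = \<one>"
    using ij I by (auto simp: int_pow_neg Pi_iff)
  finally have "?c i = 0" using assms ij(1) unfolding independent_family_def by blast
  then show False by simp
qed

lemma independent_family_image:
  assumes "independent_family G I y" shows "Z_independent G (y ` I)"
proof -
  have I: "finite I" "y \<in> I \<rightarrow> carrier G" using assms by (auto simp: independent_family_def)
  have "int_comb G (y ` I) (\<lambda>b. b) c = int_comb G I y (c \<circ> y)" for c
    using int_comb_reindex[OF independent_family_inj[OF assms], of "\<lambda>b. b" c] I by (auto simp: comp_def)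
  then show ?thesis
    unfolding Z_independent_iff_family using assms by (auto simp: independent_family_def)
qed

text \<open>
  The exchange argument for abelian groups: \<open>J\<close> need only span up to torsion. A dependency between
  the coefficient rows of suitable powers of the elements of \<open>B\<close> is a relation between the elements
  of \<open>B\<close> themselves.
\<close>

lemma card_independent_le:
  assumes J: "finite J" "y \<in> J \<rightarrow> carrier G"
    and pow: "\<And>x. x \<in> carrier G \<Longrightarrow> \<exists>n::int. n > 0 \<and> (\<exists>c. x [^] n = int_comb G J y c)"
    and B: "Z_independent G B"
  shows "card B \<le> card J"
proof (rule ccontr)
  assume "\<not> card B \<le> card J"
  have B': "finite B" "B \<subseteq> carrier G" using B by (auto simp: Z_independent_def)
  obtain n a where na: "\<And>x. x \<in> carrier G \<Longrightarrow> n x > (0::int)"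
    "\<And>x. x \<in> carrier G \<Longrightarrow> x [^] n x = int_comb G J y (a x)"
    using pow by metis
  obtain c where c: "\<exists>i\<in>B. c i \<noteq> 0" "\<And>j. j \<in> J \<Longrightarrow> (\<Sum>i\<in>B. c i * a i j) = 0"
    using int_dependency[of J B a] J(1) B'(1) \<open>\<not> card B \<le> card J\<close> by auto
  have "int_comb G B (\<lambda>b. b) (\<lambda>b. n b * c b) = int_comb G B (\<lambda>b. int_comb G J y (a b)) c"
    unfolding int_comb_def[of G B] using B'
    by (intro finprod_cong') (auto simp: na(2)[symmetric] int_pow_pow J)
  also have "\<dots> = \<one>" using B' J c(2) by (simp add: int_comb_swap int_comb_zero)
  finally have "\<forall>b\<in>B. n b * c b = 0"
    using B unfolding Z_independent_iff_family independent_family_def by blast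
  with c(1) na(1) B' show False by force
qed

text \<open>
  Every computation of a rank below goes through this criterion. It also provides the bound that
  makes the maximum in \<^const>\<open>Z_rank\<close> meaningful.
\<close>

lemma Z_rank_eqI:
  assumes indep: "independent_family G J y"
    and pow: "\<And>x. x \<in> carrier G \<Longrightarrow> \<exists>n::int. n > 0 \<and> (\<exists>c. x [^] n = int_comb G J y c)"
  shows "Z_rank G = card J"
proof -
  have J: "finite J" "y \<in> J \<rightarrow> carrier G" using indep by (auto simp: independent_family_def)
  have le: "card B \<le> card J" if "Z_independent G B" for B
    using card_independent_le[OF J pow that] .
  have "card (y ` J) = card J"
    using independent_family_inj[OF indep] by (rule card_image)
  then have "card J \<in> {card B | B. Z_independent G B}"
    using independent_family_image[OF indep] by (metis (mono_tags, lifting) mem_Collect_eq)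
  moreover have "finite {card B | B. Z_independent G B}"
    by (rule finite_subset[of _ "{..card J}"]) (use le in auto)
  ultimately show ?thesis
    unfolding Z_rank_def using le by (intro Max_eqI) auto
qed

text \<open>
  One step of the Euclidean algorithm on a relation: the coefficient at \<open>i\<close> is reduced by \<open>s\<close> times
  the one at \<open>j\<close>, at the price of changing the generator at \<open>j\<close>.
\<close>

lemma int_comb_shear:
  assumes "finite I" "y \<in> I \<rightarrow> carrier G" "i \<in> I" "j \<in> I" "i \<noteq> j"
  shows "int_comb G I (y(j := y j \<otimes> y i [^] (s::int))) (c(i := c i - s * c j)) = int_comb G I y c"
proof -
  let ?y = "y(j := y j \<otimes> y i [^] s)" and ?c = "c(i := c i - s * c j)" and ?R = "I - {i} - {j}"
  have y: "y i \<in> carrier G" "y j \<in> carrier G" using assms by auto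
  have y': "?y \<in> I \<rightarrow> carrier G" using assms y by auto
  have split: "int_comb G I z d = z i [^] d i \<otimes> (z j [^] d j \<otimes> int_comb G ?R z d)"
    if "z \<in> I \<rightarrow> carrier G" for z d
    using that assms
    by (subst int_comb_remove[of I i], simp_all, subst int_comb_remove[of "I - {i}" j]) auto
  have rest: "int_comb G ?R ?y ?c = int_comb G ?R y c"
    by (rule int_comb_cong) (use assms in auto)
  have R: "int_comb G ?R y c \<in> carrier G" using assms by (intro int_comb_closed) auto
  have "y i [^] (c i - s * c j) \<otimes> ((y j \<otimes> y i [^] s) [^] c j \<otimes> int_comb G ?R y c)
      = (y i [^] (c i - s * c j) \<otimes> y i [^] (s * c j)) \<otimes> (y j [^] c j \<otimes> int_comb G ?R y c)"
    using y R by (simp add: int_pow_distrib int_pow_pow m_ac)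
  also have "y i [^] (c i - s * c j) \<otimes> y i [^] (s * c j) = y i [^] c i"
    using y by (simp flip: int_pow_mult)
  finally show ?thesis
    unfolding split[OF y'] split[OF assms(2)] rest using assms(5) by simp
qed

text \<open>
  A spanning family of minimal length is a basis. A nontrivial relation in such a family could be
  made smaller by shears as long as two of its coefficients are nonzero; once a single coefficient
  is left, torsion-freeness kills the generator belonging to it, contradicting minimality.
\<close>

lemma ex_spanning_independent_family:
  fixes F :: "'i set" and w :: "'i \<Rightarrow> 'a"
  assumes fg: "spanning_family G F w" and tf: "torsion G = {\<one>}"
  obtains I :: "'i set" and y where "spanning_family G I y" "independent_family G I y"
proof -
  from fg have ex: "\<exists>n. \<exists>(I :: 'i set) y. spanning_family G I y \<and> card I = n" by blast
  define n where "n = (LEAST n. \<exists>(I :: 'i set) y. spanning_family G I y \<and> card I = n)"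
  obtain I :: "'i set" and y where Iy: "spanning_family G I y" "card I = n"
    using LeastI_ex[OF ex] unfolding n_def by blast
  have min: "n \<le> card K" if "spanning_family G K z" for K :: "'i set" and z
    unfolding n_def by (rule Least_le) (use that in blast)
  have I: "finite I" using Iy by (auto simp: spanning_family_def)
  have key: "\<forall>i\<in>I. c i = 0" if "spanning_family G I z" "int_comb G I z c = \<one>" for z c
    using that
  proof (induction "nat (\<Sum>i\<in>I. \<bar>c i\<bar>)" arbitrary: z c rule: less_induct)
    case less
    note z = less.prems(1)
    have zI: "z \<in> I \<rightarrow> carrier G" using z by (simp add: spanning_family_def)
    show ?case
    proof (rule ccontr)
      assume "\<not> (\<forall>i\<in>I. c i = 0)"
      then obtain k where k: "k \<in> I" "c k \<noteq> 0" by blast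
      show False
      proof (cases "\<exists>l\<in>I. l \<noteq> k \<and> c l \<noteq> 0")
        case False
        have zk: "z k \<in> carrier G" using k zI by auto
        have "\<one> = z k [^] c k \<otimes> int_comb G (I - {k}) z c"
          using less.prems(2) int_comb_remove[OF I k(1) zI] by simp
        also have "int_comb G (I - {k}) z c = \<one>" using False by (intro int_comb_zero) auto
        finally have "z k [^] c k = \<one>" using zk by simp
        then have "z k [^] int (nat \<bar>c k\<bar>) = \<one>"
          using zk by (cases "c k \<ge> 0") (auto simp: int_pow_neg)
        then have "z k [^] nat \<bar>c k\<bar> = \<one>" by (simp only: int_pow_int)
        then have "z k \<in> torsion G"
          unfolding torsion_def using zk k(2) by (auto intro!: exI[of _ "nat \<bar>c k\<bar>"])
        then have "z k = \<one>" using tf by simp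
        then have "int_comb G I z d = int_comb G (I - {k}) z d" for d
          using int_comb_remove[OF I k(1) zI, of d] zI by (simp add: Pi_iff)
        then have "spanning_family G (I - {k}) z"
          using z by (auto simp: spanning_family_def)
        then have "n \<le> card (I - {k})" by (rule min)
        then show False using Iy(2) k I by (metis card_Diff1_less not_le)
      next
        case True
        then obtain l where l: "l \<in> I" "l \<noteq> k" "c l \<noteq> 0" by blast
        (* Subtracting plus or minus the smaller coefficient from the larger one makes the sum of
           the absolute values drop, which is the measure of the induction. *)
        obtain i j where ij: "i \<in> I" "j \<in> I" "i \<noteq> j" "c j \<noteq> 0" "\<bar>c j\<bar> \<le> \<bar>c i\<bar>"
          using k l by (metis nle_le)
        define s where "s = sgn (c i) * sgn (c j)"
        define z' where "z' = z(j := z j \<otimes> z i [^] s)"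
        define c' where "c' = c(i := c i - s * c j)"
        have shear: "int_comb G I z' (d(i := d i - s * d j)) = int_comb G I z d" for d
          unfolding z'_def by (rule int_comb_shear[OF I zI ij(1-3)])
        have "z' \<in> I \<rightarrow> carrier G" using zI ij by (auto simp: z'_def Pi_iff)
        then have "spanning_family G I z'"
          using z unfolding spanning_family_def by (metis shear)
        moreover have "int_comb G I z' c' = \<one>"
          unfolding c'_def shear by (rule less.prems(2))
        moreover have "nat (\<Sum>i\<in>I. \<bar>c' i\<bar>) < nat (\<Sum>i\<in>I. \<bar>c i\<bar>)"
        proof -
          have "(\<Sum>i\<in>I. \<bar>c' i\<bar>) = \<bar>c i - s * c j\<bar> + (\<Sum>i\<in>I - {i}. \<bar>c i\<bar>)"
            using I ij(1) by (subst sum.remove[of I i]) (auto simp: c'_def intro!: sum.cong)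
          moreover have "(\<Sum>i\<in>I. \<bar>c i\<bar>) = \<bar>c i\<bar> + (\<Sum>i\<in>I - {i}. \<bar>c i\<bar>)"
            using I ij(1) by (simp add: sum.remove)
          moreover have "\<bar>c i - s * c j\<bar> < \<bar>c i\<bar>"
            using ij(4,5) by (auto simp: s_def sgn_if)
          moreover have "(\<Sum>i\<in>I - {i}. \<bar>c i\<bar>) \<ge> 0" by (simp add: sum_nonneg)
          ultimately show ?thesis by linarith
        qed
        ultimately have "\<forall>i\<in>I. c' i = 0" using less.hyps by blast
        then have "c' j = 0" using ij(2) by blast
        then show False using ij(3,4) by (simp add: c'_def)
      qed
    qed
  qed
  have "independent_family G I y"
    unfolding independent_family_def using key Iy(1) by (auto simp: spanning_family_def)
  with Iy(1) show thesis by (rule that)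
qed

end

lemma hom_int_comb:
  fixes h :: "'a \<Rightarrow> 'b"
  assumes "comm_group G" "comm_group H" "h \<in> hom G H" "finite I" "y \<in> I \<rightarrow> carrier G"
  shows "h (int_comb G I y c) = int_comb H I (h \<circ> y) c"
proof -
  interpret G: comm_group G by fact
  interpret H: comm_group H by fact
  interpret h: group_hom G H h using assms(3) by unfold_locales
  show ?thesis
    using assms(4,5)
  proof (induction I rule: finite_induct)
    case empty
    then show ?case by (simp add: int_comb_def)
  next
    case (insert i I)
    then have "h \<circ> y \<in> insert i I \<rightarrow> carrier H" "y \<in> I \<rightarrow> carrier G" by (auto simp: Pi_iff)
    with insert show ?case
      by (simp add: G.int_comb_insert H.int_comb_insert h.hom_int_pow Pi_iff)
  qed
qed

section \<open>Finitely generated abelian groups split off their torsion\<close>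

lemma (in comm_group) spanning_family_image:
  assumes span: "spanning_family G I y" and "comm_group H" and h: "h \<in> epi G H"
  shows "spanning_family H I (h \<circ> y)"
  unfolding spanning_family_def
proof (intro conjI ballI)
  have I: "finite I" "y \<in> I \<rightarrow> carrier G" using span by (simp_all add: spanning_family_def)
  have hom: "h \<in> hom G H" and surj: "carrier H = h ` carrier G" using h by (simp_all add: epi_def)
  show "finite I" by (rule I)
  show "h \<circ> y \<in> I \<rightarrow> carrier H" using I(2) hom by (auto simp: hom_def)
  fix z assume "z \<in> carrier H"
  then obtain x where x: "z = h x" "x \<in> carrier G" unfolding surj by blast
  then obtain c where "x = int_comb G I y c" using span unfolding spanning_family_def by blast
  then have "z = int_comb H I (h \<circ> y) c"
    using x hom_int_comb[OF comm_group_axioms \<open>comm_group H\<close> hom I] by simp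
  then show "\<exists>c. z = int_comb H I (h \<circ> y) c" by (intro exI[of _ c])
qed

lemma (in comm_group) spanning_family_fin_gen:
  assumes "spanning_family G I y" shows "fin_gen G"
  unfolding fin_gen_def
proof (intro exI[of _ "y ` I"] conjI)
  have I: "finite I" "y \<in> I \<rightarrow> carrier G" using assms by (simp_all add: spanning_family_def)
  show "finite (y ` I)" "y ` I \<subseteq> carrier G" using I by auto
  have "carrier G \<subseteq> range (int_comb G I y)" using assms unfolding spanning_family_def by blast
  moreover have "range (int_comb G I y) \<subseteq> carrier G" using I(2) by auto
  ultimately show "generate G (y ` I) = carrier G" using generate_eq_int_comb[OF I] by blast
qed

context comm_group
begin

lemma fin_gen_spanning_family:
  assumes "fin_gen G" obtains F where "spanning_family G F (\<lambda>b. b)"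
proof -
  obtain F where F: "finite F" "F \<subseteq> carrier G" "generate G F = carrier G"
    using assms by (auto simp: fin_gen_def)
  have "spanning_family G F (\<lambda>b. b)"
    unfolding spanning_family_def using F generate_eq_int_comb[of F "\<lambda>b. b"] by auto
  then show thesis by (rule that)
qed

lemma spanning_independent_reindex:
  assumes "spanning_family G I y" "independent_family G I y" and f: "bij_betw f K I"
  shows "spanning_family G K (y \<circ> f)" "independent_family G K (y \<circ> f)"
proof -
  have I: "finite I" "y \<in> I \<rightarrow> carrier G" and span: "\<And>x. x \<in> carrier G \<Longrightarrow> \<exists>c. x = int_comb G I y c"
    and indep: "\<And>c. int_comb G I y c = \<one> \<Longrightarrow> \<forall>i\<in>I. c i = 0"
    using assms by (auto simp: spanning_family_def independent_family_def)
  have fK: "inj_on f K" "f ` K = I" using f by (auto simp: bij_betw_def)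
  have K: "finite K" "y \<circ> f \<in> K \<rightarrow> carrier G"
    using I fK finite_imageD[of f K] by auto
  have comb: "int_comb G I y c = int_comb G K (y \<circ> f) (c \<circ> f)" for c
    using int_comb_reindex[OF fK(1), of y c] I fK(2) by simp
  show "spanning_family G K (y \<circ> f)"
    unfolding spanning_family_def using K span comb by metis
  have "\<forall>k\<in>K. c k = 0" if c: "int_comb G K (y \<circ> f) c = \<one>" for c
  proof -
    let ?d = "c \<circ> the_inv_into K f"
    have d: "?d (f k) = c k" if "k \<in> K" for k using fK(1) that by (simp add: the_inv_into_f_f)
    have "int_comb G K (y \<circ> f) (?d \<circ> f) = int_comb G K (y \<circ> f) c"
      by (rule int_comb_cong) (use K d in auto)
    then have "int_comb G I y ?d = \<one>" using c comb by simp
    then show ?thesis using indep d fK(2) by fastforce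
  qed
  then show "independent_family G K (y \<circ> f)"
    unfolding independent_family_def using K by blast
qed

lemma subgroup_torsion: "subgroup (torsion G) G"
proof (rule subgroupI)
  have "\<one> \<in> torsion G" by (auto simp: torsion_def intro!: exI[of _ 1])
  then show "torsion G \<noteq> {}" by blast
  fix x assume x: "x \<in> torsion G"
  then obtain n :: nat where n: "x \<in> carrier G" "n > 0" "x [^] n = \<one>" by (auto simp: torsion_def)
  then show "inv x \<in> torsion G" by (auto simp: torsion_def nat_pow_inv intro!: exI[of _ n])
  fix y assume "y \<in> torsion G"
  then obtain m :: nat where m: "y \<in> carrier G" "m > 0" "y [^] m = \<one>" by (auto simp: torsion_def)
  have "(x \<otimes> y) [^] (n * m) = (x [^] n) [^] m \<otimes> (y [^] m) [^] n"
    using n(1) m(1) by (simp add: nat_pow_distrib nat_pow_pow mult.commute[of m n])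
  then have "(x \<otimes> y) [^] (n * m) = \<one>" using n m by simp
  then show "x \<otimes> y \<in> torsion G" using n m by (auto simp: torsion_def intro!: exI[of _ "n * m"])
qed (auto simp: torsion_def)

lemma torsion_Mod_torsion: "torsion (G Mod torsion G) = {\<one>\<^bsub>G Mod torsion G\<^esub>}"
proof -
  interpret T: subgroup "torsion G" G by (rule subgroup_torsion)
  interpret T: normal "torsion G" G by (rule subgroup_imp_normal[OF subgroup_torsion])
  interpret Q: comm_group "G Mod torsion G" by (rule abelian_FactGroup[OF subgroup_torsion])
  have "torsion G #> x = torsion G"
    if "x \<in> carrier G" "(torsion G #> x) [^]\<^bsub>G Mod torsion G\<^esub> n = torsion G" "n > 0"
    for x and n :: nat
  proof -
    have "torsion G #> x [^] n = torsion G" using that by (simp add: T.FactGroup_pow)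
    then have "x [^] n \<in> torsion G"
      using that coset_join1[OF _ _ subgroup_torsion] by auto
    then obtain m :: nat where "m > 0" "(x [^] n) [^] m = \<one>"
      unfolding torsion_def by blast
    then have "n * m > 0" "x [^] (n * m) = \<one>" using that by (simp_all add: nat_pow_pow)
    then have "x \<in> torsion G" unfolding torsion_def using that(1) by blast
    then show ?thesis using that coset_join2[OF _ subgroup_torsion] by blast
  qed
  then have "torsion (G Mod torsion G) \<subseteq> {torsion G}"
    unfolding torsion_def[of "G Mod torsion G"] carrier_FactGroup one_FactGroup by blast
  moreover have "\<one>\<^bsub>G Mod torsion G\<^esub> \<in> torsion (G Mod torsion G)"
    using subgroup.one_closed[OF Q.subgroup_torsion] .
  ultimately show ?thesis unfolding one_FactGroup by blast
qed

lemma torsion_quotient_pow_eq: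
  assumes x: "x \<in> carrier G" and u: "u \<in> carrier G" and "x \<otimes> inv u \<in> torsion G"
  obtains m :: nat where "m > 0" "x [^] m = u [^] m"
proof -
  obtain m :: nat where m: "m > 0" "(x \<otimes> inv u) [^] m = \<one>"
    using assms(3) by (auto simp: torsion_def)
  then have "x [^] m \<otimes> inv (u [^] m) = \<one>"
    using x u by (simp add: nat_pow_distrib nat_pow_inv)
  then have "x [^] m = u [^] m"
    using x u inv_equality[of "x [^] m" "inv (u [^] m)"] by simp
  with m(1) show thesis by (rule that)
qed

text \<open>
  The quotient by the torsion subgroup is free on some basis. Representatives of this basis are
  independent and generate a complement of the torsion subgroup; their number is the rank because
  every element agrees with a combination of the representatives up to torsion.
\<close>

theorem fin_gen_iso_free_times_torsion:
  assumes "fin_gen G"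
  shows "G \<cong> free_Z (Z_rank G) \<times>\<times> G\<lparr>carrier := torsion G\<rparr>"
proof -
  let ?T = "torsion G" let ?Q = "G Mod ?T"
  interpret T: subgroup ?T G by (rule subgroup_torsion)
  interpret T: normal ?T G by (rule subgroup_imp_normal[OF subgroup_torsion])
  interpret Q: comm_group ?Q by (rule abelian_FactGroup[OF subgroup_torsion])
  have hom: "(#>) ?T \<in> hom G ?Q" using T.r_coset_hom_Mod by simp
  have comb_Mod: "?T #> int_comb G I w c = int_comb ?Q I (\<lambda>i. ?T #> w i) c"
    if "finite I" "w \<in> I \<rightarrow> carrier G" for I :: "'i set" and w c
    using hom_int_comb[OF comm_group_axioms Q.comm_group_axioms hom that] by (simp add: comp_def)
  obtain F where F: "spanning_family G F (\<lambda>b. b)" using fin_gen_spanning_family[OF assms] .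
  have "(#>) ?T \<in> epi G ?Q" using hom by (simp add: epi_def carrier_FactGroup)
  from spanning_family_image[OF F Q.comm_group_axioms this]
  have "spanning_family ?Q F ((#>) ?T \<circ> (\<lambda>b. b))" .
  from Q.ex_spanning_independent_family[OF this torsion_Mod_torsion]
  obtain I0 :: "'a set" and z0
    where z0: "spanning_family ?Q I0 z0" "independent_family ?Q I0 z0" .
  define n where "n = card I0"
  have "finite I0" using z0 by (simp add: spanning_family_def)
  then obtain f where f: "bij_betw f {..<n} I0"
    using ex_bij_betw_nat_finite[of I0] by (auto simp: n_def atLeast0LessThan)
  define z where "z = z0 \<circ> f"
  have z: "spanning_family ?Q {..<n} z" "independent_family ?Q {..<n} z"
    unfolding z_def by (rule Q.spanning_independent_reindex[OF z0 f])+
  have zI: "z \<in> {..<n} \<rightarrow> carrier ?Q" using z(2) by (simp add: independent_family_def)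
  have "\<exists>x. x \<in> carrier G \<and> z i = ?T #> x" if "i < n" for i
    using zI that by (auto simp: carrier_FactGroup Pi_iff image_iff)
  then have "\<exists>y. \<forall>i. i < n \<longrightarrow> y i \<in> carrier G \<and> z i = ?T #> y i"
    by (intro choice) blast
  then obtain y where y: "\<And>i. i < n \<Longrightarrow> y i \<in> carrier G" "\<And>i. i < n \<Longrightarrow> z i = ?T #> y i"
    by blast
  have yI: "y \<in> {..<n} \<rightarrow> carrier G" using y by auto
  have coset_comb: "?T #> int_comb G {..<n} y c = int_comb ?Q {..<n} z c" for c
  proof -
    have "int_comb ?Q {..<n} (\<lambda>i. ?T #> y i) c = int_comb ?Q {..<n} z c"
      by (rule Q.int_comb_cong) (use zI y(2) in auto)
    then show ?thesis using comb_Mod[OF finite_lessThan yI] by simp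
  qed
  have indep: "independent_family G {..<n} y"
    unfolding independent_family_def
  proof (intro conjI allI impI)
    fix c assume "int_comb G {..<n} y c = \<one>"
    then have "int_comb ?Q {..<n} z c = \<one>\<^bsub>?Q\<^esub>" using coset_comb[of c] T.subset by simp
    then show "\<forall>i\<in>{..<n}. c i = 0" using z(2) by (auto simp: independent_family_def)
  qed (use yI in auto)
  have decomp: "\<exists>c. x \<otimes> inv (int_comb G {..<n} y c) \<in> ?T" if x: "x \<in> carrier G" for x
  proof -
    have "?T #> x \<in> carrier ?Q" using x by (auto simp: carrier_FactGroup)
    then obtain c where "?T #> x = int_comb ?Q {..<n} z c"
      using z(1) unfolding spanning_family_def by blast
    then have "?T #> x = ?T #> int_comb G {..<n} y c" using coset_comb by simp
    then have "x \<in> ?T #> int_comb G {..<n} y c"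
      using rcos_self[OF x subgroup_torsion] by simp
    then have "x \<otimes> inv (int_comb G {..<n} y c) \<in> ?T"
      using T.rcos_module_imp[OF is_group] yI by simp
    then show ?thesis by blast
  qed
  have rank: "Z_rank G = n"
  proof -
    have "\<exists>m::int. m > 0 \<and> (\<exists>c. x [^] m = int_comb G {..<n} y c)" if x: "x \<in> carrier G" for x
    proof -
      obtain c where "x \<otimes> inv (int_comb G {..<n} y c) \<in> ?T" using decomp[OF x] by blast
      then obtain m :: nat where m: "m > 0" "x [^] m = int_comb G {..<n} y c [^] m"
        using torsion_quotient_pow_eq[OF x int_comb_closed[OF yI]] by blast
      then have "x [^] int m = int_comb G {..<n} y (\<lambda>i. int m * c i)"
        unfolding int_comb_pow[OF finite_lessThan yI, symmetric] by (simp only: int_pow_int m(2))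
      then show ?thesis using m(1) by (metis of_nat_0_less_iff)
    qed
    then show ?thesis using Z_rank_eqI[OF indep] by simp
  qed
  define \<psi> where "\<psi> = (\<lambda>(c, t). int_comb G {..<n} y c \<otimes> t)"
  let ?P = "free_Z n \<times>\<times> G\<lparr>carrier := ?T\<rparr>"
  have carrier_P: "carrier (free_Z n) = {..<n} \<rightarrow>\<^sub>E UNIV" by (simp add: free_Z_def)
  have gP: "group ?P"
    unfolding free_Z_def by (intro DirProd_group product_group) (auto intro: subgroup_imp_group subgroup_torsion)
  have "\<psi> \<in> iso ?P G"
    unfolding iso_kernel_image[OF gP is_group]
  proof (intro conjI)
    show "\<psi> \<in> hom ?P G"
    proof (rule homI)
      fix u v assume "u \<in> carrier ?P" "v \<in> carrier ?P"
      then obtain c s d t where uv: "u = (c, s)" "v = (d, t)" and st: "s \<in> ?T" "t \<in> ?T"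
        by (auto simp: carrier_P)
      have st': "s \<in> carrier G" "t \<in> carrier G" using st T.subset by auto
      have "int_comb G {..<n} y (\<lambda>i\<in>{..<n}. c i + d i) = int_comb G {..<n} y (\<lambda>i. c i + d i)"
        by (rule int_comb_cong) (use yI in auto)
      then show "\<psi> (u \<otimes>\<^bsub>?P\<^esub> v) = \<psi> u \<otimes> \<psi> v"
        using yI st' by (simp add: \<psi>_def uv free_Z_def int_comb_add m_ac)
    qed (use int_comb_closed[OF yI] T.subset in \<open>auto simp: \<psi>_def\<close>)
    show "kernel ?P G \<psi> = {\<one>\<^bsub>?P\<^esub>}"
    proof
      show "{\<one>\<^bsub>?P\<^esub>} \<subseteq> kernel ?P G \<psi>"
        using int_comb_zero[of "{..<n}" "\<lambda>i\<in>{..<n}. 0" y] subgroup.one_closed[OF subgroup_torsion]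
        by (simp add: kernel_def \<psi>_def free_Z_def)
      show "kernel ?P G \<psi> \<subseteq> {\<one>\<^bsub>?P\<^esub>}"
      proof
        fix u assume "u \<in> kernel ?P G \<psi>"
        then obtain c t where u: "u = (c, t)" "c \<in> {..<n} \<rightarrow>\<^sub>E UNIV" "t \<in> ?T"
          and eq: "int_comb G {..<n} y c \<otimes> t = \<one>"
          by (auto simp: kernel_def \<psi>_def carrier_P)
        have t: "t \<in> carrier G" using u T.subset by auto
        have "int_comb G {..<n} y c = inv t" using inv_equality[OF eq t int_comb_closed[OF yI]] by simp
        then have "?T #> int_comb G {..<n} y c = ?T"
          using u(3) T.rcos_const[OF is_group] by simp
        then have "int_comb ?Q {..<n} z c = \<one>\<^bsub>?Q\<^esub>" by (simp add: coset_comb)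
        then have "\<forall>i\<in>{..<n}. c i = 0" using z(2) by (simp add: independent_family_def)
        then have "c = (\<lambda>i\<in>{..<n}. 0)" and "int_comb G {..<n} y c = \<one>"
          using PiE_arb[OF u(2)] by (auto intro!: int_comb_zero)
        then show "u \<in> {\<one>\<^bsub>?P\<^esub>}" using eq t u(1) by (auto simp: free_Z_def)
      qed
    qed
    show "\<psi> ` carrier ?P = carrier G"
    proof
      show "\<psi> ` carrier ?P \<subseteq> carrier G"
        using int_comb_closed[OF yI] T.subset by (auto simp: \<psi>_def)
      show "carrier G \<subseteq> \<psi> ` carrier ?P"
      proof
        fix x assume x: "x \<in> carrier G"
        obtain c where c: "x \<otimes> inv (int_comb G {..<n} y c) \<in> ?T" using decomp[OF x] by blast
        have "int_comb G {..<n} y (\<lambda>i\<in>{..<n}. c i) = int_comb G {..<n} y c"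
          by (rule int_comb_cong) (use yI in auto)
        then have eq: "\<psi> (\<lambda>i\<in>{..<n}. c i, x \<otimes> inv (int_comb G {..<n} y c)) = x"
          using x int_comb_closed[OF yI, of c] by (simp add: \<psi>_def m_lcomm)
        have "(\<lambda>i\<in>{..<n}. c i, x \<otimes> inv (int_comb G {..<n} y c)) \<in> carrier ?P"
          using c by (simp add: carrier_P)
        then show "x \<in> \<psi> ` carrier ?P" by (rule image_eqI[rotated]) (rule eq[symmetric])
      qed
    qed
  qed
  then have "?P \<cong> G" by (rule is_isoI)
  then show ?thesis unfolding rank by (rule group.iso_sym[OF gP])
qed

end

section \<open>Cosets and fibres\<close>

text \<open>
  Two powers of \<open>w\<close> lie in one coset of \<open>L\<close> by the pigeonhole principle.
\<close>

lemma (in group) pow_mem_of_finite_cosets: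
  assumes "subgroup L G" "w \<in> carrier G" "finite (range (\<lambda>n::nat. L #> w [^] n))"
  obtains n :: nat where "n > 0" "w [^] n \<in> L"
proof -
  have "\<not> inj (\<lambda>n::nat. L #> w [^] n)" using assms(3) finite_imageD by fastforce
  then obtain i j :: nat where "i \<noteq> j" "L #> w [^] i = L #> w [^] j" by (auto simp: inj_def)
  then obtain i j :: nat where ij: "i < j" "L #> w [^] i = L #> w [^] j" by (metis linorder_neqE_nat)
  have wij: "w [^] i \<in> carrier G" "w [^] j \<in> carrier G" "w [^] (j - i) \<in> carrier G"
    using assms(2) by auto
  have "w [^] j \<in> L #> w [^] i" using rcos_self[OF wij(2) assms(1)] ij(2) by simp
  then have "w [^] j \<otimes> inv (w [^] i) \<in> L"
    by (rule subgroup.rcos_module_imp[OF assms(1) is_group wij(1)])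
  moreover have "w [^] j = w [^] (j - i) \<otimes> w [^] i" using assms(2) ij(1) by (simp add: nat_pow_mult)
  ultimately have "w [^] (j - i) \<in> L" using wij by (simp add: m_assoc)
  then show thesis using that[of "j - i"] ij(1) by simp
qed

text \<open>
  A subgroup of a quotient and the quotient of a subgroup are the same record on the nose, because
  cosets are computed by the multiplication alone.
\<close>

lemma FactGroup_subgroup_eq:
  "P\<lparr>carrier := W\<rparr> Mod L = (P Mod L)\<lparr>carrier := (\<lambda>w. L #>\<^bsub>P\<^esub> w) ` W\<rparr>"
  by (auto simp: FactGroup_def RCOSETS_def r_coset_def set_mult_def fun_eq_iff)

text \<open>
  Used to compare the cosets of a subgroup with the orbits of an action, both given as images of
  the same set of translations.
\<close>

lemma bij_betw_images_of_same_fibres: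
  assumes "\<And>x y. x \<in> W \<Longrightarrow> y \<in> W \<Longrightarrow> f x = f y \<longleftrightarrow> g x = g y"
  shows "bij_betw (\<lambda>u. g (inv_into W f u)) (f ` W) (g ` W)"
proof -
  have inv: "inv_into W f (f x) \<in> W" "f (inv_into W f (f x)) = f x" if "x \<in> W" for x
    using that by (auto intro: inv_into_into f_inv_into_f)
  have eq: "g (inv_into W f (f x)) = g x" if "x \<in> W" for x
    using assms[OF inv(1)[OF that] that] inv(2)[OF that] by simp
  show ?thesis
  proof (rule bij_betw_imageI)
    show "inj_on (\<lambda>u. g (inv_into W f u)) (f ` W)"
      by (rule inj_onI) (auto simp: eq assms)
    have "(\<lambda>u. g (inv_into W f u)) ` f ` W = (\<lambda>x. g (inv_into W f (f x))) ` W"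
      by (simp add: image_image)
    also have "\<dots> = g ` W" by (rule image_cong) (simp_all add: eq)
    finally show "(\<lambda>u. g (inv_into W f u)) ` f ` W = g ` W" .
  qed
qed

section \<open>Matroids over the integers from enlarging a kernel one generator at a time\<close>

lemma factor_through_epi:
  assumes grp: "group P" "group M" "group T"
    and q: "q \<in> epi P M" and u: "u \<in> hom P T"
    and ker: "kernel P M q \<subseteq> kernel P T u"
  obtains f where "f \<in> hom M T" "\<And>p. p \<in> carrier P \<Longrightarrow> f (q p) = u p"
proof -
  interpret P: group P by fact
  interpret M: group M by fact
  interpret T: group T by fact
  have qhom: "q \<in> hom P M" and qsurj: "q ` carrier P = carrier M" using q by (auto simp: epi_def)
  interpret q: group_hom P M q using qhom by unfold_locales
  interpret u: group_hom P T u using u by unfold_locales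
  have eq: "u p = u p'" if "p \<in> carrier P" "p' \<in> carrier P" "q p = q p'" for p p'
  proof -
    have "q (p \<otimes>\<^bsub>P\<^esub> inv\<^bsub>P\<^esub> p') = \<one>\<^bsub>M\<^esub>" using that by simp
    then have "p \<otimes>\<^bsub>P\<^esub> inv\<^bsub>P\<^esub> p' \<in> kernel P M q" using that by (simp add: kernel_def)
    then have "u (p \<otimes>\<^bsub>P\<^esub> inv\<^bsub>P\<^esub> p') = \<one>\<^bsub>T\<^esub>" using ker by (auto simp: kernel_def)
    then have "u p \<otimes>\<^bsub>T\<^esub> inv\<^bsub>T\<^esub> u p' = \<one>\<^bsub>T\<^esub>" using that by simp
    then show ?thesis using that T.inv_equality[of "u p" "inv\<^bsub>T\<^esub> u p'"] by simp
  qed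
  define f where "f = u \<circ> inv_into (carrier P) q"
  have f: "f (q p) = u p" if "p \<in> carrier P" for p
    unfolding f_def comp_def
    by (rule eq) (use that in \<open>auto intro: inv_into_into f_inv_into_f\<close>)
  have "f \<in> hom M T"
  proof (rule homI)
    fix a assume "a \<in> carrier M"
    then obtain p where p: "p \<in> carrier P" "a = q p" using qsurj by blast
    then show "f a \<in> carrier T" by (simp add: f)
    fix b assume "b \<in> carrier M"
    then obtain p' where p': "p' \<in> carrier P" "b = q p'" using qsurj by blast
    have "f (q (p \<otimes>\<^bsub>P\<^esub> p')) = u (p \<otimes>\<^bsub>P\<^esub> p')" using p p' by (intro f) simp
    then show "f (a \<otimes>\<^bsub>M\<^esub> b) = f a \<otimes>\<^bsub>T\<^esub> f b" using p p' by (simp add: f)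
  qed
  then show thesis using f by (rule that)
qed

text \<open>
  If all corners are quotients of one group \<open>P\<close>, a cocone is a homomorphism on \<open>P\<close> that kills
  both middle kernels; it factors through the last corner as soon as the last kernel is the
  product of the middle ones.
\<close>

lemma is_pushout_of_epis:
  fixes P :: "('p, 'm) monoid_scheme" and M0 M1 M2 M12 :: "'a monoid"
  assumes grp: "comm_group P" "comm_group M0" "comm_group M1" "comm_group M2" "comm_group M12"
    and q: "q0 \<in> epi P M0" "q1 \<in> epi P M1" "q2 \<in> epi P M2" "q12 \<in> epi P M12"
    and f: "f1 \<in> hom M0 M1" "f2 \<in> hom M0 M2" "i1 \<in> hom M1 M12" "i2 \<in> hom M2 M12"
    and fq: "\<And>p. p \<in> carrier P \<Longrightarrow> f1 (q0 p) = q1 p" "\<And>p. p \<in> carrier P \<Longrightarrow> f2 (q0 p) = q2 p"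
      "\<And>p. p \<in> carrier P \<Longrightarrow> i1 (q1 p) = q12 p" "\<And>p. p \<in> carrier P \<Longrightarrow> i2 (q2 p) = q12 p"
    and ker: "\<And>p. p \<in> kernel P M12 q12 \<Longrightarrow>
      \<exists>k\<in>kernel P M1 q1. \<exists>l\<in>kernel P M2 q2. p = k \<otimes>\<^bsub>P\<^esub> l"
  shows "is_pushout M0 M1 M2 M12 f1 f2 i1 i2"
  unfolding is_pushout_def
proof (intro conjI f ballI allI impI)
  interpret P: comm_group P by fact
  interpret M1: comm_group M1 by fact
  interpret M2: comm_group M2 by fact
  interpret M12: comm_group M12 by fact
  have qhom: "q1 \<in> hom P M1" "q2 \<in> hom P M2" "q12 \<in> hom P M12"
    and surj: "carrier M0 = q0 ` carrier P" "carrier M1 = q1 ` carrier P"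
      "carrier M2 = q2 ` carrier P" "carrier M12 = q12 ` carrier P"
    using q by (simp_all add: epi_def)
  show "i1 (f1 a) = i2 (f2 a)" if a: "a \<in> carrier M0" for a
  proof -
    obtain p where "a = q0 p" "p \<in> carrier P" using a unfolding surj by blast
    then show ?thesis by (simp add: fq)
  qed
  fix T :: "('a \<times> 'a) set monoid" and u1 u2
  assume H: "comm_group T \<and> u1 \<in> hom M1 T \<and> u2 \<in> hom M2 T \<and>
    (\<forall>a\<in>carrier M0. u1 (f1 a) = u2 (f2 a))"
  then interpret T: comm_group T by blast
  have u: "u1 \<in> hom M1 T" "u2 \<in> hom M2 T" using H by auto
  have u12: "u1 (q1 p) = u2 (q2 p)" if "p \<in> carrier P" for p
  proof -
    have "q0 p \<in> carrier M0" using that unfolding surj by (rule imageI)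
    then have "u1 (f1 (q0 p)) = u2 (f2 (q0 p))" using H by blast
    then show ?thesis using that by (simp add: fq)
  qed
  have hom: "u1 \<circ> q1 \<in> hom P T" using hom_compose[OF qhom(1) u(1)] .
  interpret uq: group_hom P T "u1 \<circ> q1" using hom by unfold_locales
  have one: "u1 \<one>\<^bsub>M1\<^esub> = \<one>\<^bsub>T\<^esub>" "u2 \<one>\<^bsub>M2\<^esub> = \<one>\<^bsub>T\<^esub>"
    using u by (simp_all add: hom_one[OF _ M1.group_axioms T.group_axioms]
        hom_one[OF _ M2.group_axioms T.group_axioms])
  have "kernel P M12 q12 \<subseteq> kernel P T (u1 \<circ> q1)"
  proof
    fix p assume "p \<in> kernel P M12 q12"
    then obtain k l where "k \<in> kernel P M1 q1" "l \<in> kernel P M2 q2" and p: "p = k \<otimes>\<^bsub>P\<^esub> l"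
      using ker by blast
    then have kl: "k \<in> carrier P" "q1 k = \<one>\<^bsub>M1\<^esub>" "l \<in> carrier P" "q2 l = \<one>\<^bsub>M2\<^esub>"
      by (simp_all add: kernel_def)
    have "(u1 \<circ> q1) p = (u1 \<circ> q1) k \<otimes>\<^bsub>T\<^esub> (u1 \<circ> q1) l"
      unfolding p by (rule uq.hom_mult) (use kl in auto)
    also have "\<dots> = \<one>\<^bsub>T\<^esub>" using kl one u12[OF kl(3)] by simp
    finally show "p \<in> kernel P T (u1 \<circ> q1)" using kl p by (simp add: kernel_def)
  qed
  then obtain w where w: "w \<in> hom M12 T" "\<And>p. p \<in> carrier P \<Longrightarrow> w (q12 p) = (u1 \<circ> q1) p"
    using factor_through_epi[OF P.group_axioms M12.group_axioms T.group_axioms q(4) hom] by metis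
  let ?w = "restrict w (carrier M12)"
  have q12_closed: "q12 p \<in> carrier M12" if "p \<in> carrier P" for p
    using that unfolding surj by (rule imageI)
  show "\<exists>!w. w \<in> hom M12 T \<and> w \<in> extensional (carrier M12) \<and>
      (\<forall>b\<in>carrier M1. w (i1 b) = u1 b) \<and> (\<forall>b\<in>carrier M2. w (i2 b) = u2 b)"
  proof (rule ex1I[of _ ?w])
    have "?w \<in> hom M12 T" using w(1) by (auto simp: hom_def Pi_iff)
    moreover have "?w (i1 b) = u1 b" if b: "b \<in> carrier M1" for b
    proof -
      obtain p where "b = q1 p" "p \<in> carrier P" using b unfolding surj by blast
      then show ?thesis by (simp add: fq q12_closed w)
    qed
    moreover have "?w (i2 b) = u2 b" if b: "b \<in> carrier M2" for b
    proof -
      obtain p where "b = q2 p" "p \<in> carrier P" using b unfolding surj by blast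
      then show ?thesis by (simp add: fq q12_closed w u12)
    qed
    ultimately show "?w \<in> hom M12 T \<and> ?w \<in> extensional (carrier M12) \<and>
      (\<forall>b\<in>carrier M1. ?w (i1 b) = u1 b) \<and> (\<forall>b\<in>carrier M2. ?w (i2 b) = u2 b)" by simp
  next
    fix w' assume w': "w' \<in> hom M12 T \<and> w' \<in> extensional (carrier M12) \<and>
      (\<forall>b\<in>carrier M1. w' (i1 b) = u1 b) \<and> (\<forall>b\<in>carrier M2. w' (i2 b) = u2 b)"
    show "w' = ?w"
    proof (rule extensionalityI[of _ "carrier M12"])
      fix m assume "m \<in> carrier M12"
      then obtain p where p: "m = q12 p" "p \<in> carrier P" unfolding surj by blast
      moreover have "q1 p \<in> carrier M1" using p(2) unfolding surj by (rule imageI)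
      ultimately have "w' (q12 p) = u1 (q1 p)" using w' fq(3)[of p] by metis
      then show "w' m = ?w m" using p by (simp add: w q12_closed)
    qed (use w' in auto)
  qed
qed

text \<open>
  The last assumption says that \<open>M A\<close> is obtained from \<open>M {}\<close> by killing the images of \<open>x e\<close>,
  \<open>e \<in> A\<close>; since it concerns one element at a time, it covers \<open>e \<in> A\<close> and coinciding
  elements as well.
\<close>

locale elementwise_quotients =
  fixes P :: "('p, 'm) monoid_scheme" and E :: "'e set" and M :: "'e set \<Rightarrow> 'a monoid"
    and q :: "'e set \<Rightarrow> 'p \<Rightarrow> 'a" and x :: "'e \<Rightarrow> 'p"
  assumes comm_P: "comm_group P" and finite_E: "finite E"
    and comm_M: "A \<subseteq> E \<Longrightarrow> comm_group (M A)"
    and q_epi: "A \<subseteq> E \<Longrightarrow> q A \<in> epi P (M A)"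
    and x_closed: "e \<in> E \<Longrightarrow> x e \<in> carrier P"
    and kernel_insert: "A \<subseteq> E \<Longrightarrow> e \<in> E \<Longrightarrow>
      kernel P (M (insert e A)) (q (insert e A)) =
        {k \<otimes>\<^bsub>P\<^esub> x e [^]\<^bsub>P\<^esub> (n::int) | k n. k \<in> kernel P (M A) (q A)}"
begin

sublocale P: comm_group P by (rule comm_P)

lemma q_hom: "A \<subseteq> E \<Longrightarrow> q A \<in> hom P (M A)"
  and q_surj: "A \<subseteq> E \<Longrightarrow> q A ` carrier P = carrier (M A)"
  using q_epi by (auto simp: epi_def)

lemma kernel_mono_insert:
  assumes "A \<subseteq> E" "e \<in> E"
  shows "kernel P (M A) (q A) \<subseteq> kernel P (M (insert e A)) (q (insert e A))"
proof
  fix k assume k: "k \<in> kernel P (M A) (q A)"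
  then have "k = k \<otimes>\<^bsub>P\<^esub> x e [^]\<^bsub>P\<^esub> (0::int)" by (simp add: kernel_def)
  with k show "k \<in> kernel P (M (insert e A)) (q (insert e A))"
    unfolding kernel_insert[OF assms] by blast
qed

lemma x_in_kernel_insert:
  assumes "A \<subseteq> E" "e \<in> E"
  shows "x e [^]\<^bsub>P\<^esub> (n::int) \<in> kernel P (M (insert e A)) (q (insert e A))"
proof -
  interpret group_hom P "M A" "q A"
    using q_hom[OF assms(1)] comm_M[OF assms(1)] comm_P
    by (simp add: group_hom_def group_hom_axioms_def comm_group_def)
  have "\<one>\<^bsub>P\<^esub> \<in> kernel P (M A) (q A)" by (simp add: kernel_def)
  moreover have "x e [^]\<^bsub>P\<^esub> n = \<one>\<^bsub>P\<^esub> \<otimes>\<^bsub>P\<^esub> x e [^]\<^bsub>P\<^esub> n" using x_closed[OF assms(2)] by simp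
  ultimately show ?thesis unfolding kernel_insert[OF assms] by blast
qed

lemma transition_map:
  assumes "A \<subseteq> E" "B \<subseteq> E" "kernel P (M A) (q A) \<subseteq> kernel P (M B) (q B)"
  obtains f where "f \<in> epi (M A) (M B)" "\<And>p. p \<in> carrier P \<Longrightarrow> f (q A p) = q B p"
    "kernel (M A) (M B) f = q A ` kernel P (M B) (q B)"
proof -
  interpret MA: comm_group "M A" by (rule comm_M[OF assms(1)])
  interpret MB: comm_group "M B" by (rule comm_M[OF assms(2)])
  obtain f where f: "f \<in> hom (M A) (M B)" "\<And>p. p \<in> carrier P \<Longrightarrow> f (q A p) = q B p"
    using factor_through_epi[OF P.group_axioms MA.group_axioms MB.group_axioms
        q_epi[OF assms(1)] q_hom[OF assms(2)] assms(3)] by blast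
  have "carrier (M B) \<subseteq> f ` carrier (M A)"
    unfolding q_surj[OF assms(2), symmetric] q_surj[OF assms(1), symmetric]
    using f(2) by force
  then have "f \<in> epi (M A) (M B)" using f(1) by (auto simp: epi_def hom_def)
  moreover have "kernel (M A) (M B) f = q A ` kernel P (M B) (q B)"
    unfolding kernel_def q_surj[OF assms(1), symmetric] using f(2) by auto
  ultimately show thesis using f(2) that by blast
qed

text \<open>
  The kernel is generated by the image of \<open>x e\<close>, since the elements of the kernel of \<open>q A\<close>
  disappear in \<open>M A\<close>.
\<close>

lemma transition_map_insert:
  assumes "A \<subseteq> E" "e \<in> E"
  obtains f where "epi_cyclic_kernel (M A) (M (insert e A)) f"
    "\<And>p. p \<in> carrier P \<Longrightarrow> f (q A p) = q (insert e A) p"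
proof -
  interpret MA: comm_group "M A" by (rule comm_M[OF assms(1)])
  have eA: "insert e A \<subseteq> E" using assms by simp
  interpret MB: comm_group "M (insert e A)" by (rule comm_M[OF eA])
  interpret qA: group_hom P "M A" "q A" using q_hom[OF assms(1)] by unfold_locales
  obtain f where f: "f \<in> epi (M A) (M (insert e A))"
    "\<And>p. p \<in> carrier P \<Longrightarrow> f (q A p) = q (insert e A) p"
    "kernel (M A) (M (insert e A)) f = q A ` kernel P (M (insert e A)) (q (insert e A))"
    using transition_map[OF assms(1) eA kernel_mono_insert[OF assms]] by blast
  let ?K = "kernel (M A) (M (insert e A)) f" and ?y = "q A (x e)"
  interpret f: group_hom "M A" "M (insert e A)" f
    using f(1) by unfold_locales (auto simp: epi_def)
  have y: "?y \<in> carrier (M A)" using x_closed[OF assms(2)] by simp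
  have "q A (k \<otimes>\<^bsub>P\<^esub> x e [^]\<^bsub>P\<^esub> n) = ?y [^]\<^bsub>M A\<^esub> n" if "k \<in> kernel P (M A) (q A)" for k and n :: int
    using that x_closed[OF assms(2)] by (simp add: kernel_def qA.hom_int_pow)
  moreover have "\<one>\<^bsub>P\<^esub> \<in> kernel P (M A) (q A)" by (simp add: kernel_def)
  ultimately have K: "?K = range (\<lambda>n::int. ?y [^]\<^bsub>M A\<^esub> n)"
    unfolding f(3) kernel_insert[OF assms] by (auto simp: image_iff) metis+
  have grpK: "group ((M A)\<lparr>carrier := ?K\<rparr>)"
    by (rule MA.subgroup_imp_group[OF f.subgroup_kernel])
  have "?y [^]\<^bsub>M A\<^esub> (1::int) \<in> ?K" unfolding K by blast
  then have yK: "?y \<in> ?K" using y by simp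
  have "cyclic_group ((M A)\<lparr>carrier := ?K\<rparr>)"
    unfolding group.cyclic_group[OF grpK]
  proof (rule bexI[of _ ?y])
    have "(\<lambda>n::int. ?y [^]\<^bsub>(M A)\<lparr>carrier := ?K\<rparr>\<^esub> n) = (\<lambda>n. ?y [^]\<^bsub>M A\<^esub> n)"
      using MA.int_pow_consistent[OF f.subgroup_kernel yK] by simp
    then show "carrier ((M A)\<lparr>carrier := ?K\<rparr>) = range (\<lambda>n::int. ?y [^]\<^bsub>(M A)\<lparr>carrier := ?K\<rparr>\<^esub> n)"
      using K by simp
  qed (use yK in simp)
  then show thesis using f(1,2) that by (auto simp: epi_cyclic_kernel_def)
qed

theorem matroid_over_Z: "matroid_over_Z E M"
  unfolding matroid_over_Z_def
proof (intro conjI finite_E allI impI ballI comm_M)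
  fix A e1 e2 assume A: "A \<subseteq> E" and e: "e1 \<in> E" "e2 \<in> E"
  then have sub: "insert e1 A \<subseteq> E" "insert e2 A \<subseteq> E" "insert e2 (insert e1 A) \<subseteq> E" by auto
  have comm: "insert e1 (insert e2 A) = insert e2 (insert e1 A)" by auto
  obtain f1 where f1: "epi_cyclic_kernel (M A) (M (insert e1 A)) f1"
    "\<And>p. p \<in> carrier P \<Longrightarrow> f1 (q A p) = q (insert e1 A) p"
    using transition_map_insert[OF A e(1)] by blast
  obtain f2 where f2: "epi_cyclic_kernel (M A) (M (insert e2 A)) f2"
    "\<And>p. p \<in> carrier P \<Longrightarrow> f2 (q A p) = q (insert e2 A) p"
    using transition_map_insert[OF A e(2)] by blast
  obtain i1 where i1: "epi_cyclic_kernel (M (insert e1 A)) (M (insert e2 (insert e1 A))) i1"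
    "\<And>p. p \<in> carrier P \<Longrightarrow> i1 (q (insert e1 A) p) = q (insert e2 (insert e1 A)) p"
    using transition_map_insert[OF sub(1) e(2)] by blast
  obtain i2 where i2: "epi_cyclic_kernel (M (insert e2 A)) (M (insert e2 (insert e1 A))) i2"
    "\<And>p. p \<in> carrier P \<Longrightarrow> i2 (q (insert e2 A) p) = q (insert e2 (insert e1 A)) p"
    using transition_map_insert[OF sub(2) e(1), unfolded comm] by blast
  have homs: "f1 \<in> hom (M A) (M (insert e1 A))" "f2 \<in> hom (M A) (M (insert e2 A))"
    "i1 \<in> hom (M (insert e1 A)) (M (insert e2 (insert e1 A)))"
    "i2 \<in> hom (M (insert e2 A)) (M (insert e2 (insert e1 A)))"
    using f1(1) f2(1) i1(1) i2(1) by (simp_all add: epi_cyclic_kernel_def epi_def)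
  have "is_pushout (M A) (M (insert e1 A)) (M (insert e2 A)) (M (insert e2 (insert e1 A))) f1 f2 i1 i2"
  proof (rule is_pushout_of_epis[OF comm_P comm_M[OF A] comm_M[OF sub(1)] comm_M[OF sub(2)]
        comm_M[OF sub(3)] q_epi[OF A] q_epi[OF sub(1)] q_epi[OF sub(2)] q_epi[OF sub(3)] homs f1(2) f2(2) i1(2) i2(2)])
    fix p assume "p \<in> kernel P (M (insert e2 (insert e1 A))) (q (insert e2 (insert e1 A)))"
    then show "\<exists>k\<in>kernel P (M (insert e1 A)) (q (insert e1 A)).
        \<exists>l\<in>kernel P (M (insert e2 A)) (q (insert e2 A)). p = k \<otimes>\<^bsub>P\<^esub> l"
      unfolding kernel_insert[OF sub(1) e(2)] using x_in_kernel_insert[OF A e(2)] by blast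
  qed
  moreover have sets: "A \<union> {e1} = insert e1 A" "A \<union> {e2} = insert e2 A"
    "A \<union> {e1, e2} = insert e2 (insert e1 A)" by auto
  ultimately show "\<exists>f1 f2 i1 i2.
      is_pushout (M A) (M (A \<union> {e1})) (M (A \<union> {e2})) (M (A \<union> {e1, e2})) f1 f2 i1 i2 \<and>
      epi_cyclic_kernel (M A) (M (A \<union> {e1})) f1 \<and>
      epi_cyclic_kernel (M A) (M (A \<union> {e2})) f2 \<and>
      epi_cyclic_kernel (M (A \<union> {e1})) (M (A \<union> {e1, e2})) i1 \<and>
      epi_cyclic_kernel (M (A \<union> {e2})) (M (A \<union> {e1, e2})) i2"
    unfolding sets using f1(1) f2(1) i1(1) i2(1) by blast
qed

text \<open>
  By induction on \<open>A\<close>, each new element contributing the powers of one generator.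
\<close>

lemma kernel_image_eq_generate:
  assumes "A \<subseteq> E"
  shows "q {} ` kernel P (M A) (q A) = generate (M {}) ((q {} \<circ> x) ` A)"
    and "kernel P (M {}) (q {}) \<subseteq> kernel P (M A) (q A)"
proof -
  interpret N: comm_group "M {}" by (rule comm_M) simp
  interpret q: group_hom P "M {}" "q {}" using q_hom[of "{}"] by unfold_locales simp
  let ?y = "q {} \<circ> x"
  have y: "?y \<in> E \<rightarrow> carrier (M {})" using x_closed by auto
  have "finite A" using assms finite_E by (rule finite_subset)
  then have *: "q {} ` kernel P (M A) (q A) = range (int_comb (M {}) A ?y) \<and>
      kernel P (M {}) (q {}) \<subseteq> kernel P (M A) (q A)"
    using assms
  proof (induction A rule: finite_induct)
    case empty
    have "\<one>\<^bsub>P\<^esub> \<in> kernel P (M {}) (q {})" by (simp add: kernel_def)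
    then have "q {} ` kernel P (M {}) (q {}) = {\<one>\<^bsub>M {}\<^esub>}"
      by (auto simp: kernel_def image_iff intro!: exI[of _ "\<one>\<^bsub>P\<^esub>"])
    then show ?case by (simp add: int_comb_def)
  next
    case (insert e A)
    then have e: "e \<in> E" "A \<subseteq> E" "insert e A \<subseteq> E" "?y e \<in> carrier (M {})" using x_closed by auto
    have yA: "?y \<in> insert e A \<rightarrow> carrier (M {})" "?y \<in> A \<rightarrow> carrier (M {})" using e y by auto
    have IH: "q {} ` kernel P (M A) (q A) = range (int_comb (M {}) A ?y)"
      using insert.IH[OF e(2)] by blast
    have ker_closed: "k \<in> carrier P" if "k \<in> kernel P (M A) (q A)" for k
      using that by (simp add: kernel_def)
    have "q {} ` kernel P (M (insert e A)) (q (insert e A)) =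
        {q {} (k \<otimes>\<^bsub>P\<^esub> x e [^]\<^bsub>P\<^esub> (n::int)) | k n. k \<in> kernel P (M A) (q A)}"
      unfolding kernel_insert[OF e(2,1)] by blast
    also have "\<dots> = {q {} k \<otimes>\<^bsub>M {}\<^esub> ?y e [^]\<^bsub>M {}\<^esub> (n::int) | k n. k \<in> kernel P (M A) (q A)}"
    proof -
      have "q {} (k \<otimes>\<^bsub>P\<^esub> x e [^]\<^bsub>P\<^esub> n) = q {} k \<otimes>\<^bsub>M {}\<^esub> ?y e [^]\<^bsub>M {}\<^esub> n"
        if "k \<in> kernel P (M A) (q A)" for k and n :: int
        using x_closed[OF e(1)] ker_closed[OF that] by (simp add: q.hom_int_pow)
      then show ?thesis by (intro Collect_cong ex_cong1) metis
    qed
    also have "\<dots> = {g \<otimes>\<^bsub>M {}\<^esub> ?y e [^]\<^bsub>M {}\<^esub> (n::int) | g n. g \<in> q {} ` kernel P (M A) (q A)}"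
      by blast
    also have "\<dots> = range (int_comb (M {}) (insert e A) ?y)"
    proof (intro subset_antisym subsetI)
      fix h assume "h \<in> {g \<otimes>\<^bsub>M {}\<^esub> ?y e [^]\<^bsub>M {}\<^esub> (n::int) | g n. g \<in> q {} ` kernel P (M A) (q A)}"
      then obtain c and n :: int where h: "h = int_comb (M {}) A ?y c \<otimes>\<^bsub>M {}\<^esub> ?y e [^]\<^bsub>M {}\<^esub> n"
        unfolding IH by blast
      have "int_comb (M {}) A ?y (c(e := n)) = int_comb (M {}) A ?y c"
        by (rule N.int_comb_cong) (use yA insert in auto)
      then have "h = int_comb (M {}) (insert e A) ?y (c(e := n))"
        using insert yA e N.int_comb_insert[of A e ?y "c(e := n)"] by (simp add: h N.m_comm)
      then show "h \<in> range (int_comb (M {}) (insert e A) ?y)" by blast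
    next
      fix h assume "h \<in> range (int_comb (M {}) (insert e A) ?y)"
      then obtain c where "h = int_comb (M {}) (insert e A) ?y c" by blast
      then have "h = int_comb (M {}) A ?y c \<otimes>\<^bsub>M {}\<^esub> ?y e [^]\<^bsub>M {}\<^esub> c e"
        using insert yA e N.int_comb_insert[of A e ?y c] by (simp add: N.m_comm)
      moreover have "int_comb (M {}) A ?y c \<in> q {} ` kernel P (M A) (q A)" unfolding IH by blast
      ultimately show "h \<in> {g \<otimes>\<^bsub>M {}\<^esub> ?y e [^]\<^bsub>M {}\<^esub> (n::int) | g n. g \<in> q {} ` kernel P (M A) (q A)}"
        by blast
    qed
    finally show ?case using insert.IH[OF e(2)] kernel_mono_insert[OF e(2,1)] by blast
  qed
  then show "kernel P (M {}) (q {}) \<subseteq> kernel P (M A) (q A)" by simp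
  show "q {} ` kernel P (M A) (q A) = generate (M {}) (?y ` A)"
    using * N.generate_eq_int_comb[of A ?y] \<open>finite A\<close> y assms by auto
qed

text \<open>
  The realizing module is \<open>M {}\<close>. Triviality of \<open>M E\<close> means that the images of all \<open>x e\<close>
  generate it, which is where finite generation comes from.
\<close>

theorem realizable_over_Z:
  assumes "q E ` carrier P = {\<one>\<^bsub>M E\<^esub>}"
  shows "realizable_over_Z E M"
  unfolding realizable_over_Z_def
proof (intro exI[of _ "M {}"] exI[of _ "q {} \<circ> x"] conjI allI impI)
  have sub: "{} \<subseteq> E" by simp
  show "comm_group (M {})" by (rule comm_M[OF sub])
  then interpret N: comm_group "M {}" .
  have y: "q {} \<circ> x \<in> E \<rightarrow> carrier (M {})" using q_surj[OF sub] x_closed by auto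
  then show "q {} \<circ> x \<in> E \<rightarrow> carrier (M {})" .
  have "kernel P (M E) (q E) = carrier P" using assms by (auto simp: kernel_def)
  then have "generate (M {}) ((q {} \<circ> x) ` E) = carrier (M {})"
    using kernel_image_eq_generate(1)[of E] q_surj[OF sub] by simp
  then show "fin_gen (M {})"
    unfolding fin_gen_def using y finite_E by (intro exI[of _ "(q {} \<circ> x) ` E"]) auto
  fix A assume A: "A \<subseteq> E"
  interpret MA: comm_group "M A" by (rule comm_M[OF A])
  obtain f where f: "f \<in> epi (M {}) (M A)" "\<And>p. p \<in> carrier P \<Longrightarrow> f (q {} p) = q A p"
    "kernel (M {}) (M A) f = q {} ` kernel P (M A) (q A)"
    using transition_map[OF sub A kernel_image_eq_generate(2)[OF A]] by blast
  interpret f: group_hom "M {}" "M A" f using f(1) by unfold_locales (auto simp: epi_def)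
  have "M {} Mod kernel (M {}) (M A) f \<cong> M A"
    by (rule f.FactGroup_iso) (use f(1) in \<open>simp add: epi_def\<close>)
  moreover have "group (M {} Mod kernel (M {}) (M A) f)"
    by (rule normal.factorgroup_is_group[OF f.normal_kernel])
  ultimately have "M A \<cong> M {} Mod kernel (M {}) (M A) f" using group.iso_sym by blast
  then show "M A \<cong> M {} Mod generate (M {}) ((q {} \<circ> x) ` A)"
    using f(3) kernel_image_eq_generate(1)[OF A] by simp
qed

end

section \<open>Quotients of a product of cyclic groups by a diagonal image\<close>

lemma comm_group_product_group:
  assumes "\<And>i. i \<in> I \<Longrightarrow> comm_group (H i)" shows "comm_group (product_group I H)"
proof (rule group.group_comm_groupI)
  show "group (product_group I H)"
    using assms by (simp add: comm_group.axioms(2))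
  fix x y assume xy: "x \<in> carrier (product_group I H)" "y \<in> carrier (product_group I H)"
  have "x i \<otimes>\<^bsub>H i\<^esub> y i = y i \<otimes>\<^bsub>H i\<^esub> x i" if "i \<in> I" for i
  proof -
    interpret comm_group "H i" by (rule assms[OF that])
    show ?thesis using xy that by (auto simp: PiE_iff m_comm)
  qed
  then show "x \<otimes>\<^bsub>product_group I H\<^esub> y = y \<otimes>\<^bsub>product_group I H\<^esub> x"
    by (auto intro!: restrict_ext)
qed

text \<open>
  For the semimatroid, \<open>\<Gamma> a\<close> is the quotient of \<open>G\<close> by the stabilizer belonging to the orbit \<open>a\<close>
  and \<open>\<eta> a\<close> is the projection onto it.
\<close>

locale product_quotients = group G
  for G :: "('g, 'm) monoid_scheme" (structure) and E :: "'e set"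
    and \<Gamma> :: "'e \<Rightarrow> 'b monoid" and \<eta> :: "'e \<Rightarrow> 'g \<Rightarrow> 'b" +
  assumes finite_E: "finite E"
    and group_\<Gamma>: "a \<in> E \<Longrightarrow> group (\<Gamma> a)"
    and cyclic_\<Gamma>: "a \<in> E \<Longrightarrow> cyclic_group (\<Gamma> a)"
    and \<eta>_hom: "a \<in> E \<Longrightarrow> \<eta> a \<in> hom G (\<Gamma> a)"
begin

definition diag :: "'e set \<Rightarrow> 'g \<Rightarrow> 'e \<Rightarrow> 'b"
  where "diag B g = (\<lambda>a\<in>B. \<eta> a g)"

abbreviation prod_\<Gamma> :: "'e set \<Rightarrow> ('e \<Rightarrow> 'b) monoid"
  where "prod_\<Gamma> B \<equiv> product_group B \<Gamma>"

abbreviation diag_image :: "'e set \<Rightarrow> ('e \<Rightarrow> 'b) set"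
  where "diag_image B \<equiv> diag B ` carrier G"

abbreviation quot :: "'e set \<Rightarrow> ('e \<Rightarrow> 'b) set monoid"
  where "quot B \<equiv> prod_\<Gamma> B Mod diag_image B"

definition gen :: "'e \<Rightarrow> 'b"
  where "gen a = (SOME x. x \<in> carrier (\<Gamma> a) \<and> subgroup_generated (\<Gamma> a) {x} = \<Gamma> a)"

definition unit_vec :: "'e set \<Rightarrow> 'e \<Rightarrow> 'e \<Rightarrow> 'b"
  where "unit_vec B e = (\<lambda>a\<in>B. if a = e then gen a else \<one>\<^bsub>\<Gamma> a\<^esub>)"

lemma comm_\<Gamma>: "a \<in> E \<Longrightarrow> comm_group (\<Gamma> a)"
  using group_\<Gamma> cyclic_\<Gamma> by (simp add: group.cyclic_imp_abelian_group)

lemma gen_props: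
  assumes "a \<in> E" shows "gen a \<in> carrier (\<Gamma> a) \<and> subgroup_generated (\<Gamma> a) {gen a} = \<Gamma> a"
proof -
  have "\<exists>x. x \<in> carrier (\<Gamma> a) \<and> subgroup_generated (\<Gamma> a) {x} = \<Gamma> a"
    using cyclic_\<Gamma>[OF assms] unfolding cyclic_group_def by blast
  then show ?thesis unfolding gen_def by (rule someI_ex)
qed

lemma gen_closed: "a \<in> E \<Longrightarrow> gen a \<in> carrier (\<Gamma> a)"
  using gen_props by blast

lemma carrier_\<Gamma>:
  assumes "a \<in> E" shows "carrier (\<Gamma> a) = range (\<lambda>n::int. gen a [^]\<^bsub>\<Gamma> a\<^esub> n)"
proof -
  interpret \<Gamma>: group "\<Gamma> a" by (rule group_\<Gamma>[OF assms])
  show ?thesis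
    using \<Gamma>.carrier_subgroup_generated_by_singleton[OF gen_closed[OF assms]] gen_props[OF assms]
    by simp
qed

lemma gen_pow_eq_one:
  assumes "a \<in> E" "infinite (carrier (\<Gamma> a))" "gen a [^]\<^bsub>\<Gamma> a\<^esub> (n::int) = \<one>\<^bsub>\<Gamma> a\<^esub>"
  shows "n = 0"
proof -
  interpret \<Gamma>: group "\<Gamma> a" by (rule group_\<Gamma>[OF assms(1)])
  have "\<Gamma>.ord (gen a) = 0"
    using \<Gamma>.infinite_cyclic_subgroup_order[OF gen_closed[OF assms(1)]] gen_props[OF assms(1)] assms(2)
    by simp
  then show ?thesis using assms(3) gen_closed[OF assms(1)] by (simp add: \<Gamma>.int_pow_eq_id)
qed

lemma comm_prod: "B \<subseteq> E \<Longrightarrow> comm_group (prod_\<Gamma> B)"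
  using comm_\<Gamma> by (intro comm_group_product_group) auto

lemma proj_hom: "a \<in> B \<Longrightarrow> (\<lambda>\<gamma>. \<gamma> a) \<in> hom (prod_\<Gamma> B) (\<Gamma> a)"
  by (auto simp: hom_def)

lemma prod_pow:
  assumes "B \<subseteq> E" "\<gamma> \<in> carrier (prod_\<Gamma> B)" "a \<in> B"
  shows "(\<gamma> [^]\<^bsub>prod_\<Gamma> B\<^esub> (n::int)) a = \<gamma> a [^]\<^bsub>\<Gamma> a\<^esub> n"
proof -
  interpret \<Gamma>: group "\<Gamma> a" using assms group_\<Gamma> by auto
  interpret P: comm_group "prod_\<Gamma> B" by (rule comm_prod[OF assms(1)])
  interpret group_hom "prod_\<Gamma> B" "\<Gamma> a" "\<lambda>\<gamma>. \<gamma> a"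
    using proj_hom[OF assms(3)] by unfold_locales
  show ?thesis using hom_int_pow[OF assms(2)] .
qed

lemma diag_group_hom:
  assumes "B \<subseteq> E" shows "group_hom G (prod_\<Gamma> B) (diag B)"
proof -
  interpret P: comm_group "prod_\<Gamma> B" by (rule comm_prod[OF assms])
  have "diag B \<in> hom G (prod_\<Gamma> B)"
    using \<eta>_hom assms by (fastforce simp: diag_def hom_def Pi_iff intro!: restrict_ext)
  then show ?thesis by unfold_locales
qed

lemma subgroup_diag_image: "B \<subseteq> E \<Longrightarrow> subgroup (diag_image B) (prod_\<Gamma> B)"
  using group_hom.img_is_subgroup[OF diag_group_hom] .

lemma comm_quot: "B \<subseteq> E \<Longrightarrow> comm_group (quot B)"
  using comm_group.abelian_FactGroup[OF comm_prod subgroup_diag_image] .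

lemma unit_vec_closed: "B \<subseteq> E \<Longrightarrow> unit_vec B e \<in> carrier (prod_\<Gamma> B)"
  using gen_closed group_\<Gamma> by (auto simp: unit_vec_def group.is_monoid dest!: subsetD)

lemma int_comb_unit_vec:
  assumes "B \<subseteq> E" "J \<subseteq> B"
  shows "int_comb (prod_\<Gamma> B) J (unit_vec B) c =
    (\<lambda>a\<in>B. if a \<in> J then gen a [^]\<^bsub>\<Gamma> a\<^esub> c a else \<one>\<^bsub>\<Gamma> a\<^esub>)" (is "?L = ?R")
proof (rule extensionalityI[of _ B])
  interpret P: comm_group "prod_\<Gamma> B" by (rule comm_prod[OF assms(1)])
  have J: "finite J" using assms finite_E by (meson finite_subset)
  have y: "unit_vec B \<in> J \<rightarrow> carrier (prod_\<Gamma> B)" using unit_vec_closed[OF assms(1)] by auto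
  show "?L \<in> extensional B" using P.int_comb_closed[OF y, of c] by (simp add: PiE_iff)
  show "?R \<in> extensional B" by simp
  fix a assume a: "a \<in> B"
  then have aE: "a \<in> E" using assms by auto
  interpret \<Gamma>: comm_group "\<Gamma> a" by (rule comm_\<Gamma>[OF aE])
  let ?y = "\<lambda>e. if e = a then gen a else \<one>\<^bsub>\<Gamma> a\<^esub>"
  have "?L a = int_comb (\<Gamma> a) J ((\<lambda>\<gamma>. \<gamma> a) \<circ> unit_vec B) c"
    by (rule hom_int_comb[OF P.comm_group_axioms \<Gamma>.comm_group_axioms proj_hom[OF a] J y])
  also have "(\<lambda>\<gamma>. \<gamma> a) \<circ> unit_vec B = ?y" using a by (auto simp: unit_vec_def)
  also have "int_comb (\<Gamma> a) J ?y c = ?R a"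
  proof (cases "a \<in> J")
    case True
    have "int_comb (\<Gamma> a) (J - {a}) ?y c = \<one>\<^bsub>\<Gamma> a\<^esub>"
      unfolding int_comb_def by (rule \<Gamma>.finprod_one_eqI) auto
    then show ?thesis
      using True a gen_closed[OF aE] \<Gamma>.int_comb_remove[OF J True, of ?y c] by simp
  next
    case False
    have "int_comb (\<Gamma> a) J ?y c = \<one>\<^bsub>\<Gamma> a\<^esub>"
      unfolding int_comb_def by (rule \<Gamma>.finprod_one_eqI) (use False in auto)
    then show ?thesis using False a by simp
  qed
  finally show "?L a = ?R a" .
qed

text \<open>
  Elements supported on \<open>J\<close> are combinations of the unit vectors in \<open>J\<close>, all factors being
  cyclic.
\<close>

lemma unit_vec_expansion:
  assumes "B \<subseteq> E" "J \<subseteq> B" "\<gamma> \<in> carrier (prod_\<Gamma> B)"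
    and triv: "\<And>a. a \<in> B - J \<Longrightarrow> \<gamma> a = \<one>\<^bsub>\<Gamma> a\<^esub>"
  obtains c where "\<gamma> = int_comb (prod_\<Gamma> B) J (unit_vec B) c"
proof -
  have "\<exists>n::int. \<gamma> a = gen a [^]\<^bsub>\<Gamma> a\<^esub> n" if "a \<in> B" for a
  proof -
    have "\<gamma> a \<in> carrier (\<Gamma> a)" using assms(3) that by auto
    then show ?thesis using carrier_\<Gamma>[of a] that assms(1) by auto
  qed
  then have "\<exists>c. \<forall>a\<in>B. \<gamma> a = gen a [^]\<^bsub>\<Gamma> a\<^esub> (c a :: int)" by (rule bchoice[OF ballI])
  then obtain c where c: "\<And>a. a \<in> B \<Longrightarrow> \<gamma> a = gen a [^]\<^bsub>\<Gamma> a\<^esub> (c a :: int)" by blast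
  have "\<gamma> = (\<lambda>a\<in>B. if a \<in> J then gen a [^]\<^bsub>\<Gamma> a\<^esub> c a else \<one>\<^bsub>\<Gamma> a\<^esub>)"
    by (rule extensionalityI[of _ B]) (use assms(3) triv c in \<open>auto simp: PiE_iff\<close>)
  then show thesis using that int_comb_unit_vec[OF assms(1,2)] by simp
qed

lemma quot_epi:
  assumes "B \<subseteq> E"
  shows "(\<lambda>\<gamma>. diag_image B #>\<^bsub>prod_\<Gamma> B\<^esub> \<gamma>) \<in> epi (prod_\<Gamma> B) (quot B)"
proof -
  interpret P: comm_group "prod_\<Gamma> B" by (rule comm_prod[OF assms])
  interpret N: normal "diag_image B" "prod_\<Gamma> B"
    by (rule P.subgroup_imp_normal[OF subgroup_diag_image[OF assms]])
  show ?thesis using N.r_coset_hom_Mod by (simp add: epi_def carrier_FactGroup)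
qed

lemma fin_gen_quot:
  assumes "B \<subseteq> E" shows "fin_gen (quot B)"
proof -
  interpret P: comm_group "prod_\<Gamma> B" by (rule comm_prod[OF assms])
  have "spanning_family (prod_\<Gamma> B) B (unit_vec B)"
    unfolding spanning_family_def
  proof (intro conjI ballI)
    fix \<gamma> assume "\<gamma> \<in> carrier (prod_\<Gamma> B)"
    then obtain c where "\<gamma> = int_comb (prod_\<Gamma> B) B (unit_vec B) c"
      using unit_vec_expansion[OF assms subset_refl] by blast
    then show "\<exists>c. \<gamma> = int_comb (prod_\<Gamma> B) B (unit_vec B) c" by (intro exI[of _ c])
  next
    show "finite B" using assms finite_E by (rule finite_subset)
    show "unit_vec B \<in> B \<rightarrow> carrier (prod_\<Gamma> B)" using unit_vec_closed[OF assms] by blast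
  qed
  from P.spanning_family_image[OF this comm_quot[OF assms] quot_epi[OF assms]]
  show ?thesis by (rule comm_group.spanning_family_fin_gen[OF comm_quot[OF assms]])
qed

lemma restrict_hom:
  assumes "B \<subseteq> E" shows "(\<lambda>\<gamma>. restrict \<gamma> B) \<in> hom (prod_\<Gamma> E) (prod_\<Gamma> B)"
  using assms by (auto simp: hom_def Int_absorb1 intro!: restrict_ext)

lemma restrict_surj:
  assumes "B \<subseteq> E" shows "(\<lambda>\<gamma>. restrict \<gamma> B) ` carrier (prod_\<Gamma> E) = carrier (prod_\<Gamma> B)"
proof
  show "(\<lambda>\<gamma>. restrict \<gamma> B) ` carrier (prod_\<Gamma> E) \<subseteq> carrier (prod_\<Gamma> B)"
    using assms by auto
  show "carrier (prod_\<Gamma> B) \<subseteq> (\<lambda>\<gamma>. restrict \<gamma> B) ` carrier (prod_\<Gamma> E)"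
  proof
    fix \<gamma> assume \<gamma>: "\<gamma> \<in> carrier (prod_\<Gamma> B)"
    let ?\<delta> = "\<lambda>a\<in>E. if a \<in> B then \<gamma> a else \<one>\<^bsub>\<Gamma> a\<^esub>"
    have "?\<delta> \<in> carrier (prod_\<Gamma> E)"
      using \<gamma> group_\<Gamma> by (auto simp: group.is_monoid)
    moreover have "restrict ?\<delta> B = \<gamma>"
      by (rule extensionalityI[of _ B]) (use \<gamma> assms in \<open>auto simp: PiE_iff\<close>)
    ultimately show "\<gamma> \<in> (\<lambda>\<gamma>. restrict \<gamma> B) ` carrier (prod_\<Gamma> E)" by (intro image_eqI[of _ _ ?\<delta>]) (rule sym)
  qed
qed

definition quot_map :: "'e set \<Rightarrow> ('e \<Rightarrow> 'b) \<Rightarrow> ('e \<Rightarrow> 'b) set"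
  where "quot_map A \<gamma> = diag_image (E - A) #>\<^bsub>prod_\<Gamma> (E - A)\<^esub> restrict \<gamma> (E - A)"

lemma kernel_quot_map:
  "kernel (prod_\<Gamma> E) (quot (E - A)) (quot_map A) =
    {\<gamma> \<in> carrier (prod_\<Gamma> E). restrict \<gamma> (E - A) \<in> diag_image (E - A)}"
proof -
  let ?B = "E - A"
  interpret P: comm_group "prod_\<Gamma> ?B" by (rule comm_prod) auto
  have sub: "subgroup (diag_image ?B) (prod_\<Gamma> ?B)" by (rule subgroup_diag_image) auto
  have closed: "restrict \<gamma> ?B \<in> carrier (prod_\<Gamma> ?B)" if "\<gamma> \<in> carrier (prod_\<Gamma> E)" for \<gamma>
    using that by auto
  show ?thesis
    unfolding kernel_def quot_map_def one_FactGroup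
    using P.coset_join1[OF _ closed sub] P.coset_join2[OF closed sub] by blast
qed

text \<open>
  An element \<open>\<gamma>\<close> of the larger kernel agrees with the diagonal element of some \<open>g\<close> away from
  \<open>A\<close>, except possibly at \<open>e\<close>; the error at \<open>e\<close> is a power of the generator of \<open>\<Gamma> e\<close> and can be
  removed by a power of the unit vector. If \<open>e \<in> A\<close>, the coordinate \<open>e\<close> is not seen by either
  kernel and the same computation applies.
\<close>

lemma kernel_quot_map_insert:
  assumes e: "e \<in> E"
  shows "kernel (prod_\<Gamma> E) (quot (E - insert e A)) (quot_map (insert e A)) =
    {k \<otimes>\<^bsub>prod_\<Gamma> E\<^esub> unit_vec E e [^]\<^bsub>prod_\<Gamma> E\<^esub> (n::int) | k n.
      k \<in> kernel (prod_\<Gamma> E) (quot (E - A)) (quot_map A)}"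
    (is "?L = ?R")
proof -
  interpret P: comm_group "prod_\<Gamma> E" by (rule comm_prod) simp
  have u: "unit_vec E e \<in> carrier (prod_\<Gamma> E)" by (rule unit_vec_closed) simp
  have u_pow: "(unit_vec E e [^]\<^bsub>prod_\<Gamma> E\<^esub> (n::int)) a =
      (if a = e then gen e [^]\<^bsub>\<Gamma> e\<^esub> n else \<one>\<^bsub>\<Gamma> a\<^esub>)" if "a \<in> E" for a n
  proof -
    interpret \<Gamma>: group "\<Gamma> a" by (rule group_\<Gamma>[OF that])
    show ?thesis using prod_pow[OF subset_refl u that] that by (simp add: unit_vec_def)
  qed
  show ?thesis
  proof (intro subset_antisym subsetI)
    fix \<gamma> assume "\<gamma> \<in> ?R"
    then obtain k n where k: "k \<in> carrier (prod_\<Gamma> E)" "restrict k (E - A) \<in> diag_image (E - A)"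
      and \<gamma>: "\<gamma> = k \<otimes>\<^bsub>prod_\<Gamma> E\<^esub> unit_vec E e [^]\<^bsub>prod_\<Gamma> E\<^esub> (n::int)"
      unfolding kernel_quot_map by blast
    obtain g where g: "g \<in> carrier G" "restrict k (E - A) = diag (E - A) g" using k(2) by blast
    have "restrict \<gamma> (E - insert e A) = diag (E - insert e A) g"
    proof (rule extensionalityI[of _ "E - insert e A"])
      fix a assume a: "a \<in> E - insert e A"
      then interpret \<Gamma>: group "\<Gamma> a" by (intro group_\<Gamma>) auto
      have "k a = \<eta> a g" using fun_cong[OF g(2), of a] a by (simp add: diag_def)
      moreover have "k a \<in> carrier (\<Gamma> a)" using k(1) a by auto
      ultimately show "restrict \<gamma> (E - insert e A) a = diag (E - insert e A) g a"
        using a by (simp add: \<gamma> u_pow diag_def)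
    qed (simp_all add: diag_def)
    moreover have "\<gamma> \<in> carrier (prod_\<Gamma> E)" unfolding \<gamma> using k(1) u by (intro P.m_closed P.int_pow_closed)
    ultimately show "\<gamma> \<in> ?L" unfolding kernel_quot_map using g(1) by blast
  next
    fix \<gamma> assume "\<gamma> \<in> ?L"
    then obtain g where \<gamma>: "\<gamma> \<in> carrier (prod_\<Gamma> E)" and g: "g \<in> carrier G"
      "restrict \<gamma> (E - insert e A) = diag (E - insert e A) g"
      unfolding kernel_quot_map by blast
    interpret \<Gamma>e: comm_group "\<Gamma> e" by (rule comm_\<Gamma>[OF e])
    have \<eta>e: "\<eta> e g \<in> carrier (\<Gamma> e)" using \<eta>_hom[OF e] g(1) by (auto simp: hom_def)
    have \<gamma>e: "\<gamma> e \<in> carrier (\<Gamma> e)" using \<gamma> e by auto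
    then have "inv\<^bsub>\<Gamma> e\<^esub> \<eta> e g \<otimes>\<^bsub>\<Gamma> e\<^esub> \<gamma> e \<in> carrier (\<Gamma> e)" using \<eta>e by simp
    then obtain n :: int where n: "inv\<^bsub>\<Gamma> e\<^esub> \<eta> e g \<otimes>\<^bsub>\<Gamma> e\<^esub> \<gamma> e = gen e [^]\<^bsub>\<Gamma> e\<^esub> n"
      unfolding carrier_\<Gamma>[OF e] by blast
    define v where "v = unit_vec E e [^]\<^bsub>prod_\<Gamma> E\<^esub> n"
    have v: "v \<in> carrier (prod_\<Gamma> E)" unfolding v_def using u by (rule P.int_pow_closed)
    define k where "k = \<gamma> \<otimes>\<^bsub>prod_\<Gamma> E\<^esub> inv\<^bsub>prod_\<Gamma> E\<^esub> v"
    have k: "k \<in> carrier (prod_\<Gamma> E)" unfolding k_def using \<gamma> v by (intro P.m_closed P.inv_closed)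
    have v_at: "v a = (if a = e then gen e [^]\<^bsub>\<Gamma> e\<^esub> n else \<one>\<^bsub>\<Gamma> a\<^esub>)" if "a \<in> E" for a
      unfolding v_def by (rule u_pow[OF that])
    have inv_v: "inv\<^bsub>prod_\<Gamma> E\<^esub> v = (\<lambda>a\<in>E. inv\<^bsub>\<Gamma> a\<^esub> v a)"
      by (rule inv_product_group) (use v group_\<Gamma> in auto)
    have "restrict k (E - A) = diag (E - A) g"
    proof (rule extensionalityI[of _ "E - A"])
      fix a assume a: "a \<in> E - A"
      then interpret \<Gamma>: comm_group "\<Gamma> a" by (intro comm_\<Gamma>) auto
      show "restrict k (E - A) a = diag (E - A) g a"
      proof (cases "a = e")
        case True
        have "k e = \<gamma> e \<otimes>\<^bsub>\<Gamma> e\<^esub> inv\<^bsub>\<Gamma> e\<^esub> (inv\<^bsub>\<Gamma> e\<^esub> \<eta> e g \<otimes>\<^bsub>\<Gamma> e\<^esub> \<gamma> e)"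
          using e n by (simp add: k_def inv_v v_at)
        also have "\<dots> = \<eta> e g" using \<gamma>e \<eta>e by (simp add: \<Gamma>e.inv_mult \<Gamma>e.m_lcomm[of "\<gamma> e" "\<eta> e g"])
        finally show ?thesis using True a by (simp add: diag_def)
      next
        case False
        have "\<gamma> a = \<eta> a g" using fun_cong[OF g(2), of a] a False by (simp add: diag_def)
        moreover have "\<gamma> a \<in> carrier (\<Gamma> a)" using \<gamma> a by auto
        ultimately show ?thesis using a False by (simp add: k_def inv_v v_at diag_def)
      qed
    qed (simp_all add: diag_def)
    then have "k \<in> kernel (prod_\<Gamma> E) (quot (E - A)) (quot_map A)"
      unfolding kernel_quot_map using k g(1) by blast
    moreover have "\<gamma> = k \<otimes>\<^bsub>prod_\<Gamma> E\<^esub> v"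
      unfolding k_def using \<gamma> v by (simp only: P.m_assoc P.inv_closed P.l_inv P.r_one)
    ultimately show "\<gamma> \<in> ?R" unfolding v_def by blast
  qed
qed

sublocale elementwise_quotients "prod_\<Gamma> E" E "\<lambda>A. quot (E - A)" quot_map "unit_vec E"
proof (rule elementwise_quotients.intro)
  show "comm_group (prod_\<Gamma> E)" by (rule comm_prod) simp
  show "finite E" by (rule finite_E)
  show "comm_group (quot (E - A))" for A by (rule comm_quot) auto
  show "unit_vec E e \<in> carrier (prod_\<Gamma> E)" for e by (rule unit_vec_closed) simp
  show "kernel (prod_\<Gamma> E) (quot (E - insert e A)) (quot_map (insert e A)) =
    {k \<otimes>\<^bsub>prod_\<Gamma> E\<^esub> unit_vec E e [^]\<^bsub>prod_\<Gamma> E\<^esub> (n::int) | k n.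
      k \<in> kernel (prod_\<Gamma> E) (quot (E - A)) (quot_map A)}" if "e \<in> E" for A e
    using that by (rule kernel_quot_map_insert)
  have sub: "E - A \<subseteq> E" for A by auto
  have "(\<lambda>\<gamma>. restrict \<gamma> (E - A)) \<in> epi (prod_\<Gamma> E) (prod_\<Gamma> (E - A))" for A
    unfolding epi_def using restrict_hom[OF sub] restrict_surj[OF sub] by blast
  from epi_compose[OF this quot_epi[OF sub]]
  show "quot_map A \<in> epi (prod_\<Gamma> E) (quot (E - A))" for A
    by (simp only: comp_def quot_map_def[abs_def])
qed

theorem realizable_matroid_over_Z:
  "matroid_over_Z E (\<lambda>A. quot (E - A))" "realizable_over_Z E (\<lambda>A. quot (E - A))"
proof -
  show "matroid_over_Z E (\<lambda>A. quot (E - A))" by (rule matroid_over_Z)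
  have "diag_image {} = {\<lambda>_. undefined}" using one_closed by (force simp: diag_def)
  then have "quot_map E \<gamma> = \<one>\<^bsub>quot (E - E)\<^esub>" if "\<gamma> \<in> carrier (prod_\<Gamma> E)" for \<gamma>
    by (simp add: quot_map_def r_coset_def)
  moreover have "carrier (prod_\<Gamma> E) \<noteq> {}" using P.one_closed by blast
  ultimately have "quot_map E ` carrier (prod_\<Gamma> E) = {\<one>\<^bsub>quot (E - E)\<^esub>}" by blast
  then show "realizable_over_Z E (\<lambda>A. quot (E - A))" by (rule realizable_over_Z)
qed

text \<open>
  The unit vectors in \<open>B - I\<close> are independent modulo the diagonal image, because a combination of
  them has trivial coordinates in \<open>I\<close> and \<open>faithful\<close> applies. They span up to torsion, because a
  power of a given element agrees on \<open>I\<close> with a diagonal element.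
\<close>

theorem Z_rank_quot:
  assumes B: "B \<subseteq> E" and I: "I \<subseteq> B"
    and inf: "\<And>a. a \<in> B \<Longrightarrow> infinite (carrier (\<Gamma> a))"
    and faithful: "\<And>\<gamma>. \<gamma> \<in> diag_image B \<Longrightarrow> (\<And>a. a \<in> I \<Longrightarrow> \<gamma> a = \<one>\<^bsub>\<Gamma> a\<^esub>) \<Longrightarrow>
      \<gamma> = \<one>\<^bsub>prod_\<Gamma> B\<^esub>"
    and finite_index: "\<And>\<gamma>. \<gamma> \<in> carrier (prod_\<Gamma> I) \<Longrightarrow>
      \<exists>n::int. n > 0 \<and> \<gamma> [^]\<^bsub>prod_\<Gamma> I\<^esub> n \<in> diag_image I"
  shows "Z_rank (quot B) = card (B - I)"
proof -
  let ?J = "B - I" and ?L = "diag_image B" and ?q = "\<lambda>\<gamma>. diag_image B #>\<^bsub>prod_\<Gamma> B\<^esub> \<gamma>"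
  interpret PB: comm_group "prod_\<Gamma> B" by (rule comm_prod[OF B])
  interpret Q: comm_group "quot B" by (rule comm_quot[OF B])
  have sub: "subgroup ?L (prod_\<Gamma> B)" by (rule subgroup_diag_image[OF B])
  interpret N: normal ?L "prod_\<Gamma> B" by (rule PB.subgroup_imp_normal[OF sub])
  have qhom: "?q \<in> hom (prod_\<Gamma> B) (quot B)" using quot_epi[OF B] by (simp add: epi_def)
  have IE: "I \<subseteq> E" using I B by auto
  have J: "finite ?J" "?J \<subseteq> B" using B finite_E finite_subset by auto
  have y: "unit_vec B \<in> ?J \<rightarrow> carrier (prod_\<Gamma> B)" using unit_vec_closed[OF B] by blast
  have comb: "?q (int_comb (prod_\<Gamma> B) ?J (unit_vec B) c) = int_comb (quot B) ?J (?q \<circ> unit_vec B) c" for c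
    by (rule hom_int_comb[OF PB.comm_group_axioms Q.comm_group_axioms qhom J(1) y])
  have "independent_family (quot B) ?J (?q \<circ> unit_vec B)"
    unfolding independent_family_def
  proof (intro conjI allI impI ballI)
    show "finite ?J" by (rule J)
    show "?q \<circ> unit_vec B \<in> ?J \<rightarrow> carrier (quot B)" using y unfolding carrier_FactGroup by (auto simp del: carrier_product_group)
    fix c a assume "int_comb (quot B) ?J (?q \<circ> unit_vec B) c = \<one>\<^bsub>quot B\<^esub>" and a: "a \<in> ?J"
    then have "?q (int_comb (prod_\<Gamma> B) ?J (unit_vec B) c) = ?L" by (simp only: comb one_FactGroup)
    then have "int_comb (prod_\<Gamma> B) ?J (unit_vec B) c \<in> ?L"
      by (rule PB.coset_join1[OF _ PB.int_comb_closed[OF y] sub])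
    then have "int_comb (prod_\<Gamma> B) ?J (unit_vec B) c = \<one>\<^bsub>prod_\<Gamma> B\<^esub>"
      by (rule faithful) (use I in \<open>auto simp: int_comb_unit_vec[OF B J(2)]\<close>)
    from fun_cong[OF this, of a] have "gen a [^]\<^bsub>\<Gamma> a\<^esub> c a = \<one>\<^bsub>\<Gamma> a\<^esub>"
      using a by (simp add: int_comb_unit_vec[OF B J(2)])
    then show "c a = 0" using a B inf by (intro gen_pow_eq_one[of a]) auto
  qed
  moreover have "\<exists>n::int. n > 0 \<and> (\<exists>c. X [^]\<^bsub>quot B\<^esub> n = int_comb (quot B) ?J (?q \<circ> unit_vec B) c)"
    if X: "X \<in> carrier (quot B)" for X
  proof -
    obtain \<gamma> where \<gamma>: "\<gamma> \<in> carrier (prod_\<Gamma> B)" "X = ?q \<gamma>" using X by (auto simp: carrier_FactGroup)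
    have \<gamma>I: "restrict \<gamma> I \<in> carrier (prod_\<Gamma> I)" using \<gamma>(1) I by auto
    obtain n :: int and g where n: "n > 0" and g: "g \<in> carrier G"
      "restrict \<gamma> I [^]\<^bsub>prod_\<Gamma> I\<^esub> n = diag I g" using finite_index[OF \<gamma>I] by blast
    define \<delta> where "\<delta> = \<gamma> [^]\<^bsub>prod_\<Gamma> B\<^esub> n"
    have \<delta>: "\<delta> \<in> carrier (prod_\<Gamma> B)" unfolding \<delta>_def using \<gamma>(1) by (rule PB.int_pow_closed)
    define d where "d = diag B g"
    have dL: "d \<in> ?L" unfolding d_def using g(1) by blast
    have d: "d \<in> carrier (prod_\<Gamma> B)" using dL by (rule N.mem_carrier)
    define \<epsilon> where "\<epsilon> = inv\<^bsub>prod_\<Gamma> B\<^esub> d \<otimes>\<^bsub>prod_\<Gamma> B\<^esub> \<delta>"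
    have \<epsilon>: "\<epsilon> \<in> carrier (prod_\<Gamma> B)" unfolding \<epsilon>_def using d \<delta> by (intro PB.m_closed PB.inv_closed)
    have inv_d: "inv\<^bsub>prod_\<Gamma> B\<^esub> d = (\<lambda>a\<in>B. inv\<^bsub>\<Gamma> a\<^esub> d a)"
      by (rule inv_product_group) (use d group_\<Gamma> B in auto)
    have "\<epsilon> a = \<one>\<^bsub>\<Gamma> a\<^esub>" if "a \<in> B - ?J" for a
    proof -
      have a: "a \<in> I" "a \<in> B" using that I by auto
      interpret \<Gamma>: group "\<Gamma> a" using a B by (intro group_\<Gamma>) auto
      have "\<delta> a = \<gamma> a [^]\<^bsub>\<Gamma> a\<^esub> n" unfolding \<delta>_def by (rule prod_pow[OF B \<gamma>(1) a(2)])
      also have "\<dots> = (restrict \<gamma> I [^]\<^bsub>prod_\<Gamma> I\<^esub> n) a" using prod_pow[OF IE \<gamma>I a(1)] a by simp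
      also have "\<dots> = d a" using a by (simp add: g(2) d_def diag_def)
      finally have "\<delta> a = d a" .
      moreover have "d a \<in> carrier (\<Gamma> a)" using d a by auto
      ultimately show ?thesis using a by (simp add: \<epsilon>_def inv_d)
    qed
    from unit_vec_expansion[OF B J(2) \<epsilon> this]
    obtain c where c: "\<epsilon> = int_comb (prod_\<Gamma> B) ?J (unit_vec B) c" by blast
    have "X [^]\<^bsub>quot B\<^esub> n = ?q \<delta>"
      unfolding \<gamma>(2) \<delta>_def by (rule N.FactGroup_int_pow[OF \<gamma>(1)])
    also have "\<delta> = d \<otimes>\<^bsub>prod_\<Gamma> B\<^esub> \<epsilon>"
      unfolding \<epsilon>_def using d \<delta> PB.m_assoc[OF d PB.inv_closed[OF d] \<delta>, symmetric]
      by (simp only: PB.r_inv PB.l_one)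
    also have "?q (d \<otimes>\<^bsub>prod_\<Gamma> B\<^esub> \<epsilon>) = ?q \<epsilon>"
      using PB.coset_mult_assoc[OF N.subset d \<epsilon>] PB.coset_join2[OF d sub dL] by simp
    also have "\<dots> = int_comb (quot B) ?J (?q \<circ> unit_vec B) c" unfolding c by (rule comb)
    finally show ?thesis using n by blast
  qed
  ultimately show ?thesis by (rule Q.Z_rank_eqI)
qed

end

context product_quotients
begin

lemma torsion_free_prod:
  assumes B: "B \<subseteq> E" and inf: "\<And>a. a \<in> B \<Longrightarrow> infinite (carrier (\<Gamma> a))"
    and \<gamma>: "\<gamma> \<in> carrier (prod_\<Gamma> B)" and n: "n \<noteq> 0" "\<gamma> [^]\<^bsub>prod_\<Gamma> B\<^esub> (n::int) = \<one>\<^bsub>prod_\<Gamma> B\<^esub>"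
  shows "\<gamma> = \<one>\<^bsub>prod_\<Gamma> B\<^esub>"
proof (rule extensionalityI[of _ B])
  show "\<gamma> \<in> extensional B" using \<gamma> by (simp add: PiE_iff)
  show "\<one>\<^bsub>prod_\<Gamma> B\<^esub> \<in> extensional B" by simp
  fix a assume a: "a \<in> B"
  then have aE: "a \<in> E" using B by auto
  interpret \<Gamma>a: group "\<Gamma> a" by (rule group_\<Gamma>[OF aE])
  have "\<gamma> a \<in> carrier (\<Gamma> a)" using \<gamma> a by auto
  then obtain c :: int where c: "\<gamma> a = gen a [^]\<^bsub>\<Gamma> a\<^esub> c" using carrier_\<Gamma>[OF aE] by auto
  have "gen a [^]\<^bsub>\<Gamma> a\<^esub> (c * n) = (\<gamma> [^]\<^bsub>prod_\<Gamma> B\<^esub> n) a"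
    using prod_pow[OF B \<gamma> a] gen_closed[OF aE] by (simp add: c \<Gamma>a.int_pow_pow)
  also have "\<dots> = \<one>\<^bsub>\<Gamma> a\<^esub>" using n(2) a by simp
  finally have "c * n = 0" by (rule gen_pow_eq_one[OF aE inf[OF a]])
  then show "\<gamma> a = \<one>\<^bsub>prod_\<Gamma> B\<^esub> a" using n(1) a by (simp add: c)
qed

text \<open>
  If \<open>\<gamma>\<close> has a power in the diagonal image, this power lies in \<open>W\<close>, so by purity it is the power
  of an element of \<open>W\<close>; the product being torsion-free, \<open>\<gamma>\<close> is this element. Conversely, a
  finite quotient consists of torsion.
\<close>

theorem torsion_quot:
  assumes B: "B \<subseteq> E" and inf: "\<And>a. a \<in> B \<Longrightarrow> infinite (carrier (\<Gamma> a))"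
    and pure: "pure_subgroup W (prod_\<Gamma> B)" and LW: "diag_image B \<subseteq> W"
    and fin: "finite ((\<lambda>w. diag_image B #>\<^bsub>prod_\<Gamma> B\<^esub> w) ` W)"
  shows "torsion (quot B) = (\<lambda>w. diag_image B #>\<^bsub>prod_\<Gamma> B\<^esub> w) ` W"
proof -
  let ?L = "diag_image B" and ?P = "prod_\<Gamma> B"
  interpret PB: comm_group ?P by (rule comm_prod[OF B])
  have sub: "subgroup ?L ?P" by (rule subgroup_diag_image[OF B])
  interpret N: normal ?L ?P by (rule PB.subgroup_imp_normal[OF sub])
  have W: "subgroup W ?P"
    and pure_pow: "(\<lambda>w. w [^]\<^bsub>?P\<^esub> n) ` W = W \<inter> (\<lambda>x. x [^]\<^bsub>?P\<^esub> n) ` carrier ?P" for n :: int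
    using pure by (simp_all only: pure_subgroup_def)
  have carr: "carrier (quot B) = (\<lambda>w. ?L #>\<^bsub>?P\<^esub> w) ` carrier ?P" by (rule carrier_FactGroup)
  show ?thesis
  proof (intro subset_antisym subsetI)
    fix X assume X: "X \<in> torsion (quot B)"
    then have "X \<in> carrier (quot B)" unfolding torsion_def by blast
    then obtain \<gamma> where \<gamma>: "\<gamma> \<in> carrier ?P" "X = ?L #>\<^bsub>?P\<^esub> \<gamma>" unfolding carr by blast
    obtain n :: nat where n: "n > 0" "X [^]\<^bsub>quot B\<^esub> n = ?L"
      using X unfolding torsion_def one_FactGroup by blast
    have "?L #>\<^bsub>?P\<^esub> \<gamma> [^]\<^bsub>?P\<^esub> n = ?L" using n(2) unfolding \<gamma>(2) N.FactGroup_pow[OF \<gamma>(1)] .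
    then have "\<gamma> [^]\<^bsub>?P\<^esub> n \<in> ?L"
      by (rule PB.coset_join1[OF _ PB.nat_pow_closed[OF \<gamma>(1)] sub])
    then have "\<gamma> [^]\<^bsub>?P\<^esub> int n \<in> W" using LW unfolding int_pow_int by (rule rev_subsetD)
    then have "\<gamma> [^]\<^bsub>?P\<^esub> int n \<in> (\<lambda>w. w [^]\<^bsub>?P\<^esub> int n) ` W" unfolding pure_pow using \<gamma>(1) by blast
    then obtain w where w: "w \<in> W" "\<gamma> [^]\<^bsub>?P\<^esub> int n = w [^]\<^bsub>?P\<^esub> int n" by blast
    have wP: "w \<in> carrier ?P" using w(1) subgroup.subset[OF W] by blast
    have "(\<gamma> \<otimes>\<^bsub>?P\<^esub> inv\<^bsub>?P\<^esub> w) [^]\<^bsub>?P\<^esub> int n = \<one>\<^bsub>?P\<^esub>"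
      unfolding PB.int_pow_distrib[OF \<gamma>(1) PB.inv_closed[OF wP]] PB.int_pow_inv[OF wP] w(2)
      by (rule PB.r_inv[OF PB.int_pow_closed[OF wP]])
    then have "\<gamma> \<otimes>\<^bsub>?P\<^esub> inv\<^bsub>?P\<^esub> w = \<one>\<^bsub>?P\<^esub>"
      by (intro torsion_free_prod[OF B inf PB.m_closed[OF \<gamma>(1) PB.inv_closed[OF wP]], of "int n"])
        (use n(1) in auto)
    then have "\<gamma> = w"
      using PB.inv_equality[of \<gamma> "inv\<^bsub>?P\<^esub> w"] PB.inv_inv[OF wP] PB.inv_closed[OF wP] \<gamma>(1) by metis
    then show "X \<in> (\<lambda>w. ?L #>\<^bsub>?P\<^esub> w) ` W" using w(1) \<gamma>(2) by blast
  next
    fix X assume "X \<in> (\<lambda>w. ?L #>\<^bsub>?P\<^esub> w) ` W"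
    then obtain w where w: "w \<in> W" "X = ?L #>\<^bsub>?P\<^esub> w" by blast
    have wP: "w \<in> carrier ?P" using w(1) subgroup.subset[OF W] by blast
    have "w [^]\<^bsub>?P\<^esub> n \<in> W" for n :: nat
      using PB.subgroup_int_pow_closed[OF W w(1), of "int n"] unfolding int_pow_int .
    then have "range (\<lambda>n::nat. ?L #>\<^bsub>?P\<^esub> w [^]\<^bsub>?P\<^esub> n) \<subseteq> (\<lambda>w. ?L #>\<^bsub>?P\<^esub> w) ` W" by blast
    then have "finite (range (\<lambda>n::nat. ?L #>\<^bsub>?P\<^esub> w [^]\<^bsub>?P\<^esub> n))" using fin by (rule finite_subset)
    from PB.pow_mem_of_finite_cosets[OF sub wP this]
    obtain n :: nat where n: "n > 0" "w [^]\<^bsub>?P\<^esub> n \<in> ?L" .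
    have "X [^]\<^bsub>quot B\<^esub> n = ?L"
      unfolding w(2) N.FactGroup_pow[OF wP]
      by (rule PB.coset_join2[OF PB.nat_pow_closed[OF wP] sub n(2)])
    moreover have "X \<in> carrier (quot B)" unfolding carr w(2) using wP by blast
    ultimately show "X \<in> torsion (quot B)" unfolding torsion_def one_FactGroup using n(1) by blast
  qed
qed

end

section \<open>Duals and bases of matroids\<close>

lemma matroid_dual:
  assumes "matroid E r" shows "matroid E (dual_rank E r)"
proof -
  have fin: "finite E" and le: "\<And>A. A \<subseteq> E \<Longrightarrow> r A \<le> card A"
    and mono: "\<And>A B. A \<subseteq> B \<Longrightarrow> B \<subseteq> E \<Longrightarrow> r A \<le> r B"
    and submod: "\<And>A B. A \<subseteq> E \<Longrightarrow> B \<subseteq> E \<Longrightarrow> r (A \<union> B) + r (A \<inter> B) \<le> r A + r B"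
    using assms by (auto simp: matroid_def)
  have card_mono_rank: "r B \<le> r A + card (B - A)" if "A \<subseteq> B" "B \<subseteq> E" for A B
  proof -
    have "r (A \<union> (B - A)) + r (A \<inter> (B - A)) \<le> r A + r (B - A)" using that by (intro submod) auto
    moreover have "A \<union> (B - A) = B" using that by auto
    moreover have "r (B - A) \<le> card (B - A)" using that by (intro le) auto
    ultimately show ?thesis by simp
  qed
  have finA: "finite A" if "A \<subseteq> E" for A using that fin by (rule finite_subset)
  have rE: "r E \<le> r (E - A) + card A" if "A \<subseteq> E" for A
    using card_mono_rank[of "E - A" E] that by (simp add: double_diff)
  show ?thesis
    unfolding matroid_def dual_rank_def
  proof (intro conjI allI impI fin)
    fix A assume A: "A \<subseteq> E"
    have "r (E - A) \<le> r E" by (rule mono) auto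
    then show "r (E - A) + card A - r E \<le> card A" by simp
  next
    fix A B assume AB: "A \<subseteq> B \<and> B \<subseteq> E"
    have "r (E - A) \<le> r (E - B) + card ((E - A) - (E - B))" using AB by (intro card_mono_rank) auto
    also have "(E - A) - (E - B) = B - A" using AB by auto
    also have "card (B - A) = card B - card A" using AB finA by (intro card_Diff_subset) auto
    finally have "r (E - A) + card A \<le> r (E - B) + card B"
      using card_mono[of B A] AB finA by auto
    then show "r (E - A) + card A - r E \<le> r (E - B) + card B - r E" by (rule diff_le_mono)
  next
    fix A B assume AB: "A \<subseteq> E" "B \<subseteq> E"
    have "r ((E - A) \<union> (E - B)) + r ((E - A) \<inter> (E - B)) \<le> r (E - A) + r (E - B)"
      by (rule submod) auto
    moreover have "(E - A) \<union> (E - B) = E - A \<inter> B" "(E - A) \<inter> (E - B) = E - (A \<union> B)" by auto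
    moreover have "card (A \<union> B) + card (A \<inter> B) = card A + card B"
      by (rule card_Un_Int[symmetric]) (use finA AB in auto)
    ultimately have sum_le: "(r (E - (A \<union> B)) + card (A \<union> B)) + (r (E - A \<inter> B) + card (A \<inter> B))
        \<le> (r (E - A) + card A) + (r (E - B) + card B)"
      by simp
    have "A \<union> B \<subseteq> E" "A \<inter> B \<subseteq> E" using AB by auto
    from rE[OF this(1)] rE[OF this(2)] rE[OF AB(1)] rE[OF AB(2)] obtain p1 p2 p3 p4 where
      "r (E - (A \<union> B)) + card (A \<union> B) = r E + p1" "r (E - A \<inter> B) + card (A \<inter> B) = r E + p2"
      "r (E - A) + card A = r E + p3" "r (E - B) + card B = r E + p4"
      unfolding le_iff_add by blast
    with sum_le show "r (E - (A \<union> B)) + card (A \<union> B) - r E + (r (E - A \<inter> B) + card (A \<inter> B) - r E)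
        \<le> r (E - A) + card A - r E + (r (E - B) + card B - r E)"
      by simp
  qed
qed

text \<open>
  Adding elements one at a time: if \<open>e\<close> raises the rank of \<open>A\<close>, then submodularity forces it to
  raise the rank of a basis of \<open>A\<close>.
\<close>

lemma matroid_basis:
  assumes "matroid E r" "A \<subseteq> E"
  obtains I where "I \<subseteq> A" "r I = card I" "r I = r A"
proof -
  have fin: "finite E" and le: "\<And>A. A \<subseteq> E \<Longrightarrow> r A \<le> card A"
    and mono: "\<And>A B. A \<subseteq> B \<Longrightarrow> B \<subseteq> E \<Longrightarrow> r A \<le> r B"
    and submod: "\<And>A B. A \<subseteq> E \<Longrightarrow> B \<subseteq> E \<Longrightarrow> r (A \<union> B) + r (A \<inter> B) \<le> r A + r B"
    using assms(1) by (auto simp: matroid_def)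
  have "finite A" using assms(2) fin by (rule finite_subset)
  then have "\<exists>I\<subseteq>A. r I = card I \<and> r I = r A"
    using assms(2)
  proof (induction A rule: finite_induct)
    case empty
    then show ?case using le[of "{}"] by auto
  next
    case (insert e A)
    then obtain I where I: "I \<subseteq> A" "r I = card I" "r I = r A" by auto
    have AE: "A \<subseteq> E" "insert e A \<subseteq> E" using insert by auto
    show ?case
    proof (cases "r (insert e A) = r A")
      case True
      then show ?thesis using I by (intro exI[of _ I]) auto
    next
      case False
      have "r A \<le> r (insert e A)" using AE by (intro mono) auto
      then have less: "r A < r (insert e A)" using False by simp
      have IE: "insert e I \<subseteq> E" using I AE by auto
      have "r (insert e I \<union> A) + r (insert e I \<inter> A) \<le> r (insert e I) + r A"
        by (rule submod[OF IE AE(1)])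
      moreover have "insert e I \<union> A = insert e A" "insert e I \<inter> A = I" using I insert by auto
      ultimately have ge: "r (insert e A) \<le> r (insert e I)" using I by simp
      have "card (insert e I) = Suc (card I)"
        using I insert by (meson card_insert_disjoint finite_subset subsetD)
      moreover have "r (insert e I) \<le> card (insert e I)" using IE by (rule le)
      moreover have "r (insert e I) \<le> r (insert e A)" using I AE by (intro mono) auto
      ultimately show ?thesis
        using ge less I by (intro exI[of _ "insert e I"]) auto
    qed
  qed
  then show thesis using that by blast
qed

section \<open>Ranks and translations of central sets\<close>

context almost_arithmetic_semimatroid
begin

sublocale G: group G
  using group_hom by (simp add: group_hom_def)

lemma orbit_subset: "x \<in> S \<Longrightarrow> y \<in> orbit G \<phi> x \<Longrightarrow> y \<in> S"
  using element_image by (auto simp: orbit_def)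

lemma orbit_eq_of_mem:
  assumes "x \<in> S" "y \<in> orbit G \<phi> x" shows "orbit G \<phi> y = orbit G \<phi> x"
proof -
  have y: "y \<in> S" by (rule orbit_subset[OF assms])
  have x: "x \<in> orbit G \<phi> y" by (rule orbit_sym[OF assms(1) y assms(2)])
  show ?thesis
    using orbit_trans[OF assms(1) y _ assms(2)] orbit_trans[OF y assms(1) _ x] orbit_subset assms(1) y
    by blast
qed

text \<open>
  The form in which translativity is used throughout: central sets meet every orbit at most once.
\<close>

lemma central_same_orbit:
  assumes "X \<in> C" "x \<in> X" "y \<in> X" "y \<in> orbit G \<phi> x" shows "y = x"
proof -
  obtain g where g: "g \<in> carrier G" "y = \<phi> g x" using assms(4) by (auto simp: orbit_def)
  have "{x, \<phi> g x} \<in> C" using assms g by (intro central_down_closed[OF assms(1)]) auto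
  moreover have "x \<in> S" using assms central_subset by auto
  ultimately show ?thesis using translative g by (auto simp: translative_action_def)
qed

lemma inj_on_orbit: "X \<in> C \<Longrightarrow> inj_on (orbit G \<phi>) X"
proof (rule inj_onI)
  fix x y assume "X \<in> C" "x \<in> X" "y \<in> X" "orbit G \<phi> x = orbit G \<phi> y"
  moreover from this have "x \<in> S" using central_subset by auto
  ultimately show "x = y"
    using central_same_orbit[of X y x] orbit_refl[of x] by auto
qed

text \<open>
  Otherwise CR2 adds to \<open>X\<close> a point of \<open>Y\<close> whose orbit already meets \<open>X\<close>.
\<close>

lemma rk_le_of_orbit_set_subset:
  assumes X: "X \<in> C" and Y: "Y \<in> C" and sub: "orbit_set G \<phi> Y \<subseteq> orbit_set G \<phi> X"
  shows "rk Y \<le> rk X"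
proof (rule ccontr)
  assume "\<not> rk Y \<le> rk X"
  then obtain y where y: "y \<in> Y" "y \<notin> X" and Xy: "X \<union> {y} \<in> C" using CR2[OF X Y] by auto
  have "orbit G \<phi> y \<in> orbit_set G \<phi> X" using sub y(1) by (auto simp: orbit_set_def)
  then obtain x where x: "x \<in> X" "orbit G \<phi> y = orbit G \<phi> x" by (auto simp: orbit_set_def)
  have "y = x" using inj_onD[OF inj_on_orbit[OF Xy] x(2)] x(1) by simp
  then show False using x(1) y(2) by simp
qed

text \<open>
  Every central lift attains the maximum that defines the rank of a set of orbits.
\<close>

lemma orbit_rank_orbit_set:
  assumes X: "X \<in> C" shows "orbit_rank C rk G \<phi> (orbit_set G \<phi> X) = rk X"
  unfolding orbit_rank_def
proof (rule Max_eqI)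
  let ?R = "{rk Y | Y. Y \<in> C \<and> orbit_set G \<phi> Y \<subseteq> orbit_set G \<phi> X}"
  obtain n where "\<forall>X\<in>C. rk X \<le> n" using rk_bounded by blast
  then have "?R \<subseteq> {..n}" by blast
  then show "finite ?R" by (rule finite_subset) simp
  show "rk X \<in> ?R" using X by blast
  show "y \<le> rk X" if "y \<in> ?R" for y
    using that rk_le_of_orbit_set_subset[OF X] by blast
qed

lemma sublift:
  assumes "X \<in> C" "A \<subseteq> orbit_set G \<phi> X"
  shows "{x \<in> X. orbit G \<phi> x \<in> A} \<in> C" "orbit_set G \<phi> {x \<in> X. orbit G \<phi> x \<in> A} = A"
    "card {x \<in> X. orbit G \<phi> x \<in> A} = card A"
proof -
  let ?Y = "{x \<in> X. orbit G \<phi> x \<in> A}"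
  show Y: "?Y \<in> C" by (rule central_down_closed[OF assms(1)]) auto
  show eq: "orbit_set G \<phi> ?Y = A" using assms(2) by (auto simp: orbit_set_def)
  show "card ?Y = card A"
    using card_image[OF inj_on_orbit[OF Y]] eq by (simp add: orbit_set_def)
qed

text \<open>
  The orbits met by \<open>X\<close> correspond to the points of \<open>X\<close>, and under this correspondence the rank
  of orbits is the rank of subsets of \<open>X\<close>, for which R1, R2 and R3 are the matroid axioms.
\<close>

theorem matroid_orbit_rank:
  assumes X: "X \<in> C" shows "matroid (orbit_set G \<phi> X) (orbit_rank C rk G \<phi>)"
proof -
  define Y where "Y A = {x \<in> X. orbit G \<phi> x \<in> A}" for A
  have Y: "Y A \<in> C" "card (Y A) = card A" "orbit_rank C rk G \<phi> A = rk (Y A)"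
    if "A \<subseteq> orbit_set G \<phi> X" for A
    using sublift[OF X that] orbit_rank_orbit_set[of "Y A"] by (simp_all add: Y_def)
  have Un: "Y (A \<union> B) = Y A \<union> Y B" and Int: "Y (A \<inter> B) = Y A \<inter> Y B" for A B
    by (auto simp: Y_def)
  show ?thesis
    unfolding matroid_def
  proof (intro conjI allI impI)
    show "finite (orbit_set G \<phi> X)" using central_finite[OF X] by (simp add: orbit_set_def)
  next
    fix A assume A: "A \<subseteq> orbit_set G \<phi> X"
    then show "orbit_rank C rk G \<phi> A \<le> card A" using R1[OF Y(1)[OF A]] Y(2,3)[OF A] by simp
  next
    fix A B assume AB: "A \<subseteq> B \<and> B \<subseteq> orbit_set G \<phi> X"
    then have A: "A \<subseteq> orbit_set G \<phi> X" and B: "B \<subseteq> orbit_set G \<phi> X" by auto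
    have "Y A \<subseteq> Y B" using AB by (auto simp: Y_def)
    then show "orbit_rank C rk G \<phi> A \<le> orbit_rank C rk G \<phi> B"
      using R2[OF Y(1)[OF A] Y(1)[OF B]] Y(3)[OF A] Y(3)[OF B] by simp
  next
    fix A B assume A: "A \<subseteq> orbit_set G \<phi> X" and B: "B \<subseteq> orbit_set G \<phi> X"
    then have U: "A \<union> B \<subseteq> orbit_set G \<phi> X" and I: "A \<inter> B \<subseteq> orbit_set G \<phi> X" by auto
    have "Y A \<union> Y B \<in> C" using Y(1)[OF U] by (simp add: Un)
    then show "orbit_rank C rk G \<phi> (A \<union> B) + orbit_rank C rk G \<phi> (A \<inter> B)
        \<le> orbit_rank C rk G \<phi> A + orbit_rank C rk G \<phi> B"
      using R3[OF Y(1)[OF A] Y(1)[OF B]] Y(3)[OF A] Y(3)[OF B] Y(3)[OF U] Y(3)[OF I]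
      by (simp add: Un Int)
  qed
qed

lemma orbit_set_image:
  assumes "X \<subseteq> S" "\<And>x. x \<in> X \<Longrightarrow> f x \<in> orbit G \<phi> x"
  shows "orbit_set G \<phi> (f ` X) = orbit_set G \<phi> X"
proof -
  have "orbit G \<phi> (f x) = orbit G \<phi> x" if "x \<in> X" for x
    using that assms by (intro orbit_eq_of_mem) auto
  then show ?thesis by (simp add: orbit_set_def image_image)
qed

text \<open>
  The points of an independent central set can be moved independently of each other inside their
  orbits. Suppose all points but \<open>x\<close> have been moved. The result has smaller rank than the
  original set \<open>X\<close>, so CR2 adds a point of \<open>X\<close>, and by translativity it can only be \<open>x\<close>. To move
  \<open>x\<close> by \<open>g\<close> as well, the other points are first moved by what remains after undoing \<open>g\<close>, and \<open>g\<close>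
  is applied at the end to the whole set.
\<close>

lemma independent_translate_central:
  assumes "X \<in> C" "rk X = card X" "\<And>x. x \<in> X \<Longrightarrow> f x \<in> orbit G \<phi> x"
  shows "f ` X \<in> C"
proof -
  have "finite X" using assms(1) by (rule central_finite)
  then show ?thesis
    using assms
  proof (induction X arbitrary: f rule: finite_induct)
    case empty
    then show ?case by simp
  next
    case (insert x X)
    have X: "X \<in> C" by (rule central_down_closed[OF insert.prems(1)]) auto
    have S: "insert x X \<subseteq> S" by (rule central_subset[OF insert.prems(1)])
    have xC: "{x} \<in> C" using S by (intro central_singleton) auto
    have "rk (X \<union> {x}) + rk (X \<inter> {x}) \<le> rk X + rk {x}"
      by (rule R3[OF X xC]) (use insert.prems(1) in simp)
    moreover have "rk {x} \<le> 1" using R1[OF xC] by simp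
    ultimately have rkX: "rk X = card X"
      using R1[OF X] insert.prems(2) insert.hyps by simp
    obtain g where g: "g \<in> carrier G" "f x = \<phi> g x"
      using insert.prems(3)[of x] by (auto simp: orbit_def)
    define f' where "f' y = \<phi> (inv g) (f y)" for y
    have fS: "f y \<in> S" if "y \<in> X" for y
      using orbit_subset[of y "f y"] insert.prems(3)[of y] S that by auto
    have f': "f' y \<in> orbit G \<phi> y" if "y \<in> X" for y
    proof -
      obtain k where k: "k \<in> carrier G" "f y = \<phi> k y"
        using insert.prems(3)[of y] \<open>y \<in> X\<close> by (auto simp: orbit_def)
      have "f' y = \<phi> (inv g \<otimes> k) y"
        unfolding f'_def k(2) using composition_rule[of y "inv g" k] S \<open>y \<in> X\<close> g k by auto
      then show ?thesis using g k by (auto simp: orbit_def)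
    qed
    have Z: "f' ` X \<in> C" by (rule insert.IH[OF X rkX f'])
    have orbs: "orbit_set G \<phi> (f' ` X) = orbit_set G \<phi> X"
      by (rule orbit_set_image) (use S f' in auto)
    have "rk (f' ` X) \<le> rk X" by (rule rk_le_of_orbit_set_subset[OF X Z]) (simp add: orbs)
    also have "\<dots> < rk (insert x X)" using rkX insert.prems(2) insert.hyps by simp
    finally obtain y where y: "y \<in> insert x X" "y \<notin> f' ` X" and yZ: "f' ` X \<union> {y} \<in> C"
      using CR2[OF Z insert.prems(1)] by blast
    have "y \<notin> X"
    proof
      assume "y \<in> X"
      then have "f' y = y" using central_same_orbit[OF yZ, of y "f' y"] f' by auto
      then show False using y(2) \<open>y \<in> X\<close> by (metis imageI)
    qed
    then have "insert x (f' ` X) \<in> C" using y(1) yZ by auto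
    then have "\<phi> g ` insert x (f' ` X) \<in> C" by (rule central_invariant[OF g(1)])
    moreover have "\<phi> g (f' y) = f y" if "y \<in> X" for y
      unfolding f'_def
      using orbit_sym_aux[of "inv g" "f y" "\<phi> (inv g) (f y)"] fS[OF that] g by simp
    ultimately show ?case using g(2) by (simp add: image_image cong: image_cong)
  qed
qed

text \<open>
  The intersection of \<open>X\<close> and its translate contains \<open>I\<close> and hence has full rank, so CR1 makes the
  union central, and there translativity identifies each point with its translate.
\<close>

lemma translate_eq_of_fixes_basis:
  assumes X: "X \<in> C" and fX: "f ` X \<in> C" and f: "\<And>x. x \<in> X \<Longrightarrow> f x \<in> orbit G \<phi> x"
    and I: "I \<subseteq> X" "rk I = rk X" and fix_I: "\<And>x. x \<in> I \<Longrightarrow> f x = x"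
    and x: "x \<in> X"
  shows "f x = x"
proof -
  have XfX: "X \<inter> f ` X \<in> C" by (rule central_down_closed[OF X]) auto
  have "I \<subseteq> X \<inter> f ` X" using I(1) fix_I by force
  then have "rk I \<le> rk (X \<inter> f ` X)"
    by (intro R2 XfX central_down_closed[OF X I(1)])
  moreover have "rk (X \<inter> f ` X) \<le> rk X" by (rule R2[OF XfX X]) auto
  ultimately have "X \<union> f ` X \<in> C" using I(2) by (intro CR1[OF X fX]) simp
  then show ?thesis by (rule central_same_orbit) (use x f in auto)
qed

lemma stabilizer_normal: "x \<in> S \<Longrightarrow> stabilizer G \<phi> x \<lhd> G"
  using normal by (simp add: normal_action_def)

text \<open>
  Stabilizers along an orbit are conjugate, hence equal by normality.
\<close>

lemma stabilizer_translate:
  assumes x: "x \<in> S" and g: "g \<in> carrier G"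
  shows "stabilizer G \<phi> (\<phi> g x) = stabilizer G \<phi> x"
proof -
  have sub: "stabilizer G \<phi> y \<subseteq> stabilizer G \<phi> (\<phi> k y)"
    if y: "y \<in> S" and k: "k \<in> carrier G" for y k
  proof
    fix h assume h: "h \<in> stabilizer G \<phi> y"
    then have hG: "h \<in> carrier G" by (simp add: stabilizer_def)
    have "inv k \<otimes> h \<otimes> k \<in> stabilizer G \<phi> y"
      by (rule normal.inv_op_closed1[OF stabilizer_normal[OF y] k h])
    then have fix_y: "\<phi> (inv k \<otimes> h \<otimes> k) y = y" by (simp add: stabilizer_def)
    have "\<phi> h (\<phi> k y) = \<phi> (k \<otimes> (inv k \<otimes> h \<otimes> k)) y"
      using y k hG by (simp add: composition_rule[symmetric] G.m_assoc[symmetric])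
    also have "\<dots> = \<phi> k (\<phi> (inv k \<otimes> h \<otimes> k) y)" using y k hG by (intro composition_rule) auto
    finally show "h \<in> stabilizer G \<phi> (\<phi> k y)" using hG fix_y by (simp add: stabilizer_def)
  qed
  have gx: "\<phi> g x \<in> S" using element_image[OF g x refl] .
  have "\<phi> (inv g) (\<phi> g x) = x" using orbit_sym_aux[OF g x refl] .
  then show ?thesis using sub[OF x g] sub[OF gx, of "inv g"] g by auto
qed

lemma orbit_stab_orbit:
  assumes x: "x \<in> S" shows "orbit_stab G \<phi> (orbit G \<phi> x) = stabilizer G \<phi> x"
proof -
  have "(SOME y. y \<in> orbit G \<phi> x) \<in> orbit G \<phi> x" using orbit_refl[OF x] by (rule someI)
  then obtain g where "g \<in> carrier G" "(SOME y. y \<in> orbit G \<phi> x) = \<phi> g x" by (auto simp: orbit_def)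
  then show ?thesis using stabilizer_translate[OF x] by (simp add: orbit_stab_def)
qed

lemma orbit_stab_normal: "a \<in> orbits G S \<phi> \<Longrightarrow> orbit_stab G \<phi> a \<lhd> G"
  using stabilizer_normal orbit_stab_orbit by (auto simp: orbits_def)

lemma coset_action_eq:
  assumes x: "x \<in> S" and g: "g \<in> carrier G"
  shows "coset_action \<phi> (stabilizer G \<phi> x #> g) x = \<phi> g x"
  unfolding coset_action_def
proof (rule the_equality)
  interpret N: normal "stabilizer G \<phi> x" G by (rule stabilizer_normal[OF x])
  have "g \<in> stabilizer G \<phi> x #> g" by (rule G.rcos_self[OF g N.subgroup_axioms])
  then show "\<exists>h\<in>stabilizer G \<phi> x #> g. \<phi> g x = \<phi> h x" by blast
  fix y assume "\<exists>h\<in>stabilizer G \<phi> x #> g. y = \<phi> h x"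
  then obtain s where s: "s \<in> stabilizer G \<phi> x" "y = \<phi> (s \<otimes> g) x" by (auto simp: r_coset_def)
  have "s \<in> stabilizer G \<phi> (\<phi> g x)" using s(1) stabilizer_translate[OF x g] by simp
  then have "\<phi> s (\<phi> g x) = \<phi> g x" unfolding stabilizer_def by blast
  then show "y = \<phi> g x"
    unfolding s(2) composition_rule[OF x N.mem_carrier[OF s(1)] g] .
qed

lemma translate_eq_iff_coset_eq:
  assumes x: "x \<in> S" and g: "g \<in> carrier G" and h: "h \<in> carrier G"
  shows "\<phi> g x = \<phi> h x \<longleftrightarrow> stabilizer G \<phi> x #> g = stabilizer G \<phi> x #> h"
proof
  interpret N: normal "stabilizer G \<phi> x" G by (rule stabilizer_normal[OF x])
  assume eq: "\<phi> g x = \<phi> h x"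
  have "\<phi> (g \<otimes> inv h) (\<phi> h x) = \<phi> (g \<otimes> inv h \<otimes> h) x"
    by (rule composition_rule[symmetric]) (use x g h in auto)
  also have "g \<otimes> inv h \<otimes> h = g" using g h by (simp add: G.m_assoc)
  finally have "\<phi> (g \<otimes> inv h) (\<phi> h x) = \<phi> h x" unfolding eq .
  then have "g \<otimes> inv h \<in> stabilizer G \<phi> (\<phi> h x)"
    unfolding stabilizer_def using g h by blast
  then have "g \<otimes> inv h \<in> stabilizer G \<phi> x" using stabilizer_translate[OF x h] by simp
  then have "g \<in> stabilizer G \<phi> x #> h"
    using N.rcos_module_rev[OF G.is_group h g] by simp
  then show "stabilizer G \<phi> x #> g = stabilizer G \<phi> x #> h"
    using G.repr_independence[OF _ h N.subgroup_axioms] by simp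
next
  assume "stabilizer G \<phi> x #> g = stabilizer G \<phi> x #> h"
  then show "\<phi> g x = \<phi> h x" using coset_action_eq[OF x g] coset_action_eq[OF x h] by simp
qed

end

section \<open>Orbits of central lifts\<close>

context almost_arithmetic_semimatroid
begin

text \<open>
  The point \<open>\<gamma>.x\<close> for a translation \<open>\<gamma>\<close> indexed by orbits. With orbits as indices, translations
  of different lifts of one set of orbits live in the same group.
\<close>

definition coset_translate
  where "coset_translate \<gamma> x = coset_action \<phi> (\<gamma> (orbit G \<phi> x)) x"

lemma orbit_set_subset: "X \<in> C \<Longrightarrow> orbit_set G \<phi> X \<subseteq> orbits G S \<phi>"
  using central_subset by (auto simp: orbit_set_def orbits_def)

lemma coset_translate_rep:
  assumes X: "X \<in> C" and \<gamma>: "\<gamma> \<in> carrier (orbit_Gam_set G \<phi> (orbit_set G \<phi> X))" and x: "x \<in> X"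
  obtains g where "g \<in> carrier G" "\<gamma> (orbit G \<phi> x) = stabilizer G \<phi> x #> g"
    "coset_translate \<gamma> x = \<phi> g x"
proof -
  have xS: "x \<in> S" using central_subset[OF X] x by auto
  have "orbit G \<phi> x \<in> orbit_set G \<phi> X" using x by (auto simp: orbit_set_def)
  then have "\<gamma> (orbit G \<phi> x) \<in> carrier (G Mod stabilizer G \<phi> x)"
    using \<gamma> by (auto simp: orbit_Gam_set_def orbit_Gam_def orbit_stab_orbit[OF xS] dest: PiE_mem)
  then obtain g where g: "g \<in> carrier G" "\<gamma> (orbit G \<phi> x) = stabilizer G \<phi> x #> g"
    by (auto simp: carrier_FactGroup)
  then have "coset_translate \<gamma> x = \<phi> g x" by (simp add: coset_translate_def coset_action_eq[OF xS])
  with g show thesis by (rule that)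
qed

lemma coset_translate_in_orbit:
  assumes "X \<in> C" "\<gamma> \<in> carrier (orbit_Gam_set G \<phi> (orbit_set G \<phi> X))" "x \<in> X"
  shows "coset_translate \<gamma> x \<in> orbit G \<phi> x"
  by (rule coset_translate_rep[OF assms]) (auto simp: orbit_def)

text \<open>
  Two translates of \<open>x\<close> in one central set coincide by translativity, and a coset of a stabilizer is
  determined by the point to which it moves \<open>x\<close>.
\<close>

lemma coset_translate_inj:
  assumes X: "X \<in> C" and \<gamma>: "\<gamma> \<in> carrier (orbit_Gam_set G \<phi> (orbit_set G \<phi> X))"
    and \<delta>: "\<delta> \<in> carrier (orbit_Gam_set G \<phi> (orbit_set G \<phi> X))"
    and eq: "coset_translate \<gamma> ` X = coset_translate \<delta> ` X" and central: "coset_translate \<delta> ` X \<in> C"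
  shows "\<gamma> = \<delta>"
proof (rule extensionalityI[of _ "orbit_set G \<phi> X"])
  show "\<gamma> \<in> extensional (orbit_set G \<phi> X)" "\<delta> \<in> extensional (orbit_set G \<phi> X)"
    using \<gamma> \<delta> by (simp_all add: orbit_Gam_set_def PiE_iff)
  fix a assume "a \<in> orbit_set G \<phi> X"
  then obtain x where x: "x \<in> X" "a = orbit G \<phi> x" by (auto simp: orbit_set_def)
  have xS: "x \<in> S" using central_subset[OF X] x by auto
  have orb: "coset_translate \<gamma> x \<in> orbit G \<phi> x" "coset_translate \<delta> x \<in> orbit G \<phi> x"
    using coset_translate_in_orbit[OF X] \<gamma> \<delta> x by auto
  have mem: "coset_translate \<gamma> x \<in> coset_translate \<delta> ` X" "coset_translate \<delta> x \<in> coset_translate \<delta> ` X"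
    using eq x by blast+
  have "coset_translate \<gamma> x \<in> orbit G \<phi> (coset_translate \<delta> x)"
    using orbit_eq_of_mem[OF xS orb(2)] orb(1) by simp
  then have same: "coset_translate \<gamma> x = coset_translate \<delta> x"
    by (rule central_same_orbit[OF central mem(2,1)])
  obtain g where g: "g \<in> carrier G" "\<gamma> (orbit G \<phi> x) = stabilizer G \<phi> x #> g"
    "coset_translate \<gamma> x = \<phi> g x" using coset_translate_rep[OF X \<gamma> x(1)] .
  obtain h where h: "h \<in> carrier G" "\<delta> (orbit G \<phi> x) = stabilizer G \<phi> x #> h"
    "coset_translate \<delta> x = \<phi> h x" using coset_translate_rep[OF X \<delta> x(1)] .
  have "\<phi> g x = \<phi> h x" using same g(3) h(3) by simp
  then have "stabilizer G \<phi> x #> g = stabilizer G \<phi> x #> h"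
    using translate_eq_iff_coset_eq[OF xS g(1) h(1)] by blast
  then show "\<gamma> a = \<delta> a" using g(2) h(2) x(2) by simp
qed

lemma coset_translate_orbit_h_mult:
  assumes X: "X \<in> C" and \<delta>: "\<delta> \<in> carrier (orbit_Gam_set G \<phi> (orbit_set G \<phi> X))"
    and g: "g \<in> carrier G" and x: "x \<in> X"
  shows "coset_translate (orbit_h G \<phi> (orbit_set G \<phi> X) g
      \<otimes>\<^bsub>orbit_Gam_set G \<phi> (orbit_set G \<phi> X)\<^esub> \<delta>) x = \<phi> g (coset_translate \<delta> x)"
proof -
  have xS: "x \<in> S" using central_subset[OF X] x by auto
  have orb: "orbit G \<phi> x \<in> orbit_set G \<phi> X" using x by (auto simp: orbit_set_def)
  interpret N: normal "stabilizer G \<phi> x" G by (rule stabilizer_normal[OF xS])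
  obtain h where h: "h \<in> carrier G" "\<delta> (orbit G \<phi> x) = stabilizer G \<phi> x #> h"
    "coset_translate \<delta> x = \<phi> h x" using coset_translate_rep[OF X \<delta> x] .
  have "(orbit_h G \<phi> (orbit_set G \<phi> X) g \<otimes>\<^bsub>orbit_Gam_set G \<phi> (orbit_set G \<phi> X)\<^esub> \<delta>) (orbit G \<phi> x)
      = (stabilizer G \<phi> x #> g) <#> (stabilizer G \<phi> x #> h)"
    using orb by (simp add: orbit_h_def orbit_Gam_set_def orbit_Gam_def orbit_stab_orbit[OF xS] h(2))
  also have "\<dots> = stabilizer G \<phi> x #> (g \<otimes> h)" by (rule N.rcos_sum[OF g h(1)])
  finally have "coset_translate (orbit_h G \<phi> (orbit_set G \<phi> X) g
      \<otimes>\<^bsub>orbit_Gam_set G \<phi> (orbit_set G \<phi> X)\<^esub> \<delta>) x = \<phi> (g \<otimes> h) x"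
    using coset_action_eq[OF xS, of "g \<otimes> h"] g h(1) unfolding coset_translate_def by simp
  also have "\<dots> = \<phi> g (coset_translate \<delta> x)" unfolding h(3) by (rule composition_rule[OF xS g h(1)])
  finally show ?thesis .
qed

lemma central_lift_is_coset_translate:
  assumes X: "X \<in> C" and Y: "Y \<in> C" "orbit_set G \<phi> Y = orbit_set G \<phi> X"
  obtains \<gamma> where "\<gamma> \<in> carrier (orbit_Gam_set G \<phi> (orbit_set G \<phi> X))" "coset_translate \<gamma> ` X = Y"
proof -
  have XS: "X \<subseteq> S" and YS: "Y \<subseteq> S" using X Y central_subset by auto
  have "\<exists>g. g \<in> carrier G \<and> \<phi> g x \<in> Y" if x: "x \<in> X" for x
  proof -
    have "orbit G \<phi> x \<in> orbit_set G \<phi> Y" unfolding Y(2) using x by (auto simp: orbit_set_def)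
    then obtain y where y: "y \<in> Y" "orbit G \<phi> x = orbit G \<phi> y" by (auto simp: orbit_set_def)
    have "y \<in> orbit G \<phi> x" unfolding y(2) using orbit_refl[of y] y(1) YS by blast
    then show ?thesis using y(1) by (auto simp: orbit_def)
  qed
  then have "\<exists>g. \<forall>x\<in>X. g x \<in> carrier G \<and> \<phi> (g x) x \<in> Y" by (intro bchoice) blast
  then obtain g where g: "\<And>x. x \<in> X \<Longrightarrow> g x \<in> carrier G" "\<And>x. x \<in> X \<Longrightarrow> \<phi> (g x) x \<in> Y" by blast
  define \<gamma> where "\<gamma> = (\<lambda>a\<in>orbit_set G \<phi> X. orbit_stab G \<phi> a #> g (inv_into X (orbit G \<phi>) a))"
  have \<gamma>_at: "\<gamma> (orbit G \<phi> x) = stabilizer G \<phi> x #> g x" if "x \<in> X" for x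
    using that XS inv_into_f_f[OF inj_on_orbit[OF X] that]
    by (auto simp: \<gamma>_def orbit_set_def orbit_stab_orbit)
  have translate: "coset_translate \<gamma> x = \<phi> (g x) x" if "x \<in> X" for x
    using coset_action_eq[of x "g x"] \<gamma>_at[OF that] g(1)[OF that] XS that
    by (auto simp: coset_translate_def)
  have "\<gamma> a \<in> carrier (orbit_Gam G \<phi> a)" if a: "a \<in> orbit_set G \<phi> X" for a
  proof -
    obtain x where x: "x \<in> X" "a = orbit G \<phi> x" using a by (auto simp: orbit_set_def)
    then have "x \<in> S" using XS by auto
    then show ?thesis
      using \<gamma>_at[OF x(1)] g(1)[OF x(1)] x(2)
      by (simp add: orbit_Gam_def carrier_FactGroup orbit_stab_orbit)
  qed
  then have "\<gamma> \<in> carrier (orbit_Gam_set G \<phi> (orbit_set G \<phi> X))"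
    by (auto simp: orbit_Gam_set_def \<gamma>_def)
  moreover have "coset_translate \<gamma> ` X = Y"
  proof (intro subset_antisym subsetI)
    fix y assume "y \<in> coset_translate \<gamma> ` X"
    then show "y \<in> Y" using translate g(2) by auto
  next
    fix y assume y: "y \<in> Y"
    then have "orbit G \<phi> y \<in> orbit_set G \<phi> X" unfolding Y(2)[symmetric] by (auto simp: orbit_set_def)
    then obtain x where x: "x \<in> X" "orbit G \<phi> y = orbit G \<phi> x" by (auto simp: orbit_set_def)
    have "\<phi> (g x) x \<in> orbit G \<phi> x" using g(1)[OF x(1)] by (auto simp: orbit_def)
    then have "\<phi> (g x) x = y"
      using central_same_orbit[OF Y(1) y g(2)[OF x(1)]] x(2) by simp
    then have "y = coset_translate \<gamma> x" using translate[OF x(1)] by simp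
    then show "y \<in> coset_translate \<gamma> ` X" using x(1) by (rule image_eqI)
  qed
  ultimately show thesis by (rule that)
qed

lemma orbit_set_action_translate:
  assumes "Y \<subseteq> S" "g \<in> carrier G"
  shows "orbit G (set_action \<phi>) (\<phi> g ` Y) = orbit G (set_action \<phi>) Y"
proof -
  have comp: "\<phi> k ` \<phi> h ` Z = \<phi> (k \<otimes> h) ` Z" if "Z \<subseteq> S" "k \<in> carrier G" "h \<in> carrier G" for Z k h
    unfolding image_image by (rule image_cong) (use that composition_rule in auto)
  have sub: "orbit G (set_action \<phi>) (\<phi> h ` Z) \<subseteq> orbit G (set_action \<phi>) Z"
    if Z: "Z \<subseteq> S" and h: "h \<in> carrier G" for Z h
  proof
    fix U assume "U \<in> orbit G (set_action \<phi>) (\<phi> h ` Z)"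
    then obtain k where k: "k \<in> carrier G" "U = \<phi> k ` \<phi> h ` Z" by (auto simp: orbit_def set_action_def)
    have "U = set_action \<phi> (k \<otimes> h) Z" unfolding k(2) set_action_def by (rule comp[OF Z k(1) h])
    then show "U \<in> orbit G (set_action \<phi>) Z" using k(1) h unfolding orbit_def by blast
  qed
  have "\<phi> g ` Y \<subseteq> S" using assms element_image by blast
  moreover have "\<phi> (inv g) ` \<phi> g ` Y = Y"
    using assms orbit_sym_aux[OF assms(2) _ refl] by (force simp: image_image)
  ultimately show ?thesis
    using sub[OF assms] sub[of "\<phi> g ` Y" "inv g"] assms(2) by auto
qed

text \<open>
  Translating \<open>X\<close> by \<open>\<gamma> \<in> W\<close> reaches every central lift of the orbits of \<open>X\<close> exactly once, and
  multiplying \<open>\<gamma>\<close> by the diagonal element of \<open>g\<close> applies \<open>g\<close> to the translate. So cosets of the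
  diagonal image match orbits of \<open>G\<close> on lifts.
\<close>

theorem translation_cosets_biject_lift_orbits:
  fixes X
  defines "P \<equiv> orbit_Gam_set G \<phi> (orbit_set G \<phi> X)"
  defines "L \<equiv> orbit_h G \<phi> (orbit_set G \<phi> X) ` carrier G"
  defines "W \<equiv> {\<gamma> \<in> carrier P. coset_translate \<gamma> ` X \<in> C}"
  assumes X: "X \<in> C" and P: "group P" and L: "subgroup L P"
  shows "\<exists>f. bij_betw f ((\<lambda>\<gamma>. L #>\<^bsub>P\<^esub> \<gamma>) ` W)
    (orbits G (central_lifts C G \<phi> (orbit_set G \<phi> X)) (set_action \<phi>))"
proof -
  interpret P: group P by (rule P)
  interpret L: subgroup L P by (rule L)
  define F where "F \<gamma> = orbit G (set_action \<phi>) (coset_translate \<gamma> ` X)" for \<gamma>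
  have XS: "X \<subseteq> S" using X by (rule central_subset)
  have orb: "coset_translate \<gamma> x \<in> orbit G \<phi> x" if "\<gamma> \<in> carrier P" "x \<in> X" for \<gamma> x
    using coset_translate_in_orbit[OF X] that unfolding P_def by blast
  have mult: "coset_translate (orbit_h G \<phi> (orbit_set G \<phi> X) g \<otimes>\<^bsub>P\<^esub> \<delta>) ` X = \<phi> g ` coset_translate \<delta> ` X"
    if "\<delta> \<in> carrier P" "g \<in> carrier G" for \<delta> g
    unfolding image_image using coset_translate_orbit_h_mult[OF X] that unfolding P_def by simp
  have fibres: "L #>\<^bsub>P\<^esub> \<gamma> = L #>\<^bsub>P\<^esub> \<delta> \<longleftrightarrow> F \<gamma> = F \<delta>" if \<gamma>: "\<gamma> \<in> W" and \<delta>: "\<delta> \<in> W" for \<gamma> \<delta>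
  proof
    have \<gamma>P: "\<gamma> \<in> carrier P" and \<delta>P: "\<delta> \<in> carrier P" and \<delta>C: "coset_translate \<delta> ` X \<in> C"
      using \<gamma> \<delta> by (auto simp: W_def)
    {
      assume "L #>\<^bsub>P\<^esub> \<gamma> = L #>\<^bsub>P\<^esub> \<delta>"
      then have "\<gamma> \<in> L #>\<^bsub>P\<^esub> \<delta>" using P.rcos_self[OF \<gamma>P L] by simp
      then obtain g where g: "g \<in> carrier G" "\<gamma> = orbit_h G \<phi> (orbit_set G \<phi> X) g \<otimes>\<^bsub>P\<^esub> \<delta>"
        by (auto simp: r_coset_def L_def)
      have "F \<gamma> = orbit G (set_action \<phi>) (\<phi> g ` coset_translate \<delta> ` X)"
        unfolding F_def g(2) mult[OF \<delta>P g(1)] ..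
      also have "\<dots> = F \<delta>"
        unfolding F_def by (rule orbit_set_action_translate[OF central_subset[OF \<delta>C] g(1)])
      finally show "F \<gamma> = F \<delta>" .
    }
    {
      assume eq: "F \<gamma> = F \<delta>"
      (* Keeping the action of the identity explicit treats both translates as images under group
         elements, so that the rule mult applies on both sides. *)
      have "\<phi> \<one> ` coset_translate \<gamma> ` X \<in> F \<gamma>" by (auto simp: F_def orbit_def set_action_def)
      then obtain g where g: "g \<in> carrier G" "\<phi> \<one> ` coset_translate \<gamma> ` X = \<phi> g ` coset_translate \<delta> ` X"
        unfolding eq by (auto simp: F_def orbit_def set_action_def)
      let ?\<gamma> = "orbit_h G \<phi> (orbit_set G \<phi> X) \<one> \<otimes>\<^bsub>P\<^esub> \<gamma>"
      let ?\<delta> = "orbit_h G \<phi> (orbit_set G \<phi> X) g \<otimes>\<^bsub>P\<^esub> \<delta>"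
      have hL: "orbit_h G \<phi> (orbit_set G \<phi> X) k \<in> L" if "k \<in> carrier G" for k
        using that by (auto simp: L_def)
      have closed: "?\<gamma> \<in> carrier P" "?\<delta> \<in> carrier P"
        using hL[OF G.one_closed] hL[OF g(1)] \<gamma>P \<delta>P L.mem_carrier by (auto intro!: P.m_closed)
      have "coset_translate ?\<gamma> ` X = coset_translate ?\<delta> ` X"
        using mult[OF \<gamma>P G.one_closed] mult[OF \<delta>P g(1)] g(2) by simp
      moreover have "coset_translate ?\<delta> ` X \<in> C"
        unfolding mult[OF \<delta>P g(1)] by (rule central_invariant[OF g(1) \<delta>C])
      ultimately have eq': "?\<gamma> = ?\<delta>"
        using coset_translate_inj[OF X] closed unfolding P_def by blast
      have "L #>\<^bsub>P\<^esub> (l \<otimes>\<^bsub>P\<^esub> \<epsilon>) = L #>\<^bsub>P\<^esub> \<epsilon>" if "l \<in> L" "\<epsilon> \<in> carrier P" for l \<epsilon>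
        using P.coset_mult_assoc[OF L.subset L.mem_carrier[OF that(1)] that(2)]
          P.coset_join2[OF L.mem_carrier[OF that(1)] L that(1)] by simp
      then show "L #>\<^bsub>P\<^esub> \<gamma> = L #>\<^bsub>P\<^esub> \<delta>"
        using eq' hL[OF G.one_closed] hL[OF g(1)] \<gamma>P \<delta>P by metis
    }
  qed
  have image_F: "F ` W = orbits G (central_lifts C G \<phi> (orbit_set G \<phi> X)) (set_action \<phi>)"
  proof (intro subset_antisym subsetI)
    fix u assume "u \<in> F ` W"
    then obtain \<gamma> where \<gamma>: "\<gamma> \<in> carrier P" "coset_translate \<gamma> ` X \<in> C" "u = F \<gamma>"
      by (auto simp: W_def)
    have "orbit_set G \<phi> (coset_translate \<gamma> ` X) = orbit_set G \<phi> X"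
      by (rule orbit_set_image[OF XS orb[OF \<gamma>(1)]])
    then show "u \<in> orbits G (central_lifts C G \<phi> (orbit_set G \<phi> X)) (set_action \<phi>)"
      using \<gamma>(2,3) by (auto simp: orbits_def central_lifts_def F_def)
  next
    fix u assume "u \<in> orbits G (central_lifts C G \<phi> (orbit_set G \<phi> X)) (set_action \<phi>)"
    then obtain Y where Y: "Y \<in> C" "orbit_set G \<phi> Y = orbit_set G \<phi> X" "u = orbit G (set_action \<phi>) Y"
      by (auto simp: orbits_def central_lifts_def)
    obtain \<gamma> where "\<gamma> \<in> carrier P" "coset_translate \<gamma> ` X = Y"
      using central_lift_is_coset_translate[OF X Y(1,2)] unfolding P_def .
    then show "u \<in> F ` W" using Y by (auto simp: W_def F_def)
  qed
  show ?thesis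
    unfolding image_F[symmetric]
    by (rule exI) (rule bij_betw_images_of_same_fibres[of W "\<lambda>\<gamma>. L #>\<^bsub>P\<^esub> \<gamma>" F, OF fibres])
qed

text \<open>
  Unfolds the choice of a lift in \<^const>\<open>orbit_W\<close> once and for all; the lift that is obtained is the
  chosen one.
\<close>

lemma orbit_W_eq:
  assumes "central_lifts C G \<phi> A \<noteq> {}"
  obtains X where "X \<in> C" "orbit_set G \<phi> X = A"
    "orbit_W C G \<phi> A = {\<gamma> \<in> carrier (orbit_Gam_set G \<phi> A). coset_translate \<gamma> ` X \<in> C}"
proof -
  define X where "X = (SOME X. X \<in> central_lifts C G \<phi> A)"
  obtain Y where "Y \<in> central_lifts C G \<phi> A" using assms by blast
  then have "X \<in> central_lifts C G \<phi> A" unfolding X_def by (rule someI)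
  then have X: "X \<in> C" "orbit_set G \<phi> X = A" by (auto simp: central_lifts_def)
  have "(\<lambda>x\<in>X. \<gamma> (orbit G \<phi> x)) \<in> W_set C G \<phi> X \<longleftrightarrow> coset_translate \<gamma> ` X \<in> C"
    if \<gamma>: "\<gamma> \<in> carrier (orbit_Gam_set G \<phi> A)" for \<gamma>
  proof -
    have "\<gamma> (orbit G \<phi> x) \<in> carrier (Gam G \<phi> x)" if x: "x \<in> X" for x
    proof -
      obtain g where "g \<in> carrier G" "\<gamma> (orbit G \<phi> x) = stabilizer G \<phi> x #> g"
        using coset_translate_rep[OF X(1) _ x] \<gamma> unfolding X(2) by blast
      then show ?thesis by (simp add: Gam_def carrier_FactGroup)
    qed
    moreover have "translate \<phi> (\<lambda>x\<in>X. \<gamma> (orbit G \<phi> x)) X = coset_translate \<gamma> ` X"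
      unfolding translate_def coset_translate_def by (rule image_cong) auto
    ultimately show ?thesis by (auto simp: W_set_def Gam_set_def)
  qed
  then have "orbit_W C G \<phi> A = {\<gamma> \<in> carrier (orbit_Gam_set G \<phi> A). coset_translate \<gamma> ` X \<in> C}"
    unfolding orbit_W_def X_def[symmetric] Let_def by blast
  with X show thesis by (rule that)
qed

end

section \<open>The module of a centered semimatroid\<close>

locale centered_cyclic_semimatroid = almost_arithmetic_semimatroid +
  assumes cofinite: "cofinite_action C G \<phi>"
    and centered: "centered_action S C G \<phi>"
    and cyclic: "a \<in> orbits G S \<phi> \<Longrightarrow> cyclic_group (orbit_Gam G \<phi> a)"
begin

abbreviation "E \<equiv> orbits G S \<phi>"

abbreviation "r \<equiv> orbit_rank C rk G \<phi>"

lemma ex_central_transversal: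
  obtains X where "X \<in> C" "orbit_set G \<phi> X = E"
  using centered by (auto simp: centered_action_def)

lemma matroid_E: "matroid E r"
  using ex_central_transversal matroid_orbit_rank by metis

lemma ex_lift:
  assumes "A \<subseteq> E" obtains X where "X \<in> C" "orbit_set G \<phi> X = A" "card X = card A" "rk X = r A"
proof -
  obtain X0 where X0: "X0 \<in> C" "orbit_set G \<phi> X0 = E" by (rule ex_central_transversal)
  let ?X = "{x \<in> X0. orbit G \<phi> x \<in> A}"
  have "A \<subseteq> orbit_set G \<phi> X0" using assms X0(2) by simp
  note sub = sublift[OF X0(1) this]
  show thesis by (rule that[OF sub]) (use orbit_rank_orbit_set[OF sub(1)] sub(2) in simp)
qed

sublocale PQ: product_quotients G E "orbit_Gam G \<phi>" "\<lambda>a g. orbit_stab G \<phi> a #> g"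
proof (rule product_quotients.intro)
  show "group G" by (rule G.is_group)
  show "product_quotients_axioms G E (orbit_Gam G \<phi>) (\<lambda>a g. orbit_stab G \<phi> a #> g)"
  proof (rule product_quotients_axioms.intro)
    show "finite E" using matroid_E by (simp add: matroid_def)
    show "cyclic_group (orbit_Gam G \<phi> a)" if "a \<in> E" for a using cyclic[OF that] .
    show "group (orbit_Gam G \<phi> a)" if "a \<in> E" for a
      unfolding orbit_Gam_def by (rule normal.factorgroup_is_group[OF orbit_stab_normal[OF that]])
    show "(\<lambda>g. orbit_stab G \<phi> a #> g) \<in> hom G (orbit_Gam G \<phi> a)" if "a \<in> E" for a
      unfolding orbit_Gam_def by (rule normal.r_coset_hom_Mod[OF orbit_stab_normal[OF that]])
  qed
qed

lemma diag_eq_orbit_h: "PQ.diag B = orbit_h G \<phi> B"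
  by (auto simp: PQ.diag_def orbit_h_def)

lemma semimatroid_module_eq: "semimatroid_module S G \<phi> A = PQ.quot (E - A)"
  by (simp add: semimatroid_module_def Let_def orbit_Gam_set_def diag_eq_orbit_h)

text \<open>
  The finiteness comes from cofiniteness: the orbits of lifts are among the orbits of all central
  sets.
\<close>

lemma translation_cosets:
  assumes B: "B \<subseteq> E" and X: "X \<in> C" "orbit_set G \<phi> X = B"
  defines "W \<equiv> {\<gamma> \<in> carrier (PQ.prod_\<Gamma> B). coset_translate \<gamma> ` X \<in> C}"
  shows "finite ((\<lambda>\<gamma>. PQ.diag_image B #>\<^bsub>PQ.prod_\<Gamma> B\<^esub> \<gamma>) ` W)"
    and "card ((\<lambda>\<gamma>. PQ.diag_image B #>\<^bsub>PQ.prod_\<Gamma> B\<^esub> \<gamma>) ` W) = orbit_mult C G \<phi> B"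
proof -
  have "finite (orbits G C (set_action \<phi>))" using cofinite by (simp add: cofinite_action_def)
  moreover have "orbits G (central_lifts C G \<phi> B) (set_action \<phi>) \<subseteq> orbits G C (set_action \<phi>)"
    by (auto simp: orbits_def central_lifts_def)
  ultimately have fin: "finite (orbits G (central_lifts C G \<phi> B) (set_action \<phi>))"
    by (rule finite_subset[rotated])
  have "group (PQ.prod_\<Gamma> B)" using PQ.comm_prod[OF B] by (simp add: comm_group_def)
  then obtain f where f: "bij_betw f ((\<lambda>\<gamma>. PQ.diag_image B #>\<^bsub>PQ.prod_\<Gamma> B\<^esub> \<gamma>) ` W)
      (orbits G (central_lifts C G \<phi> B) (set_action \<phi>))"
    using translation_cosets_biject_lift_orbits[OF X(1)] PQ.subgroup_diag_image[OF B]
    unfolding X(2) W_def orbit_Gam_set_def diag_eq_orbit_h by blast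
  show "finite ((\<lambda>\<gamma>. PQ.diag_image B #>\<^bsub>PQ.prod_\<Gamma> B\<^esub> \<gamma>) ` W)"
    using bij_betw_finite[OF f] fin by simp
  show "card ((\<lambda>\<gamma>. PQ.diag_image B #>\<^bsub>PQ.prod_\<Gamma> B\<^esub> \<gamma>) ` W) = orbit_mult C G \<phi> B"
    using bij_betw_same_card[OF f] by (simp add: orbit_mult_def)
qed

text \<open>
  All translates of a lift of an independent set are central, so the finitely many cosets in
  \<open>translation_cosets\<close> exhaust the whole product.
\<close>

lemma independent_finite_index:
  assumes I: "I \<subseteq> E" "r I = card I" and \<gamma>: "\<gamma> \<in> carrier (PQ.prod_\<Gamma> I)"
  shows "\<exists>n::int. n > 0 \<and> \<gamma> [^]\<^bsub>PQ.prod_\<Gamma> I\<^esub> n \<in> PQ.diag_image I"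
proof -
  let ?P = "PQ.prod_\<Gamma> I" and ?L = "PQ.diag_image I"
  interpret PI: comm_group ?P by (rule PQ.comm_prod[OF I(1)])
  obtain X where X: "X \<in> C" "orbit_set G \<phi> X = I" "card X = card I" "rk X = r I"
    using ex_lift[OF I(1)] .
  have "coset_translate \<delta> ` X \<in> C" if "\<delta> \<in> carrier ?P" for \<delta>
  proof (rule independent_translate_central[OF X(1)])
    show "rk X = card X" using X(3,4) I(2) by simp
    show "coset_translate \<delta> x \<in> orbit G \<phi> x" if "x \<in> X" for x
      using coset_translate_in_orbit[OF X(1) _ that] \<open>\<delta> \<in> carrier ?P\<close>
      unfolding X(2) orbit_Gam_set_def by blast
  qed
  then have all: "{\<gamma> \<in> carrier ?P. coset_translate \<gamma> ` X \<in> C} = carrier ?P" by blast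
  have "finite ((\<lambda>\<gamma>. ?L #>\<^bsub>?P\<^esub> \<gamma>) ` carrier ?P)"
    using translation_cosets(1)[OF I(1) X(1,2)] unfolding all .
  moreover have "range (\<lambda>n::nat. ?L #>\<^bsub>?P\<^esub> \<gamma> [^]\<^bsub>?P\<^esub> n) \<subseteq> (\<lambda>\<gamma>. ?L #>\<^bsub>?P\<^esub> \<gamma>) ` carrier ?P"
    using PI.nat_pow_closed[OF \<gamma>] by blast
  ultimately have fin: "finite (range (\<lambda>n::nat. ?L #>\<^bsub>?P\<^esub> \<gamma> [^]\<^bsub>?P\<^esub> n))"
    by (rule finite_subset[rotated])
  obtain n :: nat where n: "n > 0" "\<gamma> [^]\<^bsub>?P\<^esub> n \<in> ?L"
    using PI.pow_mem_of_finite_cosets[OF PQ.subgroup_diag_image[OF I(1)] \<gamma> fin] .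
  then have "\<gamma> [^]\<^bsub>?P\<^esub> int n \<in> ?L" unfolding int_pow_int by blast
  then show ?thesis using n(1) by (intro exI[of _ "int n"]) simp
qed

text \<open>
  The diagonal element of \<open>g\<close> is trivial at an orbit if and only if \<open>g\<close> fixes the points of this
  orbit; so \<open>g\<close> fixes a basis of a lift of \<open>B\<close> and hence the whole lift.
\<close>

lemma diag_faithful_on_basis:
  assumes B: "B \<subseteq> E" and I: "I \<subseteq> B" "r I = r B"
    and \<gamma>: "\<gamma> \<in> PQ.diag_image B" and triv: "\<And>a. a \<in> I \<Longrightarrow> \<gamma> a = \<one>\<^bsub>orbit_Gam G \<phi> a\<^esub>"
  shows "\<gamma> = \<one>\<^bsub>PQ.prod_\<Gamma> B\<^esub>"
proof -
  obtain g where g: "g \<in> carrier G" "\<gamma> = orbit_h G \<phi> B g" using \<gamma> unfolding diag_eq_orbit_h by blast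
  obtain X where X: "X \<in> C" "orbit_set G \<phi> X = B" "rk X = r B" using ex_lift[OF B] by metis
  have XS: "X \<subseteq> S" using central_subset[OF X(1)] .
  let ?Y = "{x \<in> X. orbit G \<phi> x \<in> I}"
  have Y: "?Y \<in> C" "orbit_set G \<phi> ?Y = I" using sublift[OF X(1), of I] I(1) X(2) by auto
  have rkY: "rk ?Y = rk X" using orbit_rank_orbit_set[OF Y(1)] Y(2) X(3) I(2) by simp
  have fix_iff: "stabilizer G \<phi> x #> g = stabilizer G \<phi> x \<longleftrightarrow> \<phi> g x = x" if "x \<in> S" for x
  proof -
    have sub: "subgroup (stabilizer G \<phi> x) G" by (rule stabilizer_subgroup[OF that])
    have "\<phi> g x = x \<longleftrightarrow> g \<in> stabilizer G \<phi> x" using g(1) by (simp add: stabilizer_def)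
    then show ?thesis using G.coset_join1[OF _ g(1) sub] G.coset_join2[OF g(1) sub] by blast
  qed
  have fixed: "\<phi> g x = x" if "x \<in> X" for x
  proof (rule translate_eq_of_fixes_basis[OF X(1) central_invariant[OF g(1) X(1)] _ _ rkY])
    show "\<phi> g y \<in> orbit G \<phi> y" for y using g(1) by (auto simp: orbit_def)
    show "?Y \<subseteq> X" by blast
    show "x \<in> X" by (rule that)
    fix y assume "y \<in> ?Y"
    then have y: "y \<in> S" "orbit G \<phi> y \<in> I" "orbit G \<phi> y \<in> B" using XS I(1) by auto
    have "stabilizer G \<phi> y #> g = stabilizer G \<phi> y"
      using triv[OF y(2)] y(3) by (simp add: g(2) orbit_h_def orbit_Gam_def orbit_stab_orbit[OF y(1)])
    then show "\<phi> g y = y" using fix_iff[OF y(1)] by blast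
  qed
  show ?thesis
  proof (rule extensionalityI[of _ B])
    show "\<gamma> \<in> extensional B" by (simp add: g(2) orbit_h_def)
    show "\<one>\<^bsub>PQ.prod_\<Gamma> B\<^esub> \<in> extensional B" by simp
    fix a assume a: "a \<in> B"
    then obtain x where x: "x \<in> X" "a = orbit G \<phi> x" using X(2) by (auto simp: orbit_set_def)
    then have xS: "x \<in> S" using XS by blast
    then have "stabilizer G \<phi> x #> g = stabilizer G \<phi> x" using fix_iff fixed[OF x(1)] by blast
    then show "\<gamma> a = \<one>\<^bsub>PQ.prod_\<Gamma> B\<^esub> a"
      using a by (simp add: g(2) orbit_h_def orbit_Gam_def x(2) orbit_stab_orbit[OF xS])
  qed
qed

theorem Z_rank_module:
  assumes B: "B \<subseteq> E" and inf: "\<And>a. a \<in> B \<Longrightarrow> infinite (carrier (orbit_Gam G \<phi> a))"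
  shows "Z_rank (PQ.quot B) = card B - r B"
proof -
  obtain I where I: "I \<subseteq> B" "r I = card I" "r I = r B"
    using matroid_basis[OF matroid_E B] .
  have IE: "I \<subseteq> E" using I(1) B by blast
  have "Z_rank (PQ.quot B) = card (B - I)"
    using PQ.Z_rank_quot[OF B I(1) inf diag_faithful_on_basis[OF B I(1,3)]
        independent_finite_index[OF IE I(2)]] .
  also have "\<dots> = card B - card I"
    using I(1) B PQ.finite_E by (meson card_Diff_subset finite_subset)
  finally show ?thesis using I(2,3) by simp
qed

text \<open>
  The corank of \<open>A\<close> in the dual matroid is \<open>card (E - A) - r (E - A)\<close>, which is the rank of the
  quotient computed in \<open>Z_rank_module\<close>.
\<close>

theorem underlying_matroid_module:
  assumes inf: "\<And>a. a \<in> E \<Longrightarrow> infinite (carrier (orbit_Gam G \<phi> a))"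
  shows "underlying_matroid E (\<lambda>A. PQ.quot (E - A)) (dual_rank E r)"
  unfolding underlying_matroid_def
proof (intro conjI allI impI)
  show "matroid E (dual_rank E r)" by (rule matroid_dual[OF matroid_E])
  fix A assume A: "A \<subseteq> E"
  have "r {} = 0" "r E \<le> card E" "r (E - A) \<le> card (E - A)"
    using matroid_E by (auto simp: matroid_def)
  moreover have "r E \<le> r (E - A) + card A"
  proof -
    have "E - A \<subseteq> E" by blast
    then have "r (A \<union> (E - A)) + r (A \<inter> (E - A)) \<le> r A + r (E - A)" "r A \<le> card A"
      using matroid_E A unfolding matroid_def by blast+
    moreover have "A \<union> (E - A) = E" using A by blast
    ultimately show ?thesis by simp
  qed
  moreover have "card (E - A) + card A = card E"
    using A PQ.finite_E by (metis card_Diff_subset card_mono finite_subset le_add_diff_inverse2)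
  moreover have "Z_rank (PQ.quot (E - A)) = card (E - A) - r (E - A)"
    by (rule Z_rank_module) (use inf in auto)
  ultimately show "int (dual_rank E r E) - int (dual_rank E r A) = int (Z_rank (PQ.quot (E - A)))"
    by (simp add: dual_rank_def)
qed

text \<open>
  The diagonal image lies in \<open>W\<close> because \<open>G\<close> preserves centrality; then \<open>torsion_quot\<close> describes
  the torsion and \<open>translation_cosets\<close> counts it.
\<close>

theorem torsion_module:
  assumes B: "B \<subseteq> E" and inf: "\<And>a. a \<in> B \<Longrightarrow> infinite (carrier (orbit_Gam G \<phi> a))"
    and pure: "pure_subgroup (orbit_W C G \<phi> B) (orbit_Gam_set G \<phi> B)"
  shows "torsion (PQ.quot B) =
      (\<lambda>\<gamma>. PQ.diag_image B #>\<^bsub>PQ.prod_\<Gamma> B\<^esub> \<gamma>) ` orbit_W C G \<phi> B"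
    and "card (torsion (PQ.quot B)) = orbit_mult C G \<phi> B"
proof -
  obtain X0 where "X0 \<in> C" "orbit_set G \<phi> X0 = B" using ex_lift[OF B] by metis
  then have "central_lifts C G \<phi> B \<noteq> {}" by (auto simp: central_lifts_def)
  from orbit_W_eq[OF this] obtain X where X: "X \<in> C" "orbit_set G \<phi> X = B"
    and W: "orbit_W C G \<phi> B = {\<gamma> \<in> carrier (PQ.prod_\<Gamma> B). coset_translate \<gamma> ` X \<in> C}"
    unfolding orbit_Gam_set_def .
  have "PQ.diag_image B \<subseteq> orbit_W C G \<phi> B"
  proof
    fix \<gamma> assume \<gamma>: "\<gamma> \<in> PQ.diag_image B"
    then obtain g where g: "g \<in> carrier G" "\<gamma> = orbit_h G \<phi> B g" unfolding diag_eq_orbit_h by blast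
    have "coset_translate \<gamma> x = \<phi> g x" if "x \<in> X" for x
    proof -
      have "x \<in> S" "orbit G \<phi> x \<in> B" using that X central_subset by (auto simp: orbit_set_def)
      then show ?thesis
        by (simp add: coset_translate_def g orbit_h_def orbit_stab_orbit coset_action_eq)
    qed
    then have "coset_translate \<gamma> ` X = \<phi> g ` X" by (rule image_cong[OF refl])
    then have "coset_translate \<gamma> ` X \<in> C" using central_invariant[OF g(1) X(1)] by simp
    moreover have "\<gamma> \<in> carrier (PQ.prod_\<Gamma> B)"
      using subgroup.subset[OF PQ.subgroup_diag_image[OF B]] \<gamma> by blast
    ultimately show "\<gamma> \<in> orbit_W C G \<phi> B" unfolding W by blast
  qed
  note torsion = PQ.torsion_quot[OF B inf pure[unfolded orbit_Gam_set_def] this]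
  show eq: "torsion (PQ.quot B) = (\<lambda>\<gamma>. PQ.diag_image B #>\<^bsub>PQ.prod_\<Gamma> B\<^esub> \<gamma>) ` orbit_W C G \<phi> B"
    by (rule torsion) (use translation_cosets(1)[OF B X] in \<open>simp_all only: W\<close>)
  show "card (torsion (PQ.quot B)) = orbit_mult C G \<phi> B"
    unfolding eq W by (rule translation_cosets(2)[OF B X])
qed

end

theorem theorem4:
  fixes S :: "'x set" and C :: "'x set set" and rk :: "'x set \<Rightarrow> nat"
    and G :: "('g, 'm) monoid_scheme" and \<phi> :: "'g \<Rightarrow> 'x \<Rightarrow> 'x"
    and E :: "'x set set" and M :: "'x set set \<Rightarrow> ('x set \<Rightarrow> 'g set) set monoid"
  assumes arithmetic: "arithmetic_semimatroid S C rk G \<phi>"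
    and cofinite: "cofinite_action C G \<phi>"
    and centered: "centered_action S C G \<phi>"
    and E: "E = orbits G S \<phi>"
    and M: "M = semimatroid_module S G \<phi>"
    and cyclic: "\<And>a. a \<in> E \<Longrightarrow> cyclic_group (orbit_Gam G \<phi> a)"
  shows "(matroid_over_Z E M \<and> realizable_over_Z E M)
    \<and> ((\<forall>a\<in>E. infinite_cyclic (orbit_Gam G \<phi> a)) \<longrightarrow>
        matroid E (orbit_rank C rk G \<phi>)
        \<and> underlying_matroid E M (dual_rank E (orbit_rank C rk G \<phi>)))
    \<and> ((\<forall>a\<in>E. infinite_cyclic (orbit_Gam G \<phi> a))
        \<and> (\<forall>A\<subseteq>E. pure_subgroup (orbit_W C G \<phi> A) (orbit_Gam_set G \<phi> A)) \<longrightarrow>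
        (\<forall>A\<subseteq>E. M A \<cong>
           free_Z (card (E - A) - orbit_rank C rk G \<phi> (E - A))
           \<times>\<times> ((orbit_Gam_set G \<phi> (E - A))\<lparr>carrier := orbit_W C G \<phi> (E - A)\<rparr>
                 Mod orbit_h G \<phi> (E - A) ` carrier G))
        \<and> underlying_arithmetic_matroid E M
            (dual_rank E (orbit_rank C rk G \<phi>)) (dual_mult E (orbit_mult C G \<phi>)))"
proof -
  interpret arithmetic_semimatroid S C rk G \<phi> by (rule arithmetic)
  interpret T: centered_cyclic_semimatroid S C rk G \<phi>
    using cofinite centered cyclic unfolding E by unfold_locales
  have M': "M = (\<lambda>A. T.PQ.quot (E - A))"
    unfolding M E by (rule ext) (rule T.semimatroid_module_eq)
  have part1: "matroid_over_Z E M" "realizable_over_Z E M"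
    unfolding M' E by (rule T.PQ.realizable_matroid_over_Z)+
  have part2: "matroid E (orbit_rank C rk G \<phi>)"
    "underlying_matroid E M (dual_rank E (orbit_rank C rk G \<phi>))"
    if inf: "\<forall>a\<in>E. infinite_cyclic (orbit_Gam G \<phi> a)"
  proof -
    show "matroid E (orbit_rank C rk G \<phi>)" unfolding E by (rule T.matroid_E)
    show "underlying_matroid E M (dual_rank E (orbit_rank C rk G \<phi>))"
      unfolding M' E by (rule T.underlying_matroid_module)
        (use inf in \<open>simp add: E infinite_cyclic_def\<close>)
  qed
  have iso: "M A \<cong> free_Z (card (E - A) - orbit_rank C rk G \<phi> (E - A))
      \<times>\<times> ((orbit_Gam_set G \<phi> (E - A))\<lparr>carrier := orbit_W C G \<phi> (E - A)\<rparr>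
            Mod orbit_h G \<phi> (E - A) ` carrier G)" (is ?iso)
    and mult: "dual_mult E (orbit_mult C G \<phi>) A = card (torsion (M A))" (is ?mult)
    if inf: "\<forall>a\<in>E. infinite_cyclic (orbit_Gam G \<phi> a)"
      and pure: "\<forall>A\<subseteq>E. pure_subgroup (orbit_W C G \<phi> A) (orbit_Gam_set G \<phi> A)" for A
  proof -
    let ?B = "E - A"
    have B: "?B \<subseteq> orbits G S \<phi>" unfolding E by blast
    have infB: "infinite (carrier (orbit_Gam G \<phi> a))" if "a \<in> ?B" for a
      using inf that by (simp add: infinite_cyclic_def)
    have pureB: "pure_subgroup (orbit_W C G \<phi> ?B) (orbit_Gam_set G \<phi> ?B)" using pure by blast
    note torsion = T.torsion_module[OF B infB pureB]
    have "M A = T.PQ.quot ?B" by (simp only: M')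
    then have "card (torsion (M A)) = orbit_mult C G \<phi> ?B" using torsion(2) by (simp only:)
    then show ?mult by (simp only: dual_mult_def)
    interpret N: comm_group "T.PQ.quot ?B" by (rule T.PQ.comm_quot[OF B])
    have "T.PQ.quot ?B \<cong> free_Z (Z_rank (T.PQ.quot ?B))
        \<times>\<times> (T.PQ.quot ?B)\<lparr>carrier := torsion (T.PQ.quot ?B)\<rparr>"
      by (rule N.fin_gen_iso_free_times_torsion[OF T.PQ.fin_gen_quot[OF B]])
    then have "T.PQ.quot ?B \<cong> free_Z (card ?B - orbit_rank C rk G \<phi> ?B)
        \<times>\<times> ((T.PQ.prod_\<Gamma> ?B)\<lparr>carrier := orbit_W C G \<phi> ?B\<rparr> Mod T.PQ.diag_image ?B)"
      by (simp only: torsion(1) T.Z_rank_module[OF B infB] FactGroup_subgroup_eq)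
    then show ?iso
      unfolding \<open>M A = T.PQ.quot ?B\<close> orbit_Gam_set_def T.diag_eq_orbit_h .
  qed
  show ?thesis
    unfolding underlying_arithmetic_matroid_def using part1 part2 iso mult by blast
qed

end
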